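(* For any $k$-graph $\Lambda$, the maps $\triangledown_*\colon\mathbb{Z}\widetilde Q_*(\widetilde\Lambda)\to\mathcal{P}_*(\Lambda)$ and $\square_*\colon\mathcal{P}_*(\Lambda)\to\mathbb{Z}\widetilde Q_*(\widetilde\Lambda)$ (which are chain maps of complexes of right $\Lambda$-modules) implement a homotopy equivalence between the chain complexes of right $\Lambda$-modules $\mathcal{P}_*(\Lambda)$ and $\mathbb{Z}\widetilde Q_*(\widetilde\Lambda)$; that is, $\square_*\circ\triangledown_*$ and $\triangledown_*\circ\square_*$ are each homotopic, through $\Lambda$-module maps, to the identity chain map.
   Context: $\mathbb{N}$ includes $0$; $e_1,\dots,e_k$ are the canonical generators of $\mathbb{N}^k$; $\Sigma_n$ is the symmetric group on $\{1,\dots,n\}$. **k-graphs.** A $k$-graph is a countable small category $\Lambda$ with a functor $d\colon\Lambda\to\mathbb{N}^k$ ($\mathbb{N}^k$ a one-object category under addition) with the factorization property: if $d(\lambda)=m+n$ there are unique $\mu,\nu$ with $d(\mu)=m$, $d(\nu)=n$, $\lambda=\mu\nu$. Here $\mu\nu$ is defined iff $s(\mu)=r(\nu)$. $\lambda\in\Lambda$ means $\lambda$ is a morphism; objects are identified with identity morphisms, exactly the morphisms of degree $0$ (vertices). $d_i(\lambda)$ is the $i$-th coordinate of $d(\lambda)$. For $0\le m\le n\le d(\lambda)$, $\lambda(m,n)$ is the unique morphism of degree $n-m$ with $\lambda=\lambda'\lambda(m,n)\lambda''$, $d(\lambda')=m$. The color type of $\lambda$ is $C(\lambda)=\{i:d_i(\lambda)>0\}$.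 A right $\Lambda$-module is a contravariant functor from $\Lambda$ to abelian groups; module maps are natural transformations; $\mathbb{Z}^\Lambda$ is the constant module $\mathbb{Z}$. **Cubical complex.** For a $k$-graph $\Gamma$ with degree $d$, $Q_n(\Gamma)=\{\eta\in\Gamma:\sum_id_i(\eta)=n,\ d_i(\eta)\in\{0,1\}\ \forall i\}$, and for $\lambda\in Q_n(\Gamma)$ with $d(\lambda)=\sum_{j=1}^ne_{c_j}$, $c_1<\dots<c_n$, $F^0_j(\lambda)=\lambda(0,d(\lambda)-e_{c_j})$, $F^1_j(\lambda)=\lambda(e_{c_j},d(\lambda))$. $\mathbb{Z}\widetilde Q_n(\Gamma)$ is the free abelian group on $Q_n(\Gamma)$ for $n\ge0$, is $\mathbb{Z}$ for $n=-1$, and $0$ for $n<-1$; $\partial_n(\lambda)=\sum_{j=1}^n\sum_{l=0}^1(-1)^{j+l}F^l_j(\lambda)$ for $n\ge1$, and $\partial_0$ sends each vertex to $1$. For a vertex $v$ of $\Lambda$, $\widetilde\Lambda(v)$ is the $k$-graph whose objects are the morphisms of $\Lambda$ with source $v$ and whose morphisms are the composable pairs $(\eta,\mu)$ with $s(\mu)=v$; $(\eta,\mu)$ has source $\mu$, range $\eta\mu$, degree $d(\eta)$. $\mathbb{Z}\widetilde Q_n(\widetilde\Lambda)$ is the right $\Lambda$-module $v\mapsto\mathbb{Z}\widetilde Q_n(\widetilde\Lambda(v))$, with action $(\eta,\mu)\cdot\lambda=(\eta,\mu\lambda)$ for $n\ge0$, and equal to $\mathbb{Z}^\Lambda$ for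 $n=-1$. **Simplicial complex.** For $n\ge0$, $\mathcal{P}_n(\Lambda)(v)$ is the free abelian group on $\Lambda^{*(n+1)}v$, the set of composable tuples $(\lambda_0,\dots,\lambda_n)$ ($s(\lambda_{i-1})=r(\lambda_i)$) with $s(\lambda_n)=v$; the action is $(\lambda_0,\dots,\lambda_n)\cdot\lambda=(\lambda_0,\dots,\lambda_n\lambda)$. $\mathcal{P}_{-1}(\Lambda)=\mathbb{Z}^\Lambda$ and $\mathcal{P}_n(\Lambda)=0$ for $n<-1$. For $n>0$, $\partial_n^{\mathcal{P}}(\lambda_0,\dots,\lambda_n)=(\lambda_1,\dots,\lambda_n)+\sum_{i=1}^n(-1)^i(\lambda_0,\dots,\lambda_{i-1}\lambda_i,\dots,\lambda_n)$, and $\partial_0^{\mathcal{P}}(\lambda)=1$. **The map $\triangledown_*$.** For $n\ge0$ and $(\lambda,\mu)\in Q_n(\widetilde\Lambda(v))$, with $d(\lambda)=\sum_{j=1}^ne_{c_j}$, $c_1<\dots<c_n$, and $\sigma\in\Sigma_n$, write $\lambda=\lambda_1^\sigma\cdots\lambda_n^\sigma$ with $d(\lambda_i^\sigma)=e_{c_{\sigma(i)}}$; then $\triangledown_n(\lambda,\mu)=\sum_{\sigma\in\Sigma_n}\mathrm{sgn}(\sigma)(\lambda_1^\sigma,\dots,\lambda_n^\sigma,\mu)$. $\triangledown_{-1}=\mathrm{id}_{\mathbb{Z}^\Lambda}$, $\triangledown_n=0$ for $n<-1$. **The map $\square_*$.** For a $k$-graph $\Gamma$, an $n$-element set $K\subset\{1,\dots,k\}$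 and $\lambda\in\Gamma$ with $C(\lambda)\subset K$, put $e_K=\sum_{j\in K}e_j$ and $\lceil\lambda\rfloor_K=\sum_{m}\lambda(m,m+e_K)\in\mathbb{Z}Q_n(\Gamma)$, summing over $m\in\mathbb{N}^k$ with $0\le m\le d(\lambda)-e_K$ (an empty sum is $0$). For $n\ge0$, $(\lambda_0,\dots,\lambda_n)\in\Lambda^{*(n+1)}v$ and $K$ with $i$-th smallest element $K_{(i)}$, let $\lambda=\lambda_0\cdots\lambda_n$, $b=\sum_{i=1}^n\sum_{j=K_{(i)}+1}^kd_j(\lambda_{i-1})e_j$, $c=\sum_{i=1}^n\sum_{j=K_{(i)}}^kd_j(\lambda_{i-1})e_j$, and $\widehat\square_n(\lambda_0,\dots,\lambda_n;K)=(\lambda(b,c),\lambda(c,d(\lambda)))\in\widetilde\Lambda(v)$, whose color type lies in $K$. Then $\square_n(\lambda_0,\dots,\lambda_n)=\sum_K\lceil\widehat\square_n(\lambda_0,\dots,\lambda_n;K)\rfloor_K$, the sum over all $n$-element subsets $K$ of $\{1,\dots,k\}$. $\square_{-1}=\mathrm{id}_{\mathbb{Z}^\Lambda}$, $\square_n=0$ for $n<-1$. *)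

theory Defs
  imports
    "HOL-Algebra.Free_Abelian_Groups"
    "HOL-Combinatorics.Permutations"
    "HOL-Library.Countable_Set"
    "HOL-Library.Function_Algebras"
begin

section \<open>Higher-rank graphs\<close>

text \<open>Elements of \<open>\<nat>\<^sup>k\<close> are functions \<open>nat \<Rightarrow> nat\<close> vanishing outside \<open>{1..k}\<close>, with the pointwise
  order and addition.\<close>

definition Nvec :: "nat \<Rightarrow> (nat \<Rightarrow> nat) set"
  where "Nvec k = {m. \<forall>i. i \<notin> {1..k} \<longrightarrow> m i = 0}"

text \<open>The multiple \<open>a e\<^sub>j\<close> of a canonical generator.\<close>

definition evec_scaled :: "nat \<Rightarrow> nat \<Rightarrow> (nat \<Rightarrow> nat)"
  where "evec_scaled a j = (\<lambda>i. if i = j then a else 0)"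

abbreviation evec :: "nat \<Rightarrow> (nat \<Rightarrow> nat)"
  where "evec j \<equiv> evec_scaled 1 j"

text \<open>The \<open>i\<close>-th smallest element of a finite set, counted from \<open>1\<close>.\<close>

definition ith_smallest :: "nat set \<Rightarrow> nat \<Rightarrow> nat"
  where "ith_smallest K i = sorted_list_of_set K ! (i - 1)"

text \<open>Small categories in the arrows-only style: objects are identity morphisms, so source and range
  are again morphisms. The composite \<open>cmp G \<mu> \<nu>\<close> is meaningful if \<open>src G \<mu> = rng G \<nu>\<close>.\<close>

record 'a dgraph =
  mor :: "'a set"
  src :: "'a \<Rightarrow> 'a"
  rng :: "'a \<Rightarrow> 'a"
  cmp :: "'a \<Rightarrow> 'a \<Rightarrow> 'a"
  deg :: "'a \<Rightarrow> nat \<Rightarrow> nat"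

definition vertices :: "'a dgraph \<Rightarrow> 'a set"
  where "vertices G = {v \<in> mor G. src G v = v}"

locale small_category =
  fixes G :: "'a dgraph"
  assumes src_mor: "x \<in> mor G \<Longrightarrow> src G x \<in> mor G"
    and rng_mor: "x \<in> mor G \<Longrightarrow> rng G x \<in> mor G"
    and src_src: "x \<in> mor G \<Longrightarrow> src G (src G x) = src G x"
    and rng_src: "x \<in> mor G \<Longrightarrow> rng G (src G x) = src G x"
    and src_rng: "x \<in> mor G \<Longrightarrow> src G (rng G x) = rng G x"
    and rng_rng: "x \<in> mor G \<Longrightarrow> rng G (rng G x) = rng G x"
    and cmp_mor: "\<lbrakk>x \<in> mor G; y \<in> mor G; src G x = rng G y\<rbrakk> \<Longrightarrow> cmp G x y \<in> mor G"
    and src_cmp: "\<lbrakk>x \<in> mor G; y \<in> mor G; src G x = rng G y\<rbrakk> \<Longrightarrow> src G (cmp G x y) = src G y"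
    and rng_cmp: "\<lbrakk>x \<in> mor G; y \<in> mor G; src G x = rng G y\<rbrakk> \<Longrightarrow> rng G (cmp G x y) = rng G x"
    and cmp_rng: "x \<in> mor G \<Longrightarrow> cmp G (rng G x) x = x"
    and cmp_src: "x \<in> mor G \<Longrightarrow> cmp G x (src G x) = x"
    and cmp_assoc: "\<lbrakk>x \<in> mor G; y \<in> mor G; z \<in> mor G; src G x = rng G y; src G y = rng G z\<rbrakk>
        \<Longrightarrow> cmp G (cmp G x y) z = cmp G x (cmp G y z)"

locale kgraph = small_category G for k :: nat and G :: "'a dgraph" +
  assumes countable_mor: "countable (mor G)"
    and deg_Nvec: "x \<in> mor G \<Longrightarrow> deg G x \<in> Nvec k"
    and deg_vertex: "v \<in> vertices G \<Longrightarrow> deg G v = 0"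
    and deg_cmp: "\<lbrakk>x \<in> mor G; y \<in> mor G; src G x = rng G y\<rbrakk>
        \<Longrightarrow> deg G (cmp G x y) = deg G x + deg G y"
    and factorization: "\<lbrakk>x \<in> mor G; m \<in> Nvec k; n \<in> Nvec k; deg G x = m + n\<rbrakk>
        \<Longrightarrow> \<exists>!p. case p of (\<mu>, \<nu>) \<Rightarrow> \<mu> \<in> mor G \<and> \<nu> \<in> mor G \<and> src G \<mu> = rng G \<nu>
              \<and> deg G \<mu> = m \<and> deg G \<nu> = n \<and> x = cmp G \<mu> \<nu>"

text \<open>The morphism \<open>\<lambda>(m,n)\<close>, for \<open>0 \<le> m \<le> n \<le> d(\<lambda>)\<close>.\<close>

definition segment :: "'a dgraph \<Rightarrow> 'a \<Rightarrow> (nat \<Rightarrow> nat) \<Rightarrow> (nat \<Rightarrow> nat) \<Rightarrow> 'a"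
  where "segment G l m n = (THE x. x \<in> mor G \<and> m + deg G x = n \<and>
     (\<exists>l1\<in>mor G. \<exists>l2\<in>mor G. src G l1 = rng G x \<and> src G x = rng G l2 \<and>
        deg G l1 = m \<and> l = cmp G (cmp G l1 x) l2))"

definition colors :: "'a dgraph \<Rightarrow> 'a \<Rightarrow> nat set"
  where "colors G l = {i. deg G l i > 0}"

text \<open>Nonempty composable tuples are represented by nonempty lists.\<close>

definition composable :: "'a dgraph \<Rightarrow> 'a list \<Rightarrow> bool"
  where "composable G ls \<longleftrightarrow> ls \<noteq> [] \<and> set ls \<subseteq> mor G \<and>
     (\<forall>i. Suc i < length ls \<longrightarrow> src G (ls ! i) = rng G (ls ! Suc i))"

definition composite :: "'a dgraph \<Rightarrow> 'a list \<Rightarrow> 'a"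
  where "composite G ls = foldr (cmp G) (butlast ls) (last ls)"

text \<open>The factorization of \<open>l\<close> into morphisms of prescribed degrees \<open>ds\<close>; the identity \<open>src G l\<close> is
  appended so that the empty factorization of a vertex is covered.\<close>

definition factors :: "'a dgraph \<Rightarrow> 'a \<Rightarrow> (nat \<Rightarrow> nat) list \<Rightarrow> 'a list"
  where "factors G l ds = (THE ls. map (deg G) ls = ds \<and>
     composable G (ls @ [src G l]) \<and> composite G (ls @ [src G l]) = l)"

text \<open>The \<open>k\<close>-graph \<open>\<Lambda>\<^sup>~(v)\<close>. Its object \<open>\<mu>\<close> is identified with the identity morphism \<open>(r(\<mu>), \<mu>)\<close>;
  note that \<open>r(\<eta>\<mu>) = r(\<eta>)\<close>.\<close>

definition slice :: "'a dgraph \<Rightarrow> 'a \<Rightarrow> ('a \<times> 'a) dgraph"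
  where "slice G v = \<lparr>
     mor = {(\<eta>, \<mu>). \<eta> \<in> mor G \<and> \<mu> \<in> mor G \<and> src G \<eta> = rng G \<mu> \<and> src G \<mu> = v},
     src = (\<lambda>(\<eta>, \<mu>). (rng G \<mu>, \<mu>)),
     rng = (\<lambda>(\<eta>, \<mu>). (rng G \<eta>, cmp G \<eta> \<mu>)),
     cmp = (\<lambda>(\<eta>, \<mu>) (\<eta>', \<mu>'). (cmp G \<eta> \<eta>', \<mu>')),
     deg = (\<lambda>(\<eta>, \<mu>). deg G \<eta>) \<rparr>"


section \<open>Chain complexes of right modules\<close>

text \<open>A contravariant functor \<open>M\<close> to abelian groups; \<open>act M l\<close> maps \<open>M(r(l))\<close> to \<open>M(s(l))\<close>.\<close>

record ('a, 'g) rmod =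
  grp :: "'a \<Rightarrow> 'g monoid"
  act :: "'a \<Rightarrow> 'g \<Rightarrow> 'g"

definition right_module :: "'a dgraph \<Rightarrow> ('a, 'g) rmod \<Rightarrow> bool"
  where "right_module G M \<longleftrightarrow>
     (\<forall>v\<in>vertices G. comm_group (grp M v)) \<and>
     (\<forall>l\<in>mor G. act M l \<in> hom (grp M (rng G l)) (grp M (src G l))) \<and>
     (\<forall>v\<in>vertices G. \<forall>x\<in>carrier (grp M v). act M v x = x) \<and>
     (\<forall>l\<in>mor G. \<forall>l'\<in>mor G. src G l = rng G l' \<longrightarrow>
        (\<forall>x\<in>carrier (grp M (rng G l)). act M (cmp G l l') x = act M l' (act M l x)))"

definition module_map ::
    "'a dgraph \<Rightarrow> ('a, 'g) rmod \<Rightarrow> ('a, 'h) rmod \<Rightarrow> ('a \<Rightarrow> 'g \<Rightarrow> 'h) \<Rightarrow> bool"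
  where "module_map G M N f \<longleftrightarrow>
     (\<forall>v\<in>vertices G. f v \<in> hom (grp M v) (grp N v)) \<and>
     (\<forall>l\<in>mor G. \<forall>x\<in>carrier (grp M (rng G l)).
        f (src G l) (act M l x) = act N l (f (rng G l) x))"

text \<open>\<open>bd C n\<close> is the differential from degree \<open>n\<close> to degree \<open>n - 1\<close>.\<close>

record ('a, 'g) mcomplex =
  cmod :: "int \<Rightarrow> ('a, 'g) rmod"
  bd :: "int \<Rightarrow> 'a \<Rightarrow> 'g \<Rightarrow> 'g"

abbreviation cgrp :: "('a, 'g) mcomplex \<Rightarrow> int \<Rightarrow> 'a \<Rightarrow> 'g monoid"
  where "cgrp C n v \<equiv> grp (cmod C n) v"

definition chain_complex :: "'a dgraph \<Rightarrow> ('a, 'g) mcomplex \<Rightarrow> bool"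
  where "chain_complex G C \<longleftrightarrow>
     (\<forall>n. right_module G (cmod C n)) \<and>
     (\<forall>n. module_map G (cmod C n) (cmod C (n - 1)) (bd C n)) \<and>
     (\<forall>n. \<forall>v\<in>vertices G. \<forall>x\<in>carrier (cgrp C n v).
        bd C (n - 1) v (bd C n v x) = \<one>\<^bsub>cgrp C (n - 2) v\<^esub>)"

definition chain_map ::
    "'a dgraph \<Rightarrow> ('a, 'g) mcomplex \<Rightarrow> ('a, 'h) mcomplex \<Rightarrow> (int \<Rightarrow> 'a \<Rightarrow> 'g \<Rightarrow> 'h) \<Rightarrow> bool"
  where "chain_map G C D f \<longleftrightarrow>
     (\<forall>n. module_map G (cmod C n) (cmod D n) (f n)) \<and>
     (\<forall>n. \<forall>v\<in>vertices G. \<forall>x\<in>carrier (cgrp C n v).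
        bd D n v (f n v x) = f (n - 1) v (bd C n v x))"

text \<open>\<open>f - g = \<partial>h + h\<partial>\<close>, in the multiplicative notation of the abelian groups involved.\<close>

definition chain_homotopic ::
    "'a dgraph \<Rightarrow> ('a, 'g) mcomplex \<Rightarrow> ('a, 'h) mcomplex
      \<Rightarrow> (int \<Rightarrow> 'a \<Rightarrow> 'g \<Rightarrow> 'h) \<Rightarrow> (int \<Rightarrow> 'a \<Rightarrow> 'g \<Rightarrow> 'h) \<Rightarrow> bool"
  where "chain_homotopic G C D f g \<longleftrightarrow>
     (\<exists>h. (\<forall>n. module_map G (cmod C n) (cmod D (n + 1)) (h n)) \<and>
       (\<forall>n. \<forall>v\<in>vertices G. \<forall>x\<in>carrier (cgrp C n v).
          f n v x \<otimes>\<^bsub>cgrp D n v\<^esub> inv\<^bsub>cgrp D n v\<^esub> (g n v x)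
            = bd D (n + 1) v (h n v x) \<otimes>\<^bsub>cgrp D n v\<^esub> h (n - 1) v (bd C n v x)))"

definition homotopy_equivalence_by ::
    "'a dgraph \<Rightarrow> ('a, 'g) mcomplex \<Rightarrow> ('a, 'h) mcomplex
      \<Rightarrow> (int \<Rightarrow> 'a \<Rightarrow> 'g \<Rightarrow> 'h) \<Rightarrow> (int \<Rightarrow> 'a \<Rightarrow> 'h \<Rightarrow> 'g) \<Rightarrow> bool"
  where "homotopy_equivalence_by G C D f g \<longleftrightarrow>
     chain_map G C D f \<and> chain_map G D C g \<and>
     chain_homotopic G C C (\<lambda>n v. g n v \<circ> f n v) (\<lambda>n v. id) \<and>
     chain_homotopic G D D (\<lambda>n v. f n v \<circ> g n v) (\<lambda>n v. id)"


section \<open>Augmented complexes of free abelian groups\<close>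

text \<open>Both complexes have a free abelian group on a basis \<open>B n v\<close> in degree \<open>n \<ge> 0\<close>, \<open>\<int>\<close> in degree \<open>-1\<close>
  and \<open>0\<close> below. To have one type for all degrees, elements are pairs in \<open>int \<times> ('b \<Rightarrow>\<^sub>0 int)\<close>:
  the groups are \<open>0 \<times> \<int>B\<close>, \<open>\<int> \<times> 0\<close> and \<open>0 \<times> 0\<close> respectively. The parameters \<open>ba\<close>, \<open>bo\<close> and \<open>f\<close>
  give the action, differential and map on basis elements.\<close>

definition aug_grp :: "(nat \<Rightarrow> 'a \<Rightarrow> 'b set) \<Rightarrow> int \<Rightarrow> 'a \<Rightarrow> (int \<times> ('b \<Rightarrow>\<^sub>0 int)) monoid"
  where "aug_grp B n v =
     (if n = -1 then integer_group else singleton_group 0) \<times>\<times>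
     free_Abelian_group (if n \<ge> 0 then B (nat n) v else {})"

definition aug_act :: "('b \<Rightarrow> 'a \<Rightarrow> 'b) \<Rightarrow> 'a \<Rightarrow> int \<times> ('b \<Rightarrow>\<^sub>0 int) \<Rightarrow> int \<times> ('b \<Rightarrow>\<^sub>0 int)"
  where "aug_act ba l = (\<lambda>(z, c). (z, frag_extend (\<lambda>x. frag_of (ba x l)) c))"

definition aug_bd :: "(nat \<Rightarrow> 'a \<Rightarrow> 'b \<Rightarrow> ('b \<Rightarrow>\<^sub>0 int))
      \<Rightarrow> int \<Rightarrow> 'a \<Rightarrow> int \<times> ('b \<Rightarrow>\<^sub>0 int) \<Rightarrow> int \<times> ('b \<Rightarrow>\<^sub>0 int)"
  where "aug_bd bo n v = (\<lambda>(z, c).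
     if n \<ge> 1 then (0, frag_extend (bo (nat n) v) c)
     else if n = 0 then (\<Sum>x\<in>Poly_Mapping.keys c. Poly_Mapping.lookup c x, 0)
     else (0, 0))"

definition aug_map :: "(nat \<Rightarrow> 'a \<Rightarrow> 'b \<Rightarrow> ('c \<Rightarrow>\<^sub>0 int))
      \<Rightarrow> int \<Rightarrow> 'a \<Rightarrow> int \<times> ('b \<Rightarrow>\<^sub>0 int) \<Rightarrow> int \<times> ('c \<Rightarrow>\<^sub>0 int)"
  where "aug_map f n v = (\<lambda>(z, c).
     if n \<ge> 0 then (0, frag_extend (f (nat n) v) c)
     else if n = -1 then (z, 0)
     else (0, 0))"

definition aug_complex :: "(nat \<Rightarrow> 'a \<Rightarrow> 'b set) \<Rightarrow> ('b \<Rightarrow> 'a \<Rightarrow> 'b)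
      \<Rightarrow> (nat \<Rightarrow> 'a \<Rightarrow> 'b \<Rightarrow> ('b \<Rightarrow>\<^sub>0 int)) \<Rightarrow> ('a, int \<times> ('b \<Rightarrow>\<^sub>0 int)) mcomplex"
  where "aug_complex B ba bo =
     \<lparr> cmod = (\<lambda>n. \<lparr> grp = aug_grp B n, act = aug_act ba \<rparr>), bd = aug_bd bo \<rparr>"


section \<open>The cubical complex\<close>

definition cubes :: "nat \<Rightarrow> 'a dgraph \<Rightarrow> nat \<Rightarrow> 'a set"
  where "cubes k G n = {\<eta> \<in> mor G. (\<Sum>i=1..k. deg G \<eta> i) = n \<and> (\<forall>i\<in>{1..k}. deg G \<eta> i \<in> {0, 1})}"

text \<open>The face \<open>F\<^sup>l\<^sub>j\<close>, where \<open>l\<close> is \<open>0\<close> or \<open>1\<close>.\<close>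

definition face :: "'a dgraph \<Rightarrow> nat \<Rightarrow> nat \<Rightarrow> 'a \<Rightarrow> 'a"
  where "face G l j x = (let c = ith_smallest (colors G x) j in
     if l = 0 then segment G x 0 (deg G x - evec c) else segment G x (evec c) (deg G x))"

definition cube_bd :: "'a dgraph \<Rightarrow> nat \<Rightarrow> 'a \<Rightarrow> ('a \<Rightarrow>\<^sub>0 int)"
  where "cube_bd G n x =
     (\<Sum>j=1..n. \<Sum>l=0..1. frag_cmul ((-1) ^ (j + l)) (frag_of (face G l j x)))"

definition cubical_complex ::
    "nat \<Rightarrow> 'a dgraph \<Rightarrow> ('a, int \<times> (('a \<times> 'a) \<Rightarrow>\<^sub>0 int)) mcomplex"
  where "cubical_complex k G = aug_complex
     (\<lambda>n v. cubes k (slice G v) n)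
     (\<lambda>(\<eta>, \<mu>) l. (\<eta>, cmp G \<mu> l))
     (\<lambda>n v. cube_bd (slice G v) n)"


section \<open>The simplicial complex\<close>

definition paths :: "'a dgraph \<Rightarrow> nat \<Rightarrow> 'a \<Rightarrow> 'a list set"
  where "paths G n v = {ls. length ls = n \<and> composable G ls \<and> src G (last ls) = v}"

definition path_bd :: "'a dgraph \<Rightarrow> nat \<Rightarrow> 'a list \<Rightarrow> ('a list \<Rightarrow>\<^sub>0 int)"
  where "path_bd G n ls = frag_of (tl ls) +
     (\<Sum>i=1..n. frag_cmul ((-1) ^ i)
        (frag_of (take (i - 1) ls @ [cmp G (ls ! (i - 1)) (ls ! i)] @ drop (i + 1) ls)))"

definition simplicial_complex :: "'a dgraph \<Rightarrow> ('a, int \<times> ('a list \<Rightarrow>\<^sub>0 int)) mcomplex"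
  where "simplicial_complex G = aug_complex
     (\<lambda>n v. paths G (n + 1) v)
     (\<lambda>ls l. butlast ls @ [cmp G (last ls) l])
     (\<lambda>n v. path_bd G n)"


section \<open>The comparison maps\<close>

definition nabla_basis :: "'a dgraph \<Rightarrow> nat \<Rightarrow> 'a \<times> 'a \<Rightarrow> ('a list \<Rightarrow>\<^sub>0 int)"
  where "nabla_basis G n = (\<lambda>(l, \<mu>). \<Sum>\<sigma> | \<sigma> permutes {1..n}. frag_cmul (sign \<sigma>) (frag_of
     (factors G l (map (\<lambda>i. evec (ith_smallest (colors G l) (\<sigma> i))) [1..<n + 1]) @ [\<mu>])))"

definition nabla :: "'a dgraph
      \<Rightarrow> int \<Rightarrow> 'a \<Rightarrow> int \<times> (('a \<times> 'a) \<Rightarrow>\<^sub>0 int) \<Rightarrow> int \<times> ('a list \<Rightarrow>\<^sub>0 int)"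
  where "nabla G = aug_map (\<lambda>n v. nabla_basis G n)"

text \<open>The bracket \<open>\<lceil>l\<rfloor>\<^sub>K\<close>, for \<open>l\<close> with \<open>colors G l \<subseteq> K\<close>; the condition \<open>m \<le> d(l) - e\<^sub>K\<close> (in \<open>\<int>\<^sup>k\<close>) is
  written without subtraction.\<close>

definition bracket :: "nat \<Rightarrow> 'a dgraph \<Rightarrow> nat set \<Rightarrow> 'a \<Rightarrow> ('a \<Rightarrow>\<^sub>0 int)"
  where "bracket k G K l =
     (\<Sum>m | m \<in> Nvec k \<and> m + (\<Sum>j\<in>K. evec j) \<le> deg G l.
        frag_of (segment G l m (m + (\<Sum>j\<in>K. evec j))))"

definition square_hat :: "nat \<Rightarrow> 'a dgraph \<Rightarrow> nat \<Rightarrow> 'a list \<Rightarrow> nat set \<Rightarrow> 'a \<times> 'a"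
  where "square_hat k G n ls K = (let
       l = composite G ls;
       b = (\<Sum>i=1..n. \<Sum>j=ith_smallest K i + 1..k. evec_scaled (deg G (ls ! (i - 1)) j) j);
       c = (\<Sum>i=1..n. \<Sum>j=ith_smallest K i..k. evec_scaled (deg G (ls ! (i - 1)) j) j)
     in (segment G l b c, segment G l c (deg G l)))"

definition square_basis :: "nat \<Rightarrow> 'a dgraph \<Rightarrow> nat \<Rightarrow> 'a \<Rightarrow> 'a list \<Rightarrow> (('a \<times> 'a) \<Rightarrow>\<^sub>0 int)"
  where "square_basis k G n v ls =
     (\<Sum>K | K \<subseteq> {1..k} \<and> card K = n. bracket k (slice G v) K (square_hat k G n ls K))"

definition square :: "nat \<Rightarrow> 'a dgraph
      \<Rightarrow> int \<Rightarrow> 'a \<Rightarrow> int \<times> ('a list \<Rightarrow>\<^sub>0 int) \<Rightarrow> int \<times> (('a \<times> 'a) \<Rightarrow>\<^sub>0 int)"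
  where "square k G = aug_map (square_basis k G)"

end

theory Submission
  imports Defs "HOL-Combinatorics.Multiset_Permutations"
begin

text \<open>
  Everything in this equivalence happens inside the boxes \<open>[0, d(l)]\<close> of single morphisms \<open>l\<close>. By unique
  factorization, a chain of points \<open>x\<^sub>0 \<le> \<dots> \<le> x\<^sub>n \<le> d(l)\<close> cuts \<open>l\<close> into a composable tuple, and a unit
  cube in the box cuts out a cube of the slice, the rest of \<open>l\<close> being its second component; all tuples
  and all cubes arise in this way. The right action only makes \<open>l\<close> longer. The two boundaries and the
  two comparison maps are given on every box by the same formulas in \<open>\<nat>\<^sup>k\<close>, so their identities need
  only be proved for simplices (lists of points) and unit cubes (pairs of a corner and a set of
  directions) in the lattice.

  In the lattice, \<open>\<triangledown>\<close> is the shuffle map: it sends a cube to the signed sum of the edge paths from its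
  lower to its upper corner. In the boundary, deleting an inner point of an edge path gives the same
  simplex for two orders of the steps, with opposite signs, and what remains are the edge paths of the
  faces (\<open>shuffle_chain_map\<close>).

  The map \<open>\<square>\<close> is an Alexander-Whitney map. The lattice can be contracted onto any corner \<open>x\<close> by
  sweeping cubes along the axes, one coordinate after the other (\<open>contract_homotopy\<close>). The map \<open>aw\<close> is
  defined by recursion on the last point: \<open>aw(x\<^sub>0,\<dots>,x\<^sub>n)\<close> is, up to sign, \<open>aw(x\<^sub>0,\<dots>,x\<^sub>n\<^sub>-\<^sub>1)\<close> contracted
  towards \<open>x\<^sub>n\<close>. For such a recursion the chain map property is a formal consequence of the homotopy
  formula (\<open>aw_chain_map\<close>), and solving the recursion gives the sum that defines \<open>\<square>\<close>
  (\<open>aw_closed\<close>, \<open>square_basis_realize\<close>).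

  On an edge path, each contraction sweeps nothing unless the new direction is larger than all earlier
  ones. Hence only the increasing order contributes and \<open>\<square> \<circ> \<triangledown>\<close> is equal to the identity
  (\<open>aw_shuffle\<close>). In particular \<open>\<triangledown>\<close> is injective, so that \<open>\<partial>\<partial> = 0\<close> for cubes follows from \<open>\<partial>\<partial> = 0\<close> for
  simplices (\<open>box_bd_bd\<close>).

  The homotopy for \<open>\<triangledown> \<circ> \<square>\<close> comes from freeness. The simplicial complex consists of free right modules, with
  the tuples ending in an identity as generators, and appending the end vertex contracts it. So any
  chain map from it to itself that is the identity in degrees \<open>-1\<close> and \<open>0\<close> is homotopic to the identity, by a
  homotopy defined recursively on generators (\<open>recursive_homotopy\<close>, \<open>self_map_homotopic_id\<close>).
\<close>

text \<open>The numeral \<open>1\<close> is not rewritten to \<open>Suc 0\<close>, so that terms keep the form that they have in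
  the definitions of the complexes.\<close>

declare One_nat_def [simp del]

section \<open>Linear extension\<close>

abbreviation supp :: "('b \<Rightarrow>\<^sub>0 int) \<Rightarrow> 'b set"
  where "supp \<equiv> Poly_Mapping.keys"

lemma frag_cmul_diff: "frag_cmul c (a - b) = frag_cmul c a - frag_cmul c b"
  by (rule poly_mapping_eqI) (simp add: lookup_minus algebra_simps)

lemma frag_extend_frag_extend:
  "frag_extend f (frag_extend g c) = frag_extend (\<lambda>x. frag_extend f (g x)) c"
  by (simp add: frag_extend_def[of g] frag_extend_def[of "\<lambda>x. frag_extend f (g x)"]
      frag_extend_sum frag_extend_cmul)

lemma frag_extend_sum': "finite I \<Longrightarrow> frag_extend f (\<Sum>i\<in>I. g i) = (\<Sum>i\<in>I. frag_extend f (g i))"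
  by (simp add: frag_extend_sum)

lemma frag_extend_plus_fun: "frag_extend (\<lambda>x. f x + g x) c = frag_extend f c + frag_extend g c"
  by (simp add: frag_extend_def frag_cmul_distrib2 sum.distrib)

lemma frag_extend_diff_fun: "frag_extend (\<lambda>x. f x - g x) c = frag_extend f c - frag_extend g c"
  by (simp add: frag_extend_def frag_cmul_diff sum_subtractf)

lemma frag_extend_sum_fun: "frag_extend (\<lambda>x. \<Sum>i\<in>I. f i x) c = (\<Sum>i\<in>I. frag_extend (f i) c)"
  unfolding frag_extend_def frag_cmul_sum by (rule sum.swap)

lemma frag_extend_frag_of_id [simp]: "frag_extend frag_of c = c"
  using frag_expansion[of c] by simp

lemma frag_eq_minus_self: "c = - c \<Longrightarrow> c = (0 :: 'b \<Rightarrow>\<^sub>0 int)"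
proof (rule poly_mapping_eqI)
  fix x assume "c = - c"
  then have "Poly_Mapping.lookup c x = - Poly_Mapping.lookup c x"
    by (metis lookup_uminus)
  then show "Poly_Mapping.lookup c x = Poly_Mapping.lookup 0 x" by simp
qed

section \<open>The boundary of a simplex of points\<close>

text \<open>Points are deleted one at a time with alternating signs. The recursion separates the first point
  from the others; as it ends with the empty list, which is the boundary of a single point, the
  complex is augmented.\<close>

primrec simplex_bd :: "'b list \<Rightarrow> ('b list \<Rightarrow>\<^sub>0 int)" where
  "simplex_bd [] = 0"
| "simplex_bd (x # xs) = frag_of xs - frag_extend (\<lambda>ys. frag_of (x # ys)) (simplex_bd xs)"

lemma simplex_bd_bd: "frag_extend simplex_bd (simplex_bd xs) = 0"
proof (induction xs)
  case (Cons x xs)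
  have "frag_extend simplex_bd (frag_extend (\<lambda>ys. frag_of (x # ys)) (simplex_bd xs))
      = frag_extend (\<lambda>ys. frag_of ys - frag_extend (\<lambda>ys. frag_of (x # ys)) (simplex_bd ys)) (simplex_bd xs)"
    by (simp add: frag_extend_frag_extend)
  also have "\<dots> = simplex_bd xs
      - frag_extend (\<lambda>ys. frag_of (x # ys)) (frag_extend simplex_bd (simplex_bd xs))"
    by (simp add: frag_extend_diff_fun frag_extend_frag_extend)
  finally show ?case by (simp add: frag_extend_diff Cons.IH)
qed simp

text \<open>Appending a point commutes with the boundary except for the one term that deletes this point.
  Constructions by recursion on the last point rest on this.\<close>

lemma simplex_bd_snoc:
  "simplex_bd (xs @ [x]) = frag_extend (\<lambda>ys. frag_of (ys @ [x])) (simplex_bd xs)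
     + frag_cmul ((-1) ^ length xs) (frag_of xs)"
proof (induction xs)
  case (Cons y xs)
  then show ?case
    by (simp add: frag_extend_add frag_extend_diff frag_extend_frag_extend frag_extend_cmul
        algebra_simps flip: minus_frag_cmul)
qed simp

lemma simplex_bd_eq_sum:
  "simplex_bd xs = (\<Sum>i<length xs. frag_cmul ((-1) ^ i) (frag_of (take i xs @ drop (Suc i) xs)))"
proof (induction xs)
  case (Cons x xs)
  show ?case
    by (simp add: Cons.IH sum.lessThan_Suc_shift frag_extend_sum' frag_extend_cmul
        sum_negf del: sum.lessThan_Suc flip: minus_frag_cmul)
qed simp

section \<open>Cubes in the lattice and their boundary\<close>

text \<open>For \<open>j \<in> K\<close> this is \<open>(-1)\<^sup>i\<^sup>-\<^sup>1\<close> if \<open>j\<close> is the \<open>i\<close>-th smallest element of \<open>K\<close>; for \<open>j \<notin> K\<close> it is the sign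
  of the place where \<open>j\<close> would be inserted.\<close>

definition color_sign :: "nat set \<Rightarrow> nat \<Rightarrow> int"
  where "color_sign K j = (-1) ^ card {i \<in> K. i < j}"

text \<open>The pair \<open>(a, K)\<close> stands for the unit cube with lower corner \<open>a\<close> and edge directions \<open>K\<close>.\<close>

definition box_bd :: "(nat \<Rightarrow> nat) \<times> nat set \<Rightarrow> ((nat \<Rightarrow> nat) \<times> nat set \<Rightarrow>\<^sub>0 int)"
  where "box_bd = (\<lambda>(a, K). \<Sum>j\<in>K. frag_cmul (color_sign K j)
     (frag_of (a + evec j, K - {j}) - frag_of (a, K - {j})))"

lemma color_sign_square [simp]: "color_sign K j * color_sign K j = 1"
  by (simp add: color_sign_def flip: power_mult_distrib)

lemma color_sign_remove:
  assumes "finite K" "j \<in> K" "i \<noteq> j"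
  shows "color_sign (K - {j}) i = (if j < i then - color_sign K i else color_sign K i)"
proof (cases "j < i")
  case True
  have "card {l \<in> K. l < i} = Suc (card {l \<in> K - {j}. l < i})"
  proof -
    have "{l \<in> K. l < i} = insert j {l \<in> K - {j}. l < i}" using assms True by auto
    then show ?thesis using assms by simp
  qed
  then show ?thesis using True by (simp add: color_sign_def)
next
  case False
  then have "{l \<in> K - {j}. l < i} = {l \<in> K. l < i}" using assms by auto
  then show ?thesis using False by (simp add: color_sign_def)
qed

lemma color_sign_insert:
  assumes "finite K" "p \<notin> K" "i \<noteq> p"
  shows "color_sign (insert p K) i = (if p < i then - color_sign K i else color_sign K i)"
  using color_sign_remove[of "insert p K" p i] assms by (auto simp: insert_Diff_if)

lemma color_sign_insert_same [simp]: "color_sign (insert p K) p = color_sign K p"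
proof -
  have "{i \<in> insert p K. i < p} = {i \<in> K. i < p}" by auto
  then show ?thesis by (simp add: color_sign_def)
qed

lemma color_sign_remove_same [simp]: "color_sign (K - {p}) p = color_sign K p"
proof -
  have "{i \<in> K - {p}. i < p} = {i \<in> K. i < p}" by auto
  then show ?thesis by (simp add: color_sign_def)
qed

text \<open>Removing two directions in either order gives opposite signs. This is the source of the
  cancellations in the boundary of a shuffle.\<close>

lemma color_sign_swap:
  assumes "finite K" "i \<in> K" "j \<in> K" "i \<noteq> j"
  shows "color_sign K j * color_sign (K - {j}) i = - (color_sign K i * color_sign (K - {i}) j)"
  using assms by (auto simp: color_sign_remove)

section \<open>Contracting the lattice onto a corner\<close>

text \<open>The sum over the interval from \<open>a\<close> to \<open>b\<close>, which changes sign when its ends are exchanged; so it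
  telescopes whatever the order of the ends.\<close>

definition signed_sum :: "(nat \<Rightarrow> 'g::ab_group_add) \<Rightarrow> nat \<Rightarrow> nat \<Rightarrow> 'g"
  where "signed_sum f a b = sum f {..<b} - sum f {..<a}"

lemma signed_sum_eq_sum: "a \<le> b \<Longrightarrow> signed_sum f a b = sum f {a..<b}"
proof -
  assume "a \<le> b"
  then have "sum f {..<b} = sum f {..<a} + sum f {a..<b}"
    by (metis ivl_disj_un_one(2) ivl_disj_int_one(2) sum.union_disjoint finite_lessThan finite_atLeastLessThan)
  then show ?thesis by (simp add: signed_sum_def)
qed

lemma signed_sum_telescope: "signed_sum (\<lambda>t. f (Suc t) - f t) a b = f b - f a"
  by (simp add: signed_sum_def sum_lessThan_telescope)

lemma signed_sum_Suc: "signed_sum f (Suc a) b = signed_sum f a b - f a"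
  by (simp add: signed_sum_def)

lemma frag_extend_signed_sum: "frag_extend g (signed_sum f a b) = signed_sum (\<lambda>t. frag_extend g (f t)) a b"
  by (simp add: signed_sum_def frag_extend_diff frag_extend_sum')

lemma signed_sum_add: "signed_sum (\<lambda>t. f t + g t) a b = signed_sum f a b + signed_sum g a b"
  by (simp add: signed_sum_def sum.distrib)

lemma signed_sum_diff: "signed_sum (\<lambda>t. f t - g t) a b = signed_sum f a b - signed_sum g a b"
  by (simp add: signed_sum_def sum_subtractf)

lemma signed_sum_sum: "signed_sum (\<lambda>t. \<Sum>j\<in>K. f j t) a b = (\<Sum>j\<in>K. signed_sum (f j) a b)"
  unfolding signed_sum_def sum_subtractf by (simp add: sum.swap[of _ K])

lemma signed_sum_cmul: "signed_sum (\<lambda>t. frag_cmul c (f t)) a b = frag_cmul c (signed_sum f a b)"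
  by (simp add: signed_sum_def frag_cmul_diff frag_cmul_sum)

text \<open>The coordinates in \<open>R\<close> are projected onto those of \<open>D\<close>. A cube with an edge in such a direction
  degenerates and becomes \<open>0\<close>.\<close>

definition collapse :: "(nat \<Rightarrow> nat) \<Rightarrow> nat set \<Rightarrow> (nat \<Rightarrow> nat) \<times> nat set \<Rightarrow> ((nat \<Rightarrow> nat) \<times> nat set \<Rightarrow>\<^sub>0 int)"
  where "collapse D R = (\<lambda>(a, K). if K \<inter> R = {} then frag_of (\<lambda>j. if j \<in> R then D j else a j, K) else 0)"

text \<open>The chain that a cube sweeps out when it is moved along the \<open>p\<close>-th axis up to the coordinate \<open>D p\<close>;
  a cube that already has an edge in this direction sweeps out nothing.\<close>

definition sweep :: "(nat \<Rightarrow> nat) \<Rightarrow> nat \<Rightarrow> (nat \<Rightarrow> nat) \<times> nat set \<Rightarrow> ((nat \<Rightarrow> nat) \<times> nat set \<Rightarrow>\<^sub>0 int)"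
  where "sweep D p = (\<lambda>(a, K). if p \<in> K then 0 else
     frag_cmul (color_sign K p) (signed_sum (\<lambda>t. frag_of (a(p := t), insert p K)) (a p) (D p)))"

lemmas evec_apply = evec_scaled_def

lemma upd_add_evec_same: "a(p := t) + evec p = a(p := Suc t)"
  by (auto simp: fun_eq_iff evec_apply)

text \<open>The critical case is a cube with exactly one direction in \<open>R\<close>: its two faces in this direction have
  the same image and cancel.\<close>

lemma collapse_box_bd:
  "frag_extend (collapse D R) (box_bd x) = frag_extend box_bd (collapse D R x)"
proof -
  obtain a K where x: "x = (a, K)" by (cases x)
  show ?thesis
  proof (cases "finite K")
    case False
    then show ?thesis by (simp add: x box_bd_def collapse_def)
  next
    case fin: True
    let ?o = "\<lambda>a j. if j \<in> R then D j else a j :: nat"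
    have L: "frag_extend (collapse D R) (box_bd x) = (\<Sum>j\<in>K. frag_cmul (color_sign K j)
        (collapse D R (a + evec j, K - {j}) - collapse D R (a, K - {j})))"
      using fin by (simp add: x box_bd_def frag_extend_sum' frag_extend_cmul frag_extend_diff)
    show ?thesis
    proof (cases "K \<inter> R = {}")
      case True
      have "collapse D R (a + evec j, K - {j}) - collapse D R (a, K - {j})
          = frag_of (?o a + evec j, K - {j}) - frag_of (?o a, K - {j})" if "j \<in> K" for j
      proof -
        have "?o (a + evec j) = ?o a + evec j" using that True by (auto simp: fun_eq_iff evec_apply)
        moreover have "(K - {j}) \<inter> R = {}" using True by auto
        ultimately show ?thesis by (simp add: collapse_def)
      qed
      then show ?thesis unfolding L using True by (simp add: x collapse_def box_bd_def)
    next
      case False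
      have "collapse D R (a + evec j, K - {j}) - collapse D R (a, K - {j}) = 0" if "j \<in> K" for j
      proof (cases "(K - {j}) \<inter> R = {}")
        case True
        then have "j \<in> R" using False by auto
        then have "?o (a + evec j) = ?o a" by (auto simp: fun_eq_iff evec_apply)
        then show ?thesis using True by (simp add: collapse_def)
      qed (simp add: collapse_def)
      then show ?thesis unfolding L using False by (simp add: x collapse_def)
    qed
  qed
qed

text \<open>For \<open>p \<notin> K\<close> the faces orthogonal to \<open>p\<close> telescope and leave the two end positions, while the other faces
  cancel with the sweeps of the faces of the cube, since inserting \<open>p\<close> and removing \<open>j\<close> changes exactly
  one of the two signs involved. For \<open>p \<in> K\<close> the two faces orthogonal to \<open>p\<close> sweep out chains that
  differ by the cube itself.\<close>

lemma sweep_homotopy: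
  assumes fin: "finite K"
  shows "frag_extend box_bd (sweep D p (a, K)) + frag_extend (sweep D p) (box_bd (a, K))
    = collapse D {p} (a, K) - frag_of (a, K)"
proof (cases "p \<in> K")
  case True
  have L: "frag_extend (sweep D p) (box_bd (a, K)) = (\<Sum>j\<in>K. frag_cmul (color_sign K j)
      (sweep D p (a + evec j, K - {j}) - sweep D p (a, K - {j})))"
    using fin by (simp add: box_bd_def frag_extend_sum' frag_extend_cmul frag_extend_diff)
  also have "\<dots> = frag_cmul (color_sign K p) (sweep D p (a + evec p, K - {p}) - sweep D p (a, K - {p}))"
    using True fin by (subst sum.remove[of _ p]) (auto simp: sweep_def intro!: sum.neutral)
  also have "\<dots> = - frag_of (a, K)"
  proof -
    have "(a + evec p)(p := t) = a(p := t)" for t by (auto simp: fun_eq_iff evec_apply)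
    moreover have "(a + evec p) p = Suc (a p)" by (simp add: evec_apply)
    ultimately show ?thesis using True
      by (simp add: sweep_def insert_absorb signed_sum_Suc frag_cmul_diff)
  qed
  finally show ?thesis using True by (simp add: sweep_def collapse_def)
next
  case False
  let ?Y = "\<lambda>j t. frag_of (a(p := t) + evec j, insert p (K - {j})) - frag_of (a(p := t), insert p (K - {j}))"
  have "box_bd (a(p := t), insert p K) = frag_cmul (color_sign K p)
        (frag_of (a(p := Suc t), K) - frag_of (a(p := t), K))
      + (\<Sum>j\<in>K. frag_cmul (color_sign (insert p K) j) (?Y j t))" for t
  proof -
    have "insert p K - {j} = insert p (K - {j})" if "j \<in> K" for j using that False by auto
    then show ?thesis using False fin
      by (simp add: box_bd_def upd_add_evec_same)
  qed
  then have 1: "frag_extend box_bd (sweep D p (a, K))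
     = frag_of (a(p := D p), K) - frag_of (a, K)
      + (\<Sum>j\<in>K. frag_cmul (color_sign K p * color_sign (insert p K) j) (signed_sum (?Y j) (a p) (D p)))"
    using False signed_sum_telescope[of "\<lambda>t. frag_of (a(p := t), K)"]
    by (simp add: sweep_def frag_extend_cmul frag_extend_signed_sum signed_sum_add signed_sum_cmul
        signed_sum_sum frag_cmul_distrib2 frag_cmul_sum)
  have 2: "frag_extend (sweep D p) (box_bd (a, K)) =
     (\<Sum>j\<in>K. frag_cmul (color_sign K j * color_sign (K - {j}) p) (signed_sum (?Y j) (a p) (D p)))"
  proof -
    have "frag_cmul (color_sign K j) (sweep D p (a + evec j, K - {j}) - sweep D p (a, K - {j}))
       = frag_cmul (color_sign K j * color_sign (K - {j}) p) (signed_sum (?Y j) (a p) (D p))"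
      if "j \<in> K" for j
    proof -
      have "j \<noteq> p" using that False by auto
      then have "(a + evec j)(p := t) = a(p := t) + evec j" "(a + evec j) p = a p" for t
        by (auto simp: fun_eq_iff evec_apply)
      then show ?thesis using False that
        by (simp add: sweep_def signed_sum_diff frag_cmul_diff)
    qed
    then show ?thesis
      using fin by (simp add: box_bd_def frag_extend_sum' frag_extend_cmul frag_extend_diff)
  qed
  have "color_sign K p * color_sign (insert p K) j = - (color_sign K j * color_sign (K - {j}) p)"
    if "j \<in> K" for j
  proof -
    have "j \<noteq> p" using that False by auto
    then show ?thesis using that False fin
      by (auto simp: color_sign_insert color_sign_remove)
  qed
  then have "(\<Sum>j\<in>K. frag_cmul (color_sign K p * color_sign (insert p K) j) (signed_sum (?Y j) (a p) (D p)))
     = - (\<Sum>j\<in>K. frag_cmul (color_sign K j * color_sign (K - {j}) p) (signed_sum (?Y j) (a p) (D p)))"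
    by (simp add: sum_negf flip: minus_frag_cmul)
  then show ?thesis
  proof -
    have "(\<lambda>j. if j = p then D j else a j) = a(p := D p)" by auto
    then show ?thesis unfolding 1 2 using False
     \<open>(\<Sum>j\<in>K. frag_cmul (color_sign K p * color_sign (insert p K) j) (signed_sum (?Y j) (a p) (D p))) = _\<close>
      by (simp add: collapse_def)
  qed
qed

text \<open>The coordinates are collapsed in turn, the largest first: the \<open>p\<close>-th sweep is applied after those above
  \<open>p\<close> have been collapsed. Any order gives a contraction; this one leads to the formula for \<open>\<square>\<close>.\<close>

definition contract :: "nat \<Rightarrow> (nat \<Rightarrow> nat) \<Rightarrow> (nat \<Rightarrow> nat) \<times> nat set \<Rightarrow> ((nat \<Rightarrow> nat) \<times> nat set \<Rightarrow>\<^sub>0 int)"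
  where "contract k D x = (\<Sum>p=1..k. frag_extend (sweep D p) (collapse D {p<..k} x))"

lemma collapse_collapse:
  assumes "p \<in> {1..k}"
  shows "frag_extend (collapse D {p}) (collapse D {p<..k} x) = collapse D {p - 1<..k} x"
proof -
  obtain a K where x: "x = (a, K)" by (cases x)
  have R: "{p - 1<..k} = insert p {p<..k}" using assms by auto
  have "(\<lambda>j. if j = p then D j else (if p < j \<and> j \<le> k then D j else a j)) 
    = (\<lambda>j. if j = p \<or> p < j \<and> j \<le> k then D j else a j)" by auto
  then show ?thesis unfolding x collapse_def R by auto
qed

lemma sum_pred_telescope: "(\<Sum>p=1..k. f (p - 1) - f p) = f 0 - f k"
  for f :: "nat \<Rightarrow> 'g::ab_group_add"
  by (induction k) simp_all

text \<open>The homotopies of the single sweeps telescope.\<close>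

lemma contract_homotopy_basis:
  assumes "finite K"
  shows "frag_extend box_bd (contract k D (a, K)) + frag_extend (contract k D) (box_bd (a, K))
    = collapse D {1..k} (a, K) - frag_of (a, K)"
proof -
  let ?T = "\<lambda>p. collapse D {p<..k}"
  have "frag_extend box_bd (frag_extend (sweep D p) (?T p (a, K)))
       + frag_extend (sweep D p) (frag_extend (?T p) (box_bd (a, K)))
     = ?T (p - 1) (a, K) - ?T p (a, K)" if p: "p \<in> {1..k}" for p
  proof -
    have "frag_extend box_bd (frag_extend (sweep D p) (?T p (a, K)))
       + frag_extend (sweep D p) (frag_extend (?T p) (box_bd (a, K)))
      = frag_extend (\<lambda>y. frag_extend box_bd (sweep D p y) + frag_extend (sweep D p) (box_bd y)) (?T p (a, K))"
      by (simp add: collapse_box_bd frag_extend_plus_fun frag_extend_frag_extend)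
    also have "\<dots> = frag_extend (\<lambda>y. collapse D {p} y - frag_of y) (?T p (a, K))"
    proof (rule frag_extend_eq)
      fix y assume "y \<in> supp (?T p (a, K))"
      then obtain a' where "y = (a', K)" by (auto simp: collapse_def split: if_splits)
      then show "frag_extend box_bd (sweep D p y) + frag_extend (sweep D p) (box_bd y)
          = collapse D {p} y - frag_of y"
        using sweep_homotopy[OF assms] by simp
    qed
    also have "\<dots> = ?T (p - 1) (a, K) - ?T p (a, K)"
      using collapse_collapse[OF p] by (simp add: frag_extend_diff_fun)
    finally show ?thesis .
  qed
  then have "frag_extend box_bd (contract k D (a, K)) + frag_extend (contract k D) (box_bd (a, K))
     = (\<Sum>p=1..k. ?T (p - 1) (a, K) - ?T p (a, K))"
    unfolding contract_def
    by (simp add: frag_extend_sum' frag_extend_sum_fun frag_extend_frag_extend flip: sum.distrib)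
  also have "\<dots> = ?T 0 (a, K) - ?T k (a, K)"
    by (rule sum_pred_telescope)
  also have "?T 0 = collapse D {1..k}" by (simp add: atLeastSucAtMost_greaterThanAtMost One_nat_def)
  finally show ?thesis
    by (simp add: collapse_def)
qed

lemma frag_extend_cmul_fun: "frag_extend (\<lambda>x. frag_cmul n (f x)) c = frag_cmul n (frag_extend f c)"
  by (simp add: frag_extend_def frag_cmul_sum mult_ac)

section \<open>The shuffle map\<close>

primrec lattice_path :: "(nat \<Rightarrow> nat) \<Rightarrow> nat list \<Rightarrow> (nat \<Rightarrow> nat) list" where
  "lattice_path a [] = [a]"
| "lattice_path a (c # cs) = a # lattice_path (a + evec c) cs"

text \<open>On lists without repetitions this is the usual number of inversions.\<close>

primrec inversions :: "nat list \<Rightarrow> nat" where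
  "inversions [] = 0"
| "inversions (c # cs) = card {d \<in> set cs. d < c} + inversions cs"

text \<open>The signed triangulation of the cube \<open>(a, K)\<close> by the edge paths from its lower to its upper corner.\<close>

definition shuffle :: "(nat \<Rightarrow> nat) \<times> nat set \<Rightarrow> ((nat \<Rightarrow> nat) list \<Rightarrow>\<^sub>0 int)"
  where "shuffle = (\<lambda>(a, K). \<Sum>cs\<in>permutations_of_set K.
     frag_cmul ((-1) ^ inversions cs) (frag_of (lattice_path a cs)))"

lemma shuffle_empty: "shuffle (a, {}) = frag_of [a]"
  by (simp add: shuffle_def)

text \<open>The edge paths are sorted by their first step; the inversions caused by it are counted by the colour
  sign.\<close>

lemma shuffle_rec:
  assumes "finite K" "K \<noteq> {}"
  shows "shuffle (a, K) = (\<Sum>j\<in>K. frag_cmul (color_sign K j)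
     (frag_extend (\<lambda>ys. frag_of (a # ys)) (shuffle (a + evec j, K - {j}))))"
proof -
  have "shuffle (a, K) = (\<Sum>j\<in>K. \<Sum>cs\<in>(#) j ` permutations_of_set (K - {j}).
     frag_cmul ((-1) ^ inversions cs) (frag_of (lattice_path a cs)))"
    unfolding shuffle_def prod.case permutations_of_set_nonempty[OF assms(2)]
    by (rule sum.UNION_disjoint) (use assms in auto)
  also have "\<dots> = (\<Sum>j\<in>K. \<Sum>cs\<in>permutations_of_set (K - {j}).
     frag_cmul ((-1) ^ inversions (j # cs)) (frag_of (lattice_path a (j # cs))))"
    by (simp add: sum.reindex inj_on_def)
  also have "\<dots> = (\<Sum>j\<in>K. frag_cmul (color_sign K j)
     (frag_extend (\<lambda>ys. frag_of (a # ys)) (shuffle (a + evec j, K - {j}))))"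
  proof (rule sum.cong[OF refl])
    fix j assume "j \<in> K"
    have "(-1) ^ inversions (j # cs) = color_sign K j * (-1) ^ inversions cs"
      if "cs \<in> permutations_of_set (K - {j})" for cs
    proof -
      have "{d \<in> set cs. d < j} = {d \<in> K. d < j}" using that by (auto simp: permutations_of_set_def)
      then show ?thesis by (simp add: color_sign_def power_add)
    qed
    then show "(\<Sum>cs\<in>permutations_of_set (K - {j}).
       frag_cmul ((-1) ^ inversions (j # cs)) (frag_of (lattice_path a (j # cs))))
      = frag_cmul (color_sign K j)
     (frag_extend (\<lambda>ys. frag_of (a # ys)) (shuffle (a + evec j, K - {j})))"
      by (simp add: shuffle_def frag_extend_sum' frag_extend_cmul frag_cmul_sum del: inversions.simps)
  qed
  finally show ?thesis .
qed

lemma sum_pairs_swap: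
  assumes "finite K"
  shows "(\<Sum>i\<in>K. \<Sum>j\<in>K - {i}. g i j) = (\<Sum>i\<in>K. \<Sum>j\<in>K - {i}. g j i)"
proof -
  have e: "K - {i} = {j \<in> K. i \<noteq> j}" "K - {i} = {j \<in> K. j \<noteq> i}" for i by auto
  show ?thesis
    unfolding e(1) by (subst sum.swap_restrict) (use assms e in auto)
qed

lemma sum_pairs_antisym:
  fixes f :: "'i \<Rightarrow> 'i \<Rightarrow> 'b \<Rightarrow>\<^sub>0 int"
  assumes "finite K" and "\<And>i j. i \<in> K \<Longrightarrow> j \<in> K \<Longrightarrow> i \<noteq> j \<Longrightarrow> f i j = - f j i"
  shows "(\<Sum>i\<in>K. \<Sum>j\<in>K - {i}. f i j) = 0"
proof -
  let ?s = "\<Sum>i\<in>K. \<Sum>j\<in>K - {i}. f i j"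
  have "?s = (\<Sum>i\<in>K. \<Sum>j\<in>K - {i}. - f j i)" using assms by (intro sum.cong) auto
  also have "\<dots> = - ?s" using sum_pairs_swap[OF assms(1), of f] by (simp add: sum_negf)
  finally show ?thesis by (rule frag_eq_minus_self)
qed

text \<open>By induction on the dimension, splitting off the first step. In the boundary of the tails, the faces
  through \<open>a + e\<^sub>i + e\<^sub>j\<close> occur for both orders of the first two steps and cancel. For \<open>K = {}\<close> the sides
  differ by the augmentation.\<close>

lemma shuffle_chain_map:
  assumes "finite K" "K \<noteq> {}"
  shows "frag_extend simplex_bd (shuffle (a, K)) = frag_extend shuffle (box_bd (a, K))"
  using assms
proof (induction "card K" arbitrary: a K)
  case (Suc n)
  note fin = Suc.prems(1)
  have R: "frag_extend shuffle (box_bd (a, K)) = (\<Sum>j\<in>K. frag_cmul (color_sign K j)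
      (shuffle (a + evec j, K - {j}) - shuffle (a, K - {j})))"
    using fin by (simp add: box_bd_def frag_extend_sum' frag_extend_cmul frag_extend_diff)
  show ?case
  proof (cases "n = 0")
    case True
    then obtain j where K: "K = {j}" using Suc.hyps(2) by (metis card_1_singletonE One_nat_def)
    show ?thesis unfolding R unfolding K
      by (simp add: shuffle_rec shuffle_empty frag_extend_cmul)
  next
    case False
    let ?C = "frag_extend (\<lambda>ys. frag_of (a # ys))"
    let ?b = "\<lambda>j i. a + evec j + evec i"
    have ne: "K - {j} \<noteq> {}" if "j \<in> K" for j
    proof
      assume "K - {j} = {}"
      then have "K = {j}" using that by auto
      then show False using Suc.hyps(2) False by simp
    qed
    have IH: "frag_extend simplex_bd (shuffle (b, K - {j})) = (\<Sum>i\<in>K - {j}. frag_cmul (color_sign (K - {j}) i)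
      (shuffle (b + evec i, K - {j} - {i}) - shuffle (b, K - {j} - {i})))" if "j \<in> K" for j b
    proof -
      have "n = card (K - {j})" using Suc.hyps(2) that fin by simp
      from Suc.hyps(1)[OF this _ ne[OF that]] show ?thesis
        using fin by (simp add: box_bd_def frag_extend_sum' frag_extend_cmul frag_extend_diff)
    qed
    have "frag_extend simplex_bd (shuffle (a, K)) = (\<Sum>j\<in>K. frag_cmul (color_sign K j)
      (shuffle (a + evec j, K - {j}) - ?C (frag_extend simplex_bd (shuffle (a + evec j, K - {j})))))"
      unfolding shuffle_rec[OF Suc.prems]
      using fin by (simp add: frag_extend_sum' frag_extend_cmul frag_extend_frag_extend frag_extend_diff_fun)
    also have "\<dots> = (\<Sum>j\<in>K. frag_cmul (color_sign K j) (shuffle (a + evec j, K - {j})))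
       - (\<Sum>j\<in>K. \<Sum>i\<in>K - {j}. frag_cmul (color_sign K j * color_sign (K - {j}) i)
           (?C (shuffle (?b j i, K - {j} - {i}))))
       + (\<Sum>j\<in>K. \<Sum>i\<in>K - {j}. frag_cmul (color_sign K j * color_sign (K - {j}) i)
           (?C (shuffle (a + evec j, K - {j} - {i}))))"
      using fin by (simp add: IH frag_cmul_diff frag_cmul_sum frag_extend_sum' frag_extend_cmul frag_extend_diff
          sum_subtractf)
    also have "(\<Sum>j\<in>K. \<Sum>i\<in>K - {j}. frag_cmul (color_sign K j * color_sign (K - {j}) i)
           (?C (shuffle (?b j i, K - {j} - {i})))) = 0"
    proof (rule sum_pairs_antisym[OF fin])
      fix i j assume "i \<in> K" "j \<in> K" "i \<noteq> j"
      moreover have "?b i j = ?b j i" "K - {i} - {j} = K - {j} - {i}" by (auto simp: fun_eq_iff)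
      ultimately show "frag_cmul (color_sign K i * color_sign (K - {i}) j) (?C (shuffle (?b i j, K - {i} - {j})))
        = - frag_cmul (color_sign K j * color_sign (K - {j}) i) (?C (shuffle (?b j i, K - {j} - {i})))"
        using color_sign_swap[OF fin, of j i] by simp
    qed
    also have "(\<Sum>j\<in>K. \<Sum>i\<in>K - {j}. frag_cmul (color_sign K j * color_sign (K - {j}) i)
           (?C (shuffle (a + evec j, K - {j} - {i}))))
        = - (\<Sum>j\<in>K. frag_cmul (color_sign K j) (shuffle (a, K - {j})))"
    proof -
      have "shuffle (a, K - {j}) = (\<Sum>i\<in>K - {j}. frag_cmul (color_sign (K - {j}) i)
          (?C (shuffle (a + evec i, K - {j} - {i}))))" if "j \<in> K" for j
        using shuffle_rec[OF _ ne[OF that], of a] fin by simp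
      then have "(\<Sum>j\<in>K. frag_cmul (color_sign K j) (shuffle (a, K - {j})))
         = (\<Sum>j\<in>K. \<Sum>i\<in>K - {j}. frag_cmul (color_sign K j * color_sign (K - {j}) i)
           (?C (shuffle (a + evec i, K - {j} - {i}))))"
        by (simp add: frag_cmul_sum)
      also have "\<dots> = (\<Sum>j\<in>K. \<Sum>i\<in>K - {j}. frag_cmul (color_sign K i * color_sign (K - {i}) j)
           (?C (shuffle (a + evec j, K - {i} - {j}))))"
        by (rule sum_pairs_swap[OF fin])
      also have "\<dots> = (\<Sum>j\<in>K. \<Sum>i\<in>K - {j}. - frag_cmul (color_sign K j * color_sign (K - {j}) i)
           (?C (shuffle (a + evec j, K - {j} - {i}))))"
      proof (intro sum.cong refl)
        fix j i assume "j \<in> K" "i \<in> K - {j}"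
        moreover have "K - {i} - {j} = K - {j} - {i}" by auto
        ultimately show "frag_cmul (color_sign K i * color_sign (K - {i}) j) (?C (shuffle (a + evec j, K - {i} - {j})))
          = - frag_cmul (color_sign K j * color_sign (K - {j}) i) (?C (shuffle (a + evec j, K - {j} - {i})))"
          using color_sign_swap[OF fin, of i j] by simp
      qed
      finally show ?thesis by (simp add: sum_negf del: minus_frag_cmul)
    qed
    finally show ?thesis unfolding R by (simp add: frag_cmul_diff sum_subtractf plus_fun_def)
  qed
qed auto

section \<open>The Alexander-Whitney map\<close>

text \<open>The list is reversed to expose the last point. The sign cancels those of the sweeps: the only sweeps
  that contribute add a direction above all those of a cube of dimension \<open>length ys\<close>.\<close>

fun aw_rev :: "nat \<Rightarrow> (nat \<Rightarrow> nat) list \<Rightarrow> ((nat \<Rightarrow> nat) \<times> nat set \<Rightarrow>\<^sub>0 int)" where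
  "aw_rev k [] = 0"
| "aw_rev k [x] = frag_of (x, {})"
| "aw_rev k (x # y # ys) = frag_cmul ((-1) ^ length ys) (frag_extend (contract k x) (aw_rev k (y # ys)))"

definition aw :: "nat \<Rightarrow> (nat \<Rightarrow> nat) list \<Rightarrow> ((nat \<Rightarrow> nat) \<times> nat set \<Rightarrow>\<^sub>0 int)"
  where "aw k xs = aw_rev k (rev xs)"

lemma aw_Nil [simp]: "aw k [] = 0"
  and aw_single [simp]: "aw k [x] = frag_of (x, {})"
  by (simp_all add: aw_def)

lemma aw_snoc:
  "xs \<noteq> [] \<Longrightarrow> aw k (xs @ [x]) = frag_cmul ((-1) ^ (length xs - 1)) (frag_extend (contract k x) (aw k xs))"
  unfolding aw_def by (cases xs rule: rev_cases) auto

lemma keys_signed_sum: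
  "supp (signed_sum f a b) \<subseteq> (\<Union>t. supp (f t))"
  unfolding signed_sum_def
  using keys_diff[of "sum f {..<b}" "sum f {..<a}"] keys_sum[of f "{..<b}"] keys_sum[of f "{..<a}"] by blast

lemma keys_contract:
  assumes "(b, L) \<in> supp (contract k D (a, K))"
  shows "\<exists>p. p \<in> {1..k} \<and> p \<notin> K \<and> L = insert p K"
proof -
  from assms obtain p where p: "p \<in> {1..k}"
    and "(b, L) \<in> supp (frag_extend (sweep D p) (collapse D {p<..k} (a, K)))"
    unfolding contract_def using keys_sum by fastforce
  then obtain a' where "(b, L) \<in> supp (sweep D p (a', K))"
    using keys_frag_extend by (fastforce simp: collapse_def split: if_splits)
  then show ?thesis using p
    by (auto simp: sweep_def split: if_splits dest!: subsetD[OF keys_signed_sum])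
qed

lemma keys_aw:
  assumes "(b, L) \<in> supp (aw k xs)"
  shows "L \<subseteq> {1..k} \<and> card L = length xs - 1"
  using assms
proof (induction xs arbitrary: b L rule: rev_induct)
  case (snoc x xs)
  show ?case
  proof (cases "xs = []")
    case False
    then have "(b, L) \<in> supp (frag_extend (contract k x) (aw k xs))"
      using snoc.prems by (simp add: aw_snoc)
    then obtain a K where aK: "(a, K) \<in> supp (aw k xs)"
      and "(b, L) \<in> supp (contract k x (a, K))"
      using keys_frag_extend by fast
    then obtain p where p: "p \<in> {1..k} \<and> p \<notin> K \<and> L = insert p K" using keys_contract by blast
    have K: "K \<subseteq> {1..k}" "card K = length xs - 1" using snoc.IH[OF aK] by auto
    then have "finite K" using finite_subset by blast
    then show ?thesis using K p False by (cases xs) auto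
  qed (use snoc.prems in auto)
qed auto

lemma contract_homotopy:
  assumes "\<And>y. y \<in> supp c \<Longrightarrow> finite (snd y)"
  shows "frag_extend box_bd (frag_extend (contract k D) c) + frag_extend (contract k D) (frag_extend box_bd c)
    = frag_extend (collapse D {1..k}) c - c"
proof -
  have "frag_extend box_bd (frag_extend (contract k D) c) + frag_extend (contract k D) (frag_extend box_bd c)
    = frag_extend (\<lambda>y. frag_extend box_bd (contract k D y) + frag_extend (contract k D) (box_bd y)) c"
    by (simp add: frag_extend_plus_fun frag_extend_frag_extend)
  also have "\<dots> = frag_extend (\<lambda>y. collapse D {1..k} y - frag_of y) c"
    using assms by (intro frag_extend_eq) (auto simp: contract_homotopy_basis)
  finally show ?thesis by (simp add: frag_extend_diff_fun)
qed

lemma keys_simplex_bd: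
  assumes "ys \<in> supp (simplex_bd xs)"
  shows "\<exists>i<length xs. ys = take i xs @ drop (Suc i) xs"
proof -
  from assms have "ys \<in> (\<Union>i<length xs. supp
      (frag_cmul ((-1) ^ i) (frag_of (take i xs @ drop (Suc i) xs))))"
    unfolding simplex_bd_eq_sum by (rule subsetD[OF keys_sum])
  then show ?thesis by auto
qed

text \<open>Write \<open>S\<close> for the contraction towards the last point \<open>x\<close>. In positive degrees \<open>\<partial>S = - id - S\<partial>\<close>, as the
  collapse vanishes there. So \<open>\<partial> aw(xs,x)\<close> is, up to sign, \<open>aw(xs)\<close> plus \<open>S \<partial> aw(xs)\<close>; by induction the latter is
  \<open>S\<close> of the faces of \<open>xs\<close>, which are the faces of the whole list that keep \<open>x\<close>.\<close>

theorem aw_chain_map: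
  assumes "xs \<noteq> []" "set xs \<subseteq> Nvec k"
  shows "frag_extend box_bd (aw k xs) = frag_extend (aw k) (simplex_bd xs)"
  using assms
proof (induction xs rule: rev_induct)
  case (snoc x xs)
  show ?case
  proof (cases "xs = []")
    case True
    then show ?thesis by (simp add: box_bd_def)
  next
    case ne: False
    have IH: "frag_extend box_bd (aw k xs) = frag_extend (aw k) (simplex_bd xs)"
      using snoc ne by simp
    have fin: "finite (snd y)" if "y \<in> supp (aw k xs)" for y
      using that by (cases y) (auto dest!: keys_aw intro: finite_subset)
    let ?e = "(-1) ^ (length xs - 1) :: int"
    let ?S = "frag_extend (contract k x)"
    have A: "frag_extend box_bd (aw k (xs @ [x])) =
       frag_cmul ?e (frag_extend (collapse x {1..k}) (aw k xs)) - frag_cmul ?e (aw k xs)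
       - frag_cmul ?e (?S (frag_extend (aw k) (simplex_bd xs)))"
    proof -
      have "frag_extend box_bd (aw k (xs @ [x])) = frag_cmul ?e (frag_extend box_bd (?S (aw k xs)))"
        using ne by (simp add: aw_snoc frag_extend_cmul)
      also have "frag_extend box_bd (?S (aw k xs)) = frag_extend (collapse x {1..k}) (aw k xs) - aw k xs
           - ?S (frag_extend (aw k) (simplex_bd xs))"
      proof -
        have H: "frag_extend box_bd (?S (aw k xs)) + ?S (frag_extend box_bd (aw k xs))
          = frag_extend (collapse x {1..k}) (aw k xs) - aw k xs"
          by (rule contract_homotopy) (rule fin)
        show ?thesis unfolding H[symmetric] IH by simp
      qed
      finally show ?thesis by (simp add: frag_cmul_diff)
    qed
    have B: "frag_extend (aw k) (simplex_bd (xs @ [x])) =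
       frag_extend (\<lambda>ys. aw k (ys @ [x])) (simplex_bd xs) + frag_cmul ((-1) ^ length xs) (aw k xs)"
      by (simp add: simplex_bd_snoc frag_extend_add frag_extend_cmul frag_extend_frag_extend)
    have sgn: "frag_cmul ((-1) ^ length xs) (aw k xs) = - frag_cmul ?e (aw k xs)"
    proof -
      have "length xs = Suc (length xs - 1)" using ne by simp
      then have "(-1) ^ length xs = - ?e" by (metis power_Suc mult_minus1)
      then show ?thesis by simp
    qed
    show ?thesis
    proof (cases "length xs = 1")
      \<comment> \<open>In degree \<open>0\<close> the collapse yields \<open>x\<close>, the end point of the edge.\<close>
      case True
      then obtain y where xs: "xs = [y]" by (cases xs) auto
      have "(\<lambda>j. if j \<in> {1..k} then x j else y j) = x"
        using snoc.prems by (auto simp: xs Nvec_def)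
      then show ?thesis unfolding A B sgn using True
        by (simp add: xs collapse_def)
    next
      case False
      have 1: "frag_extend (collapse x {1..k}) (aw k xs) = 0"
      proof (rule frag_extend_eq_0)
        fix y assume y: "y \<in> supp (aw k xs)"
        obtain a K where yy: "y = (a, K)" by (cases y)
        have "K \<subseteq> {1..k}" "card K = length xs - 1" using keys_aw y yy by auto
        moreover have "length xs - 1 \<noteq> 0"
          using False ne length_greater_0_conv[of xs] by linarith
        ultimately have "K \<inter> {1..k} = K" "K \<noteq> {}" by auto
        then have "K \<inter> {1..k} \<noteq> {}" by simp
        then show "collapse x {1..k} y = 0" by (simp add: collapse_def yy)
      qed
      have 2: "frag_extend (\<lambda>ys. aw k (ys @ [x])) (simplex_bd xs)
        = - frag_cmul ?e (?S (frag_extend (aw k) (simplex_bd xs)))"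
      proof -
        have "frag_extend (\<lambda>ys. aw k (ys @ [x])) (simplex_bd xs)
          = frag_extend (\<lambda>ys. - frag_cmul ?e (?S (aw k ys))) (simplex_bd xs)"
        proof (rule frag_extend_eq)
          fix ys assume "ys \<in> supp (simplex_bd xs)"
          then obtain i where "i < length xs" "ys = take i xs @ drop (Suc i) xs"
            using keys_simplex_bd by blast
          then have "length ys = length xs - 1" by auto
          moreover have l: "length xs - 1 = Suc (length xs - 2)"
            using False ne length_greater_0_conv[of xs] by linarith
          ultimately have "ys \<noteq> []" "length ys - 1 = length xs - 2" by auto
          then show "aw k (ys @ [x]) = - frag_cmul ?e (?S (aw k ys))"
            unfolding l by (simp add: aw_snoc)
        qed
        also have "\<dots> = frag_cmul (- ?e) (?S (frag_extend (aw k) (simplex_bd xs)))"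
          by (simp add: frag_extend_cmul_fun frag_extend_frag_extend)
        finally show ?thesis by simp
      qed
      show ?thesis unfolding A B 1 2 sgn by simp
    qed
  qed
qed simp

section \<open>A left inverse of the shuffle map\<close>

lemma sum_evec_apply: "finite K \<Longrightarrow> (\<Sum>j\<in>K. evec j) i = (if i \<in> K then 1 else 0)"
  by (induction K rule: finite_induct) (auto simp: evec_apply)

lemma lattice_path_snoc:
  "distinct (cs @ [p]) \<Longrightarrow>
    lattice_path a (cs @ [p]) = lattice_path a cs @ [a + (\<Sum>j\<in>set (cs @ [p]). evec j)]"
proof (induction cs arbitrary: a)
  case (Cons c cs)
  then show ?case by (auto simp: fun_eq_iff add_ac)
qed auto

lemma length_lattice_path [simp]: "length (lattice_path a cs) = Suc (length cs)"
  by (induction cs arbitrary: a) auto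

text \<open>If some direction of the cube is above \<open>p\<close>, the cube is killed by the collapse; if \<open>p\<close> itself is one,
  by the sweep. Hence only directions \<open>p\<close> above all those of \<open>K\<close> remain.\<close>

lemma contract_mono:
  assumes K: "K \<subseteq> {1..k}" and aD: "\<And>p. p \<in> {1..k} \<Longrightarrow> K \<subseteq> {..<p} \<Longrightarrow> a p \<le> D p"
  shows "contract k D (a, K) = frag_cmul ((-1) ^ card K) (\<Sum>p | p \<in> {1..k} \<and> K \<subseteq> {..<p}. \<Sum>t=a p..<D p.
     frag_of ((\<lambda>j. if p < j \<and> j \<le> k then D j else a j)(p := t), insert p K))"
proof -
  let ?F = "\<lambda>p t. frag_of ((\<lambda>j. if p < j \<and> j \<le> k then D j else a j)(p := t), insert p K)"
  have "frag_extend (sweep D p) (collapse D {p<..k} (a, K)) =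
     (if K \<subseteq> {..<p} then frag_cmul ((-1) ^ card K) (\<Sum>t=a p..<D p. ?F p t) else 0)"
    if p: "p \<in> {1..k}" for p
  proof (cases "K \<subseteq> {..<p}")
    case True
    have "K \<inter> {p<..k} = {}" "p \<notin> K" "{i \<in> K. i < p} = K" using True by auto
    then show ?thesis using True aD[OF p True]
      by (simp add: collapse_def sweep_def color_sign_def signed_sum_eq_sum)
  next
    case False
    then obtain x where "x \<in> K" "p \<le> x" by (auto simp: subset_eq not_less[symmetric])
    then have "p \<in> K \<or> x \<in> K \<inter> {p<..k}" using K by (cases "x = p") auto
    then show ?thesis using False by (auto simp: collapse_def sweep_def)
  qed
  then have "contract k D (a, K) = (\<Sum>p=1..k. if K \<subseteq> {..<p} then frag_cmul ((-1) ^ card K) (\<Sum>t=a p..<D p. ?F p t) else 0)"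
    by (simp add: contract_def)
  also have "\<dots> = (\<Sum>p | p \<in> {1..k} \<and> K \<subseteq> {..<p}. frag_cmul ((-1) ^ card K) (\<Sum>t=a p..<D p. ?F p t))"
    by (rule sum.inter_filter[symmetric]) simp
  finally show ?thesis by (simp add: frag_cmul_sum)
qed

text \<open>From the upper corner of the cube built so far to the next point only the coordinate \<open>p\<close> moves, so the
  contraction consists of the sweep in direction \<open>p\<close>, and this occurs only if \<open>p\<close> is above all earlier
  directions.\<close>

lemma aw_lattice_path:
  assumes "distinct cs" "set cs \<subseteq> {1..k}"
  shows "aw k (lattice_path a cs) = (if sorted cs then frag_of (a, set cs) else 0)"
  using assms
proof (induction cs rule: rev_induct)
  case (snoc p cs)
  define D where "D = a + (\<Sum>j\<in>set (cs @ [p]). evec j)"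
  have D: "D j = (if j \<in> set cs \<or> j = p then Suc (a j) else a j)" for j
    using sum_evec_apply[of "set (cs @ [p])" j] by (simp add: D_def)
  have "aw k (lattice_path a (cs @ [p])) = frag_cmul ((-1) ^ length cs)
      (frag_extend (contract k D) (aw k (lattice_path a cs)))"
    by (subst lattice_path_snoc[OF snoc.prems(1)], subst D_def[symmetric], subst aw_snoc) (auto simp flip: length_greater_0_conv)
  also have "\<dots> = (if sorted cs then frag_cmul ((-1) ^ length cs) (contract k D (a, set cs)) else 0)"
    using snoc by simp
  also have "\<dots> = (if sorted (cs @ [p]) then frag_of (a, set (cs @ [p])) else 0)"
  proof (cases "sorted cs")
    case True
    have "contract k D (a, set cs) = frag_cmul ((-1) ^ card (set cs))
       (\<Sum>q | q \<in> {1..k} \<and> set cs \<subseteq> {..<q}. \<Sum>t=a q..<D q.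
     frag_of ((\<lambda>j. if q < j \<and> j \<le> k then D j else a j)(q := t), insert q (set cs)))"
      by (rule contract_mono) (use snoc.prems D in auto)
    also have "(\<Sum>q | q \<in> {1..k} \<and> set cs \<subseteq> {..<q}. \<Sum>t=a q..<D q.
     frag_of ((\<lambda>j. if q < j \<and> j \<le> k then D j else a j)(q := t), insert q (set cs)))
      = (\<Sum>q | q \<in> {1..k} \<and> set cs \<subseteq> {..<q}. if q = p then frag_of (a, insert p (set cs)) else 0)"
    proof (intro sum.cong refl)
      fix q assume q: "q \<in> {q. q \<in> {1..k} \<and> set cs \<subseteq> {..<q}}"
      show "(\<Sum>t=a q..<D q.
         frag_of ((\<lambda>j. if q < j \<and> j \<le> k then D j else a j)(q := t), insert q (set cs)))
        = (if q = p then frag_of (a, insert p (set cs)) else 0)"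
      proof (cases "q = p")
        case True
        have "(\<lambda>j. if p < j \<and> j \<le> k then D j else a j)(p := a p) = a"
          using q True by (auto simp: D fun_eq_iff)
        then show ?thesis using True D by simp
      next
        case False
        then have "D q = a q" using q D by auto
        then show ?thesis using False by simp
      qed
    qed
    also have "\<dots> = (if set cs \<subseteq> {..<p} then frag_of (a, insert p (set cs)) else 0)"
      using snoc.prems by (subst sum.delta) auto
    also have "set cs \<subseteq> {..<p} \<longleftrightarrow> sorted (cs @ [p])"
      using True snoc.prems(1) by (auto simp: sorted_append less_le)
    finally show ?thesis using True snoc.prems(1)
      by (simp add: distinct_card flip: power_mult_distrib)
  qed (simp add: sorted_append)
  finally show ?case .
qed auto

lemma inversions_sorted: "sorted cs \<Longrightarrow> inversions cs = 0"
proof (induction cs)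
  case (Cons c cs)
  then have "{d \<in> set cs. d < c} = {}" by auto
  then show ?case using Cons by simp
qed auto

lemma aw_shuffle:
  assumes "K \<subseteq> {1..k}"
  shows "frag_extend (aw k) (shuffle (a, K)) = frag_of (a, K)"
proof -
  have fin: "finite K" using assms finite_subset by blast
  have "frag_extend (aw k) (shuffle (a, K)) =
     (\<Sum>cs\<in>permutations_of_set K. if cs = sorted_list_of_set K then frag_of (a, K) else 0)"
    unfolding shuffle_def prod.case frag_extend_sum'[OF finite_permutations_of_set]
  proof (intro sum.cong refl)
    fix cs assume "cs \<in> permutations_of_set K"
    then have cs: "set cs = K" "distinct cs" by (auto simp: permutations_of_set_def)
    moreover have "sorted cs \<longleftrightarrow> cs = sorted_list_of_set K"
      using cs fin by (metis sorted_list_of_set.idem_if_sorted_distinct sorted_list_of_set.sorted_sorted_key_list_of_set)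
    ultimately show "frag_extend (aw k) (frag_cmul ((-1) ^ inversions cs) (frag_of (lattice_path a cs)))
       = (if cs = sorted_list_of_set K then frag_of (a, K) else 0)"
      using assms by (auto simp: frag_extend_cmul aw_lattice_path inversions_sorted)
  qed
  also have "\<dots> = frag_of (a, K)"
    using fin by (subst sum.delta[OF finite_permutations_of_set]) (auto simp: permutations_of_set_def)
  finally show ?thesis .
qed

section \<open>Signs of orderings\<close>

lemma inversions_swap:
  "distinct (as @ y # x # bs) \<Longrightarrow> x < y \<Longrightarrow>
    inversions (as @ y # x # bs) = Suc (inversions (as @ x # y # bs))"
proof (induction as)
  case Nil
  then have "{d \<in> set (x # bs). d < y} = insert x {d \<in> set bs. d < y}"
     "{d \<in> set (y # bs). d < x} = {d \<in> set bs. d < x}" "x \<notin> set bs" by auto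
  then show ?case by simp
next
  case (Cons a as)
  have "set (as @ y # x # bs) = set (as @ x # y # bs)" by auto
  then show ?case using Cons by simp
qed

lemma not_sorted_descent:
  "\<not> sorted cs \<Longrightarrow> \<exists>as x y bs. cs = as @ y # x # bs \<and> (x :: nat) < y"
proof (induction cs rule: induct_list012)
  case (3 c d cs)
  show ?case
  proof (cases "d < c")
    case True
    then show ?thesis by (metis append_Nil)
  next
    case False
    then have "\<not> sorted (d # cs)" using 3(3) by (auto simp: not_less intro: order_trans[of c d])
    then show ?thesis using 3(2) by (metis append_Cons)
  qed
qed auto

text \<open>Exchanging two neighbours in descending order removes exactly one inversion and changes the sign of the
  permutation; a permutation without descents is the identity.\<close>

lemma sign_eq_inversions:
  assumes "\<sigma> permutes {1..n}"
  shows "sign \<sigma> = (-1) ^ inversions (map \<sigma> [1..<n + 1])"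
  using assms
proof (induction "inversions (map \<sigma> [1..<n + 1])" arbitrary: \<sigma> rule: less_induct)
  case less
  note perm = less.prems
  let ?cs = "map \<sigma> [1..<n + 1]"
  have inj: "inj \<sigma>" using perm permutes_inj by blast
  have dist: "distinct ?cs" using inj by (simp add: distinct_map inj_on_def)
  show ?case
  proof (cases "sorted ?cs")
    case True
    have r: "{1..<n + 1} = {1..n}" by auto
    have "set ?cs = {1..n}" using permutes_image[OF perm] r by simp
    then have "?cs = [1..<n + 1]"
      using True dist r by (intro sorted_distinct_set_unique) auto
    have "\<sigma> i = i" for i
    proof (cases "i \<in> {1..n}")
      case True
      then have "i - 1 < n" "1 + (i - 1) = i" by auto
      then have "?cs ! (i - 1) = \<sigma> i" "[1..<n + 1] ! (i - 1) = i" by (simp_all del: upt_Suc)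
      then show ?thesis using \<open>?cs = _\<close> by simp
    qed (use perm in \<open>auto simp: permutes_def\<close>)
    then have "\<sigma> = id" by auto
    then show ?thesis using inversions_sorted[OF True] by simp
  next
    case False
    then obtain as x y bs where cs: "?cs = as @ y # x # bs" and xy: "x < y"
      using not_sorted_descent by blast
    let ?i = "Suc (length as)" and ?j = "Suc (Suc (length as))"
    let ?\<tau> = "\<sigma> \<circ> transpose ?i ?j"
    have len: "length as + 2 + length bs = n" using arg_cong[OF cs, of length] by simp
    have nth: "(as @ y # x # bs) ! i = \<sigma> (Suc i)" if "i < n" for i
      unfolding cs[symmetric] using that by (simp add: One_nat_def del: upt_Suc)
    have yx: "\<sigma> ?i = y" "\<sigma> ?j = x" using nth[of "length as"] nth[of "Suc (length as)"] len
      by (simp_all add: nth_append)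
    have "transpose ?i ?j permutes {1..n}" by (rule permutes_swap_id) (use len in auto)
    then have perm': "?\<tau> permutes {1..n}" using perm permutes_compose by blast
    have map': "map ?\<tau> [1..<n + 1] = as @ x # y # bs"
    proof (rule nth_equalityI)
      fix i assume "i < length (map ?\<tau> [1..<n + 1])"
      then have i: "i < n" by simp
      have "(as @ x # y # bs) ! i = ?\<tau> (Suc i)"
      proof -
        consider "i < length as" | "i = length as" | "i = Suc (length as)" | "i > Suc (length as)" by linarith
        then show ?thesis
        proof cases
          case 4
          then show ?thesis using nth[OF i] by (auto simp: nth_append transpose_def nth_Cons split: nat.splits)
        qed (use nth[OF i] yx in \<open>auto simp: nth_append transpose_def\<close>)
      qed
      then show "map ?\<tau> [1..<n + 1] ! i = (as @ x # y # bs) ! i" using i by (simp add: One_nat_def del: upt_Suc)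
    qed (use len in simp)
    have inv: "inversions ?cs = Suc (inversions (map ?\<tau> [1..<n + 1]))"
      unfolding cs map' using dist cs xy by (metis inversions_swap)
    have "sign ?\<tau> = (-1) ^ inversions (map ?\<tau> [1..<n + 1])"
      by (rule less.hyps[OF _ perm']) (use inv in simp)
    moreover have "sign ?\<tau> = - sign \<sigma>"
    proof -
      have "permutation \<sigma>" using perm permutation_permutes by blast
      then show ?thesis by (simp add: sign_compose permutation_swap_id sign_swap_id)
    qed
    ultimately show ?thesis unfolding inv by simp
  qed
qed

lemma inversions_map:
  "strict_mono_on (set cs) f \<Longrightarrow> distinct cs \<Longrightarrow> inversions (map f cs) = inversions cs"
proof (induction cs)
  case (Cons c cs)
  have inj: "inj_on f (set (c # cs))" using Cons.prems(1) strict_mono_on_imp_inj_on by blast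
  have "f d < f c \<longleftrightarrow> d < c" if "d \<in> set cs" for d
    using Cons.prems(1) that strict_mono_on_less[of "set (c # cs)" f d c] by simp
  then have "{d \<in> f ` set cs. d < f c} = f ` {d \<in> set cs. d < c}" by auto
  moreover have "card (f ` {d \<in> set cs. d < c}) = card {d \<in> set cs. d < c}"
    by (rule card_image) (rule inj_on_subset[OF inj], auto)
  ultimately show ?case using Cons by (simp add: strict_mono_on_def)
qed auto

lemma ith_smallest_strict_mono:
  "finite K \<Longrightarrow> strict_mono_on {1..card K} (ith_smallest K)"
  unfolding ith_smallest_def
  by (intro strict_mono_onI sorted_wrt_nth_less[OF strict_sorted_list_of_set]) auto

lemma ith_smallest_image:
  assumes "finite K" shows "ith_smallest K ` {1..card K} = K"
proof -
  have "K = set (sorted_list_of_set K)" using assms by simp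
  also have "\<dots> = (\<lambda>i. sorted_list_of_set K ! i) ` {0..<card K}"
    using assms by (auto simp: set_conv_nth image_def)
  also have "{0..<card K} = (\<lambda>i. i - 1) ` {1..card K}"
    by (auto simp: image_iff One_nat_def intro!: bexI[of _ "Suc _"])
  finally show ?thesis by (simp add: ith_smallest_def image_image)
qed

text \<open>A permutation of the positions is turned into an ordering of \<open>K\<close> by reading off the elements; as the
  enumeration of \<open>K\<close> is increasing, inversions are preserved.\<close>

lemma sum_permutes_eq_sum_orderings:
  assumes fin: "finite K"
  shows "(\<Sum>\<sigma> | \<sigma> permutes {1..card K}. frag_cmul (sign \<sigma>) (g (map (\<lambda>i. ith_smallest K (\<sigma> i)) [1..<card K + 1])))
    = (\<Sum>cs\<in>permutations_of_set K. frag_cmul ((-1) ^ inversions cs) (g cs))"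
proof -
  let ?n = "card K" let ?f = "\<lambda>\<sigma>. map (\<lambda>i. ith_smallest K (\<sigma> i)) [1..<card K + 1]"
  have set1: "set [1..<?n + 1] = {1..?n}" by (auto simp: One_nat_def)
  note smono = ith_smallest_strict_mono[OF fin]
  have inj: "inj_on (ith_smallest K) {1..?n}" using smono strict_mono_on_imp_inj_on by blast
  have f: "?f \<sigma> = map (ith_smallest K) (map \<sigma> [1..<?n + 1])" for \<sigma> by simp
  have im: "?f ` {\<sigma>. \<sigma> permutes {1..?n}} \<subseteq> permutations_of_set K"
  proof clarify
    fix \<sigma> assume s: "\<sigma> permutes {1..?n}"
    have "distinct (map \<sigma> [1..<?n + 1])" using permutes_inj[OF s] by (simp add: distinct_map inj_on_def)
    moreover have "set (map \<sigma> [1..<?n + 1]) = {1..?n}" using permutes_image[OF s] set1 by simp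
    ultimately show "?f \<sigma> \<in> permutations_of_set K"
      unfolding f permutations_of_set_def using inj ith_smallest_image[OF fin]
      by (simp only: distinct_map[of "ith_smallest K"] set_map[of "ith_smallest K"] mem_Collect_eq simp_thms)
  qed
  have injf: "inj_on ?f {\<sigma>. \<sigma> permutes {1..?n}}"
  proof (rule inj_onI, clarify)
    fix \<sigma> \<tau> assume s: "\<sigma> permutes {1..?n}" and t: "\<tau> permutes {1..?n}" and e: "?f \<sigma> = ?f \<tau>"
    show "\<sigma> = \<tau>"
    proof
      fix i show "\<sigma> i = \<tau> i"
      proof (cases "i \<in> {1..?n}")
        case True
        then have "ith_smallest K (\<sigma> i) = ith_smallest K (\<tau> i)" using e set1 by (metis map_eq_conv)
        moreover have "\<sigma> i \<in> {1..?n}" "\<tau> i \<in> {1..?n}"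
          using True permutes_in_image[OF s] permutes_in_image[OF t] by auto
        ultimately show ?thesis using inj by (meson inj_onD)
      qed (use s t in \<open>auto simp: permutes_def\<close>)
    qed
  qed
  have "?f ` {\<sigma>. \<sigma> permutes {1..?n}} = permutations_of_set K"
    by (rule card_subset_eq[OF finite_permutations_of_set im])
       (use injf fin in \<open>simp add: card_image card_permutations card_permutations_of_set\<close>)
  then have bij: "bij_betw ?f {\<sigma>. \<sigma> permutes {1..?n}} (permutations_of_set K)"
    using injf by (simp add: bij_betw_def)
  show ?thesis
  proof (subst sum.reindex_bij_betw[OF bij, symmetric], intro sum.cong refl)
    fix \<sigma> assume "\<sigma> \<in> {\<sigma>. \<sigma> permutes {1..?n}}"
    then have s: "\<sigma> permutes {1..?n}" by simp
    have "distinct (map \<sigma> [1..<?n + 1])" using permutes_inj[OF s] by (simp add: distinct_map inj_on_def)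
    moreover have "set (map \<sigma> [1..<?n + 1]) = {1..?n}" using permutes_image[OF s] set1 by simp
    ultimately have "inversions (?f \<sigma>) = inversions (map \<sigma> [1..<?n + 1])"
      unfolding f using smono by (intro inversions_map) simp_all
    then show "frag_cmul (sign \<sigma>) (g (?f \<sigma>)) = frag_cmul ((-1) ^ inversions (?f \<sigma>)) (g (?f \<sigma>))"
      using sign_eq_inversions[OF s] by simp
  qed
qed

section \<open>A closed formula for the Alexander-Whitney map\<close>

definition below :: "nat set \<Rightarrow> nat \<Rightarrow> nat"
  where "below K j = card {i \<in> K. i < j}"

text \<open>The values of the \<open>j\<close>-th coordinate of the cubes with direction set \<open>K\<close> in the image of \<open>xs\<close>. A
  coordinate is read off at the point whose index is the number of directions below \<open>j\<close>; if \<open>j\<close> is itself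
  a direction, the coordinate runs through the step to the next point.\<close>

definition aw_range :: "(nat \<Rightarrow> nat) list \<Rightarrow> nat set \<Rightarrow> nat \<Rightarrow> nat set"
  where "aw_range xs K j = (if j \<in> K then {(xs ! below K j) j..<(xs ! Suc (below K j)) j}
     else {(xs ! below K j) j})"

definition aw_region :: "(nat \<Rightarrow> nat) list \<Rightarrow> nat set \<Rightarrow> (nat \<Rightarrow> nat) set"
  where "aw_region xs K = {a. \<forall>j. a j \<in> aw_range xs K j}"

lemma finite_aw_region:
  assumes "finite K" shows "finite (aw_region xs K)"
proof (rule finite_imageD)
  have "(\<lambda>a. restrict a K) ` aw_region xs K \<subseteq> PiE K (aw_range xs K)"
    by (auto simp: aw_region_def)
  then show "finite ((\<lambda>a. restrict a K) ` aw_region xs K)"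
    by (rule finite_subset) (use assms in \<open>auto intro!: finite_PiE simp: aw_range_def\<close>)
  show "inj_on (\<lambda>a. restrict a K) (aw_region xs K)"
  proof (rule inj_onI, rule ext)
    fix a b j assume ab: "a \<in> aw_region xs K" "b \<in> aw_region xs K" "restrict a K = restrict b K"
    then have "a j \<in> aw_range xs K j" "b j \<in> aw_range xs K j" unfolding aw_region_def by blast+
    then show "a j = b j" using fun_cong[OF ab(3), of j]
      by (cases "j \<in> K") (simp_all add: aw_range_def)
  qed
qed

lemma below_le_card: "finite K \<Longrightarrow> below K j \<le> card K"
  unfolding below_def by (intro card_mono) auto

lemma below_less_card: "finite K \<Longrightarrow> j \<in> K \<Longrightarrow> below K j < card K"
  unfolding below_def by (intro psubset_card_mono) auto

lemma below_eq_card: "finite K \<Longrightarrow> K \<subseteq> {..<p} \<Longrightarrow> p \<le> j \<Longrightarrow> below K j = card K"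
  unfolding below_def by (intro arg_cong[where f=card]) auto

lemma below_insert:
  assumes "finite K" "K \<subseteq> {..<p}"
  shows "below (insert p K) j = (if p < j then Suc (card K) else below K j)"
proof (cases "p < j")
  case True
  then have "{i \<in> insert p K. i < j} = insert p K" using assms by auto
  moreover have "p \<notin> K" using assms by auto
  ultimately show ?thesis using True assms by (simp add: below_def)
next
  case False
  then have "{i \<in> insert p K. i < j} = {i \<in> K. i < j}" by auto
  then show ?thesis using False by (simp add: below_def)
qed

lemma aw_range_above:
  assumes "finite K" "K \<subseteq> {..<p}" "p \<le> j"
  shows "aw_range xs K j = {(xs ! card K) j}"
proof -
  have "j \<notin> K" using assms(2,3) by auto
  then show ?thesis using below_eq_card[OF assms] by (simp add: aw_range_def)
qed

lemma aw_range_snoc: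
  assumes "finite K" "K \<subseteq> {..<p}" "length xs = Suc (card K)"
  shows "j < p \<Longrightarrow> aw_range (xs @ [x]) (insert p K) j = aw_range xs K j"
    and "aw_range (xs @ [x]) (insert p K) p = {(xs ! card K) p..<x p}"
    and "p < j \<Longrightarrow> aw_range (xs @ [x]) (insert p K) j = {x j}"
proof -
  show "aw_range (xs @ [x]) (insert p K) j = aw_range xs K j" if "j < p"
    using that below_less_card[OF assms(1), of j] below_le_card[OF assms(1), of j] assms(3)
    by (auto simp: aw_range_def below_insert[OF assms(1,2)] nth_append)
  show "aw_range (xs @ [x]) (insert p K) p = {(xs ! card K) p..<x p}"
    using below_eq_card[OF assms(1,2), of p] assms(3)
    by (simp add: aw_range_def below_insert[OF assms(1,2)] nth_append)
  show "aw_range (xs @ [x]) (insert p K) j = {x j}" if "p < j"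
  proof -
    have "j \<notin> insert p K" using that assms(2) by auto
    then show ?thesis using that assms(3)
      by (simp add: aw_range_def below_insert[OF assms(1,2)] nth_append)
  qed
qed

text \<open>The largest direction \<open>p\<close> of a cube in the image of \<open>xs @ [x]\<close> stems from the last contraction, which
  leaves the coordinates below \<open>p\<close> alone, moves those above \<open>p\<close> to \<open>x\<close>, and lets the \<open>p\<close>-th one run
  through the last step.\<close>

theorem aw_closed:
  assumes "xs \<noteq> []" "sorted_wrt (\<le>) xs" "set xs \<subseteq> Nvec k"
  shows "aw k xs = (\<Sum>K | K \<subseteq> {1..k} \<and> card K = length xs - 1. \<Sum>a\<in>aw_region xs K. frag_of (a, K))"
  using assms
proof (induction xs rule: rev_induct)
  case (snoc x xs)
  show ?case
  proof (cases "xs = []")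
    case True
    have "{K. K \<subseteq> {1..k} \<and> card K = 0} = {{}}"
      by (auto dest: finite_subset simp: card_eq_0_iff)
    moreover have "aw_region [x] {} = {x}" by (auto simp: aw_region_def aw_range_def below_def)
    ultimately show ?thesis using True by simp
  next
    case ne: False
    define n where "n = length xs - 1"
    have len: "length xs = Suc n" using ne n_def by simp
    define X where "X = {K. K \<subseteq> {1..k} \<and> card K = n}"
    define Y where "Y = {K. K \<subseteq> {1..k} \<and> card K = Suc n}"
    have finX: "finite X" "finite Y" unfolding X_def Y_def by (auto intro: finite_subset[of _ "Pow {1..k}"])
    have finK: "finite K" "K \<subseteq> {1..k}" "card K = n" if "K \<in> X" for K
      using that unfolding X_def by (auto intro: finite_subset)
    have finK': "finite K" "K \<subseteq> {1..k}" "card K = Suc n" if "K \<in> Y" for K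
      using that unfolding Y_def by (auto intro: finite_subset)
    have lx: "xs ! n \<le> x" using snoc.prems(2) len by (simp add: sorted_wrt_append)
    have N: "xs ! n \<in> Nvec k" "x \<in> Nvec k" using snoc.prems(3) len by auto
    have IH: "aw k xs = (\<Sum>K\<in>X. \<Sum>a\<in>aw_region xs K. frag_of (a, K))"
      using snoc ne by (simp add: sorted_wrt_append n_def X_def)
    define u where "u a p t = (\<lambda>j. if p < j then x j else a j)(p := t)" for a p t
    let ?P = "\<lambda>K. {p. p \<in> {1..k} \<and> K \<subseteq> {..<p}}"
    have above: "a j = (xs ! n) j"
      if "K \<in> X" "a \<in> aw_region xs K" "K \<subseteq> {..<p}" "p \<le> j" for K a p j
    proof -
      have "a j \<in> aw_range xs K j" using that(2) unfolding aw_region_def by blast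
      then show ?thesis using aw_range_above[OF finK(1)[OF that(1)] that(3,4)] finK(3)[OF that(1)] by simp
    qed
    have con: "contract k x (a, K) = frag_cmul ((-1) ^ n)
         (\<Sum>p\<in>?P K. \<Sum>t=a p..<x p. frag_of (u a p t, insert p K))"
      if K: "K \<in> X" and a: "a \<in> aw_region xs K" for K a
    proof -
      have "a p \<le> x p" if "K \<subseteq> {..<p}" for p
        using above[OF K a that, of p] le_funD[OF lx, of p] by simp
      then have "contract k x (a, K) = frag_cmul ((-1) ^ n) (\<Sum>p\<in>?P K. \<Sum>t=a p..<x p.
          frag_of ((\<lambda>j. if p < j \<and> j \<le> k then x j else a j)(p := t), insert p K))"
        using contract_mono[OF finK(2)[OF K], of a x] finK(3)[OF K] by simp
      moreover have "(\<lambda>j. if p < j \<and> j \<le> k then x j else a j)(p := t) = u a p t"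
        if "K \<subseteq> {..<p}" for p t
      proof
        fix j
        \<comment> \<open>Beyond the last colour all points of the chain vanish, so the cut-off at \<open>k\<close> is immaterial.\<close>
        have "a j = x j" if "p < j" "\<not> j \<le> k"
          using above[OF K a \<open>K \<subseteq> {..<p}\<close>, of j] N that by (simp add: Nvec_def)
        then show "((\<lambda>j. if p < j \<and> j \<le> k then x j else a j)(p := t)) j = u a p t j"
          by (simp add: u_def)
      qed
      ultimately show ?thesis by simp
    qed
    have "aw k (xs @ [x]) = frag_cmul ((-1) ^ n) (\<Sum>K\<in>X. \<Sum>a\<in>aw_region xs K. contract k x (a, K))"
      using ne finX finK finite_aw_region by (simp add: aw_snoc IH n_def frag_extend_sum')
    also have "\<dots> = (\<Sum>K\<in>X. \<Sum>a\<in>aw_region xs K.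
         \<Sum>p\<in>?P K. \<Sum>t=a p..<x p. frag_of (u a p t, insert p K))"
      by (simp add: con frag_cmul_sum flip: power_mult_distrib)
    also have "\<dots> = (\<Sum>(K, a, p, t) \<in> (SIGMA K:X. SIGMA a:aw_region xs K. SIGMA p:?P K. {a p..<x p}).
         frag_of (u a p t, insert p K))"
      using finX finK finite_aw_region by (simp add: sum.Sigma)
    also have "\<dots> = (\<Sum>(K, a) \<in> (SIGMA K:Y. aw_region (xs @ [x]) K). frag_of (a, K))"
    proof (rule sum.reindex_bij_witness)
      let ?i = "\<lambda>(K, a). (K - {Max K}, (\<lambda>j. if j < Max K then a j else (xs ! n) j), Max K, a (Max K))"
      let ?j = "\<lambda>(K, a, p, t). (insert p K, u a p t)"
      {
        fix y assume "y \<in> (SIGMA K:X. SIGMA a:aw_region xs K. SIGMA p:?P K. {a p..<x p})"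
        then obtain K a p t where y: "y = (K, a, p, t)" and K: "K \<in> X" and a: "a \<in> aw_region xs K"
          and p: "p \<in> {1..k}" "K \<subseteq> {..<p}" and t: "a p \<le> t" "t < x p" by auto
        note above = above[OF K a p(2)]
        note snoc' = aw_range_snoc[OF finK(1)[OF K] p(2), of xs, unfolded finK(3)[OF K], OF len]
        have mx: "Max (insert p K) = p" using p finK[OF K] by (intro Max_eqI) auto
        have pK: "p \<notin> K" using p by auto
        have "(\<lambda>j. if j < p then u a p t j else (xs ! n) j) = a" "u a p t p = t"
          using above by (auto simp: u_def)
        then show "?i (?j y) = y" using pK by (simp add: y mx)
        have "u a p t j \<in> aw_range (xs @ [x]) (insert p K) j" for j
        proof (cases j p rule: linorder_cases)
          case less
          then show ?thesis using a by (simp add: snoc' u_def aw_region_def)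
        next
          case equal
          then show ?thesis using above[of p] t by (simp add: snoc' u_def)
        qed (simp add: snoc' u_def)
        then have "u a p t \<in> aw_region (xs @ [x]) (insert p K)" by (simp add: aw_region_def)
        moreover have "insert p K \<in> Y" using K pK p finK[OF K] by (auto simp: Y_def)
        ultimately show "?j y \<in> (SIGMA K:Y. aw_region (xs @ [x]) K)" by (simp add: y)
        show "(case ?j y of (K, a) \<Rightarrow> frag_of (a, K)) = (case y of (K, a, p, t) \<Rightarrow> frag_of (u a p t, insert p K))"
          by (simp add: y)
      }
      {
        fix y assume "y \<in> (SIGMA K:Y. aw_region (xs @ [x]) K)"
        then obtain L a where y: "y = (L, a)" and L: "L \<in> Y" and a: "a \<in> aw_region (xs @ [x]) L" by auto
        define p where "p = Max L" define K where "K = L - {p}"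
        have "L \<noteq> {}" using finK'[OF L] by auto
        then have pL: "p \<in> L" using finK'[OF L] by (simp add: p_def)
        then have LK: "L = insert p K" by (auto simp: K_def)
        have Kp: "K \<subseteq> {..<p}"
          using Max_ge[of L] finK'[OF L] by (auto simp: K_def p_def less_le)
        have K: "K \<in> X" using finK'[OF L] pL by (auto simp: X_def K_def)
        note snoc' = aw_range_snoc[OF finK(1)[OF K] Kp, of xs, unfolded finK(3)[OF K], OF len]
        define b where "b = (\<lambda>j. if j < p then a j else (xs ! n) j)"
        have a': "a j \<in> aw_range (xs @ [x]) (insert p K) j" for j
          using a unfolding aw_region_def LK by blast
        have "b j \<in> aw_range xs K j" for j
        proof (cases "j < p")
          case True
          then show ?thesis using a'[of j] by (simp add: snoc' b_def)
        next
          case False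
          then show ?thesis using aw_range_above[OF finK(1)[OF K] Kp, of j xs] finK(3)[OF K]
            by (simp add: b_def)
        qed
        then have "b \<in> aw_region xs K" by (simp add: aw_region_def)
        moreover have "b p \<le> a p" "a p < x p" using a'[of p] by (simp_all add: snoc' b_def)
        ultimately show "?i y \<in> (SIGMA K:X. SIGMA a:aw_region xs K. SIGMA p:?P K. {a p..<x p})"
          using K Kp pL finK'[OF L] by (auto simp: y b_def K_def simp flip: p_def)
        have "u b p (a p) j = a j" for j
          using a'[of j] by (cases j p rule: linorder_cases) (simp_all add: snoc' u_def b_def)
        then have "u b p (a p) = a" by auto
        then show "?j (?i y) = y" using LK by (simp add: y b_def K_def insert_absorb pL flip: p_def)
      }
    qed
    also have "\<dots> = (\<Sum>K\<in>Y. \<Sum>a\<in>aw_region (xs @ [x]) K. frag_of (a, K))"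
      using finX finK' finite_aw_region by (simp add: sum.Sigma)
    finally show ?thesis by (simp add: Y_def len)
  qed
qed simp

section \<open>Augmented complexes of free right modules\<close>

definition augmentation :: "('b \<Rightarrow>\<^sub>0 int) \<Rightarrow> int"
  where "augmentation c = (\<Sum>x\<in>supp c. Poly_Mapping.lookup c x)"

lemma augmentation_eq_lookup: "augmentation c = Poly_Mapping.lookup (frag_extend (\<lambda>_. frag_of ()) c) ()"
  by (simp add: augmentation_def frag_extend_def lookup_sum)

lemma augmentation_0 [simp]: "augmentation 0 = 0"
  and augmentation_frag_of [simp]: "augmentation (frag_of x) = 1"
  and augmentation_add: "augmentation (c + d) = augmentation c + augmentation d"
  and augmentation_diff: "augmentation (c - d) = augmentation c - augmentation d"
  and augmentation_cmul: "augmentation (frag_cmul n c) = n * augmentation c"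
  by (simp_all add: augmentation_eq_lookup frag_extend_add frag_extend_diff frag_extend_cmul lookup_add lookup_minus)

lemma augmentation_sum: "augmentation (\<Sum>i\<in>I. f i) = (\<Sum>i\<in>I. augmentation (f i))"
  by (induction I rule: infinite_finite_induct) (simp_all add: augmentation_add)

lemma augmentation_frag_extend:
  assumes "\<And>x. x \<in> supp c \<Longrightarrow> augmentation (f x) = n"
  shows "augmentation (frag_extend f c) = augmentation c * n"
proof -
  have "augmentation (frag_extend f c)
      = (\<Sum>x\<in>supp c. Poly_Mapping.lookup c x * augmentation (f x))"
    by (simp add: frag_extend_def augmentation_sum augmentation_cmul)
  also have "\<dots> = (\<Sum>x\<in>supp c. Poly_Mapping.lookup c x * n)"
    using assms by (intro sum.cong) simp_all
  finally show ?thesis by (simp add: augmentation_def sum_distrib_right)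
qed

abbreviation push :: "('b \<Rightarrow> 'c) \<Rightarrow> ('b \<Rightarrow>\<^sub>0 int) \<Rightarrow> ('c \<Rightarrow>\<^sub>0 int)"
  where "push g c \<equiv> frag_extend (\<lambda>x. frag_of (g x)) c"

lemma keys_frag_extend_subset:
  assumes "supp c \<subseteq> A" "\<And>x. x \<in> A \<Longrightarrow> supp (f x) \<subseteq> S"
  shows "supp (frag_extend f c) \<subseteq> S"
  by (rule subset_trans[OF keys_frag_extend]) (use assms in blast)

lemma frag_extend_cong:
  assumes "supp c \<subseteq> A" "\<And>x. x \<in> A \<Longrightarrow> f x = g x"
  shows "frag_extend f c = frag_extend g c"
  by (rule frag_extend_eq) (use assms in blast)

lemma aug_carrier:
  "(z, c) \<in> carrier (aug_grp B n v) \<longleftrightarrow> (n \<noteq> -1 \<longrightarrow> z = 0)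
     \<and> supp c \<subseteq> (if n \<ge> 0 then B (nat n) v else {})"
  by (simp add: aug_grp_def singleton_group_def)

lemma aug_mult:
  "(z, c) \<otimes>\<^bsub>aug_grp B n v\<^esub> (z', c') = (if n = -1 then z + z' else 0, c + c')"
  by (simp add: aug_grp_def singleton_group_def)

lemma aug_one: "\<one>\<^bsub>aug_grp B n v\<^esub> = (0, 0)"
  by (simp add: aug_grp_def singleton_group_def)

lemma aug_comm_group: "comm_group (aug_grp B n v)"
proof (rule comm_groupI)
  fix x assume "x \<in> carrier (aug_grp B n v)"
  moreover obtain z c where "x = (z, c)" by (cases x)
  ultimately show "\<exists>y\<in>carrier (aug_grp B n v). y \<otimes>\<^bsub>aug_grp B n v\<^esub> x = \<one>\<^bsub>aug_grp B n v\<^esub>"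
    by (intro bexI[of _ "(- z, - c)"]) (auto simp: aug_carrier aug_mult aug_one)
next
  fix x y assume xy: "x \<in> carrier (aug_grp B n v)" "y \<in> carrier (aug_grp B n v)"
  obtain z c z' c' where zc: "x = (z, c)" "y = (z', c')" by (cases x; cases y)
  let ?S = "if n \<ge> 0 then B (nat n) v else {}"
  have "supp c \<union> supp c' \<subseteq> ?S"
    using xy unfolding zc aug_carrier by blast
  then have "supp (c + c') \<subseteq> ?S" by (rule subset_trans[OF keys_add])
  then show "x \<otimes>\<^bsub>aug_grp B n v\<^esub> y \<in> carrier (aug_grp B n v)"
    unfolding zc aug_mult aug_carrier by simp
qed (auto simp: aug_carrier aug_mult aug_one add_ac)

lemma aug_inv:
  assumes "(z, c) \<in> carrier (aug_grp B n v)"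
  shows "inv\<^bsub>aug_grp B n v\<^esub> (z, c) = (- z, - c)"
  using aug_comm_group[of B n v] assms
  by (intro group.inv_equality) (auto simp: comm_group_def aug_carrier aug_mult aug_one)

lemma aug_homI:
  assumes "\<And>z c. (z, c) \<in> carrier (aug_grp B n v) \<Longrightarrow> f (z, c) \<in> carrier (aug_grp B' m w)"
    and "\<And>z c z' c'. (z, c) \<in> carrier (aug_grp B n v) \<Longrightarrow> (z', c') \<in> carrier (aug_grp B n v) \<Longrightarrow>
      f (if n = -1 then z + z' else 0, c + c') = f (z, c) \<otimes>\<^bsub>aug_grp B' m w\<^esub> f (z', c')"
  shows "f \<in> hom (aug_grp B n v) (aug_grp B' m w)"
  by (rule homI) (use assms in \<open>auto simp: aug_mult\<close>)

lemma nat_of_pos_int: "n \<ge> 1 \<Longrightarrow> \<exists>m. nat n = Suc m \<and> nat (n - 1) = m" for n :: int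
  by (rule exI[of _ "nat (n - 1)"]) auto

text \<open>The data from which a right module with free groups \<open>\<int>B\<close> is made: a right action on the basis
  elements.\<close>

locale basis_action = small_category G for G :: "'a dgraph" +
  fixes B :: "nat \<Rightarrow> 'a \<Rightarrow> 'b set" and ba :: "'b \<Rightarrow> 'a \<Rightarrow> 'b"
  assumes B_act: "l \<in> mor G \<Longrightarrow> x \<in> B n (rng G l) \<Longrightarrow> ba x l \<in> B n (src G l)"
    and ba_id: "v \<in> vertices G \<Longrightarrow> x \<in> B n v \<Longrightarrow> ba x v = x"
    and ba_cmp: "l \<in> mor G \<Longrightarrow> l' \<in> mor G \<Longrightarrow> src G l = rng G l' \<Longrightarrow> x \<in> B n (rng G l)
      \<Longrightarrow> ba x (cmp G l l') = ba (ba x l) l'"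
begin

lemma right_module_aug: "right_module G (mcomplex.cmod (aug_complex B ba bo) n)"
  unfolding right_module_def aug_complex_def
proof (simp, intro conjI ballI impI allI)
  fix v show "comm_group (aug_grp B n v)" by (rule aug_comm_group)
next
  fix l assume l: "l \<in> mor G"
  show "aug_act ba l \<in> hom (aug_grp B n (rng G l)) (aug_grp B n (src G l))"
  proof (rule aug_homI)
    fix z c assume c: "(z, c) \<in> carrier (aug_grp B n (rng G l))"
    have "supp (push (\<lambda>x. ba x l) c) \<subseteq> (if n \<ge> 0 then B (nat n) (src G l) else {})"
      by (rule keys_frag_extend_subset[where A = "if n \<ge> 0 then B (nat n) (rng G l) else {}"])
         (use c B_act[OF l] in \<open>auto simp: aug_carrier split: if_splits\<close>)
    then show "aug_act ba l (z, c) \<in> carrier (aug_grp B n (src G l))"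
      using c by (simp add: aug_act_def aug_carrier)
  qed (auto simp: aug_act_def aug_carrier aug_mult frag_extend_add)
next
  fix v x assume v: "v \<in> vertices G" and x: "x \<in> carrier (aug_grp B n v)"
  obtain z c where zc: "x = (z, c)" by (cases x)
  have "supp c \<subseteq> B (nat n) v" using x by (auto simp: zc aug_carrier split: if_splits)
  then have "push (\<lambda>x. ba x v) c = frag_extend frag_of c"
    by (rule frag_extend_cong) (simp add: ba_id[OF v])
  then show "aug_act ba v x = x" by (simp add: aug_act_def zc)
next
  fix l l' x assume l: "l \<in> mor G" "l' \<in> mor G" "src G l = rng G l'"
    and x: "x \<in> carrier (aug_grp B n (rng G l))"
  obtain z c where zc: "x = (z, c)" by (cases x)
  have "supp c \<subseteq> B (nat n) (rng G l)" using x by (auto simp: zc aug_carrier split: if_splits)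
  then have "push (\<lambda>x. ba x (cmp G l l')) c = push (\<lambda>x. ba (ba x l) l') c"
    by (rule frag_extend_cong) (simp add: ba_cmp[OF l])
  then show "aug_act ba (cmp G l l') x = aug_act ba l' (aug_act ba l x)"
    by (simp add: aug_act_def zc frag_extend_frag_extend)
qed

end

locale basis_complex = basis_action G B ba for G :: "'a dgraph" and B :: "nat \<Rightarrow> 'a \<Rightarrow> 'b set" and ba +
  fixes bo :: "nat \<Rightarrow> 'a \<Rightarrow> 'b \<Rightarrow> ('b \<Rightarrow>\<^sub>0 int)"
  assumes bo_keys: "v \<in> vertices G \<Longrightarrow> x \<in> B (Suc n) v \<Longrightarrow> supp (bo (Suc n) v x) \<subseteq> B n v"
    and bo_act: "l \<in> mor G \<Longrightarrow> x \<in> B (Suc n) (rng G l) \<Longrightarrow>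
      bo (Suc n) (src G l) (ba x l) = push (\<lambda>y. ba y l) (bo (Suc n) (rng G l) x)"
    and bo_bo: "v \<in> vertices G \<Longrightarrow> x \<in> B (Suc (Suc n)) v \<Longrightarrow>
      frag_extend (bo (Suc n) v) (bo (Suc (Suc n)) v x) = 0"
    and bo_aug: "v \<in> vertices G \<Longrightarrow> x \<in> B (Suc 0) v \<Longrightarrow> augmentation (bo (Suc 0) v x) = 0"
begin

lemma aug_bd_hom:
  assumes v: "v \<in> vertices G"
  shows "aug_bd bo n v \<in> hom (aug_grp B n v) (aug_grp B (n - 1) v)"
proof (rule aug_homI)
  fix z c assume c: "(z, c) \<in> carrier (aug_grp B n v)"
  show "aug_bd bo n v (z, c) \<in> carrier (aug_grp B (n - 1) v)"
  proof (cases "n \<ge> 1")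
    case True
    then obtain m where m: "nat n = Suc m" "nat (n - 1) = m" using nat_of_pos_int by blast
    have "supp c \<subseteq> B (Suc m) v" using c True m by (simp add: aug_carrier)
    then have "supp (frag_extend (bo (Suc m) v) c) \<subseteq> B m v"
      by (rule keys_frag_extend_subset) (rule bo_keys[OF v])
    then show ?thesis using True m by (simp add: aug_bd_def aug_carrier)
  qed (auto simp: aug_bd_def aug_carrier)
next
  fix z c z' c'
  show "aug_bd bo n v (if n = -1 then z + z' else 0, c + c')
     = aug_bd bo n v (z, c) \<otimes>\<^bsub>aug_grp B (n - 1) v\<^esub> aug_bd bo n v (z', c')"
    using augmentation_add[of c c']
    by (simp add: aug_bd_def aug_mult frag_extend_add augmentation_def)
qed

lemma aug_bd_act:
  assumes l: "l \<in> mor G" and x: "x \<in> carrier (aug_grp B n (rng G l))"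
  shows "aug_bd bo n (src G l) (aug_act ba l x) = aug_act ba l (aug_bd bo n (rng G l) x)"
proof -
  obtain z c where zc: "x = (z, c)" by (cases x)
  show ?thesis
  proof (cases "n \<ge> 1")
    case True
    then obtain m where m: "nat n = Suc m" using nat_of_pos_int by blast
    have "supp c \<subseteq> B (Suc m) (rng G l)" using x True m by (simp add: zc aug_carrier)
    then have "frag_extend (\<lambda>x. bo (Suc m) (src G l) (ba x l)) c
        = frag_extend (\<lambda>x. push (\<lambda>y. ba y l) (bo (Suc m) (rng G l) x)) c"
      by (rule frag_extend_cong) (rule bo_act[OF l])
    then show ?thesis using True m by (simp add: aug_bd_def aug_act_def zc frag_extend_frag_extend)
  next
    case False
    have "augmentation (push (\<lambda>x. ba x l) c) = augmentation c"
      using augmentation_frag_extend[of c "\<lambda>x. frag_of (ba x l)" 1] by simp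
    then show ?thesis using False by (simp add: aug_bd_def aug_act_def zc augmentation_def)
  qed
qed

lemma aug_bd_bd:
  assumes v: "v \<in> vertices G" and x: "x \<in> carrier (aug_grp B n v)"
  shows "aug_bd bo (n - 1) v (aug_bd bo n v x) = (0, 0)"
proof -
  obtain z c where zc: "x = (z, c)" by (cases x)
  consider "n \<le> 0" | "n = 1" | "n \<ge> 2" by linarith
  then show ?thesis
  proof cases
    case 2
    then have c: "supp c \<subseteq> B (Suc 0) v" using x by (simp add: zc aug_carrier One_nat_def)
    have "augmentation (frag_extend (bo (Suc 0) v) c) = augmentation c * 0"
      by (rule augmentation_frag_extend) (use c bo_aug[OF v] in blast)
    then show ?thesis using 2 by (simp add: aug_bd_def zc augmentation_def One_nat_def)
  next
    case 3
    then have "n - 1 \<ge> 1" by simp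
    then obtain m where m: "nat (n - 1) = Suc m" using nat_of_pos_int by blast
    then have n: "nat n = Suc (Suc m)" using 3 by linarith
    have "supp c \<subseteq> B (Suc (Suc m)) v" using x 3 n by (simp add: zc aug_carrier)
    then have "frag_extend (\<lambda>x. frag_extend (bo (Suc m) v) (bo (Suc (Suc m)) v x)) c = frag_extend (\<lambda>x. 0) c"
      by (rule frag_extend_cong) (rule bo_bo[OF v])
    then show ?thesis using 3 m n by (simp add: aug_bd_def zc frag_extend_frag_extend frag_extend_eq_0)
  qed (auto simp: aug_bd_def zc)
qed

theorem chain_complex_aug: "chain_complex G (aug_complex B ba bo)"
  unfolding chain_complex_def module_map_def
  using right_module_aug aug_bd_hom aug_bd_act aug_bd_bd
  by (simp add: aug_complex_def aug_one)

text \<open>In degree \<open>-1\<close> the map \<open>F\<close> is the identity, so the homotopy may be zero in negative degrees.\<close>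

lemma chain_homotopic_id_aug:
  fixes F :: "int \<Rightarrow> 'a \<Rightarrow> int \<times> ('b \<Rightarrow>\<^sub>0 int) \<Rightarrow> int \<times> ('b \<Rightarrow>\<^sub>0 int)"
    and f h :: "nat \<Rightarrow> 'a \<Rightarrow> 'b \<Rightarrow> ('b \<Rightarrow>\<^sub>0 int)"
  assumes F: "\<And>n v z c. v \<in> vertices G \<Longrightarrow> (z, c) \<in> carrier (aug_grp B n v) \<Longrightarrow>
      F n v (z, c) = (z, frag_extend (f (nat n) v) c)"
    and h_keys: "\<And>n v x. v \<in> vertices G \<Longrightarrow> x \<in> B n v \<Longrightarrow> supp (h n v x) \<subseteq> B (Suc n) v"
    and h_act: "\<And>n l x. l \<in> mor G \<Longrightarrow> x \<in> B n (rng G l) \<Longrightarrow>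
      h n (src G l) (ba x l) = push (\<lambda>y. ba y l) (h n (rng G l) x)"
    and h_0: "\<And>v x. v \<in> vertices G \<Longrightarrow> x \<in> B 0 v \<Longrightarrow>
      frag_extend (bo (Suc 0) v) (h 0 v x) = f 0 v x - frag_of x"
    and h_Suc: "\<And>n v x. v \<in> vertices G \<Longrightarrow> x \<in> B (Suc n) v \<Longrightarrow>
      frag_extend (bo (Suc (Suc n)) v) (h (Suc n) v x) + frag_extend (h n v) (bo (Suc n) v x)
        = f (Suc n) v x - frag_of x"
  shows "chain_homotopic G (aug_complex B ba bo) (aug_complex B ba bo) F (\<lambda>n v. id)"
proof -
  define H where "H n v = (\<lambda>(z :: int, c). if n \<ge> 0 then (0 :: int, frag_extend (h (nat n) v) c) else (0, 0))" for n :: int and v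
  have hom: "H n v \<in> hom (aug_grp B n v) (aug_grp B (n + 1) v)" if v: "v \<in> vertices G" for n v
  proof (rule aug_homI)
    fix z c assume c: "(z, c) \<in> carrier (aug_grp B n v)"
    show "H n v (z, c) \<in> carrier (aug_grp B (n + 1) v)"
    proof (cases "n \<ge> 0")
      case True
      then have n: "nat (n + 1) = Suc (nat n)" by linarith
      have "supp c \<subseteq> B (nat n) v" using c True by (simp add: aug_carrier)
      then have "supp (frag_extend (h (nat n) v) c) \<subseteq> B (Suc (nat n)) v"
        by (rule keys_frag_extend_subset) (rule h_keys[OF v])
      then show ?thesis using True n by (simp add: H_def aug_carrier)
    qed (auto simp: H_def aug_carrier)
  qed (auto simp: H_def aug_mult frag_extend_add)
  have act: "H n (src G l) (aug_act ba l x) = aug_act ba l (H n (rng G l) x)"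
    if l: "l \<in> mor G" and x: "x \<in> carrier (aug_grp B n (rng G l))" for n l x
  proof -
    obtain z c where zc: "x = (z, c)" by (cases x)
    show ?thesis
    proof (cases "n \<ge> 0")
      case True
      then have "supp c \<subseteq> B (nat n) (rng G l)" using x by (simp add: zc aug_carrier)
      then have "frag_extend (\<lambda>x. h (nat n) (src G l) (ba x l)) c
          = frag_extend (\<lambda>x. push (\<lambda>y. ba y l) (h (nat n) (rng G l) x)) c"
        by (rule frag_extend_cong) (rule h_act[OF l])
      then show ?thesis using True by (simp add: H_def aug_act_def zc frag_extend_frag_extend)
    qed (simp add: H_def aug_act_def zc)
  qed
  have eq: "F n v x \<otimes>\<^bsub>aug_grp B n v\<^esub> inv\<^bsub>aug_grp B n v\<^esub> x
      = aug_bd bo (n + 1) v (H n v x) \<otimes>\<^bsub>aug_grp B n v\<^esub> H (n - 1) v (aug_bd bo n v x)"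
    if v: "v \<in> vertices G" and x: "x \<in> carrier (aug_grp B n v)" for n v x
  proof -
    obtain z c where zc: "x = (z, c)" by (cases x)
    have L: "F n v x \<otimes>\<^bsub>aug_grp B n v\<^esub> inv\<^bsub>aug_grp B n v\<^esub> x = (0, frag_extend (f (nat n) v) c - c)"
      using x v by (simp add: zc F aug_inv aug_mult)
    consider "n < 0" | "n = 0" | "n \<ge> 1" by linarith
    then show ?thesis
    proof cases
      case 1
      then have "c = 0" using x by (simp add: zc aug_carrier)
      then show ?thesis unfolding L using 1 by (simp add: zc H_def aug_bd_def aug_mult)
    next
      case 2
      then have "supp c \<subseteq> B 0 v" using x by (simp add: zc aug_carrier)
      then have "frag_extend (\<lambda>x. frag_extend (bo (Suc 0) v) (h 0 v x)) c = frag_extend (\<lambda>x. f 0 v x - frag_of x) c"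
        by (rule frag_extend_cong) (rule h_0[OF v])
      then show ?thesis unfolding L using 2
        by (simp add: zc H_def aug_bd_def aug_mult frag_extend_frag_extend frag_extend_diff_fun One_nat_def)
    next
      case 3
      then obtain m where m: "nat n = Suc m" "nat (n - 1) = m" using nat_of_pos_int by blast
      then have m': "nat (n + 1) = Suc (Suc m)" using 3 by linarith
      have "supp c \<subseteq> B (Suc m) v" using x m 3 by (simp add: zc aug_carrier)
      then have "frag_extend (\<lambda>x. frag_extend (bo (Suc (Suc m)) v) (h (Suc m) v x)
          + frag_extend (h m v) (bo (Suc m) v x)) c = frag_extend (\<lambda>x. f (Suc m) v x - frag_of x) c"
        by (rule frag_extend_cong) (rule h_Suc[OF v])
      then show ?thesis unfolding L using 3 m m'
        by (simp add: zc H_def aug_bd_def aug_mult frag_extend_frag_extend frag_extend_diff_fun frag_extend_plus_fun)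
    qed
  qed
  show ?thesis
    unfolding chain_homotopic_def module_map_def
    by (rule exI[of _ H]) (use hom act eq in \<open>simp add: aug_complex_def\<close>)
qed

end

lemma chain_map_aug:
  assumes "basis_complex G B ba bo" "basis_complex G B' ba' bo'"
    and f_keys: "\<And>n v x. v \<in> vertices G \<Longrightarrow> x \<in> B n v \<Longrightarrow> supp (f n v x) \<subseteq> B' n v"
    and f_act: "\<And>n l x. l \<in> mor G \<Longrightarrow> x \<in> B n (rng G l) \<Longrightarrow>
      f n (src G l) (ba x l) = push (\<lambda>y. ba' y l) (f n (rng G l) x)"
    and f_bo: "\<And>n v x. v \<in> vertices G \<Longrightarrow> x \<in> B (Suc n) v \<Longrightarrow>
      frag_extend (bo' (Suc n) v) (f (Suc n) v x) = frag_extend (f n v) (bo (Suc n) v x)"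
    and f_aug: "\<And>v x. v \<in> vertices G \<Longrightarrow> x \<in> B 0 v \<Longrightarrow> augmentation (f 0 v x) = 1"
  shows "chain_map G (aug_complex B ba bo) (aug_complex B' ba' bo') (aug_map f)"
proof -
  have hom: "aug_map f n v \<in> hom (aug_grp B n v) (aug_grp B' n v)" if v: "v \<in> vertices G" for n v
  proof (rule aug_homI)
    fix z c assume c: "(z, c) \<in> carrier (aug_grp B n v)"
    show "aug_map f n v (z, c) \<in> carrier (aug_grp B' n v)"
    proof (cases "n \<ge> 0")
      case True
      then have "supp c \<subseteq> B (nat n) v" using c by (simp add: aug_carrier)
      then have "supp (frag_extend (f (nat n) v) c) \<subseteq> B' (nat n) v"
        by (rule keys_frag_extend_subset) (rule f_keys[OF v])
      then show ?thesis using True by (simp add: aug_map_def aug_carrier)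
    qed (auto simp: aug_map_def aug_carrier)
  qed (auto simp: aug_map_def aug_mult frag_extend_add)
  have act: "aug_map f n (src G l) (aug_act ba l x) = aug_act ba' l (aug_map f n (rng G l) x)"
    if l: "l \<in> mor G" and x: "x \<in> carrier (aug_grp B n (rng G l))" for n l x
  proof -
    obtain z c where zc: "x = (z, c)" by (cases x)
    show ?thesis
    proof (cases "n \<ge> 0")
      case True
      then have "supp c \<subseteq> B (nat n) (rng G l)" using x by (simp add: zc aug_carrier)
      then have "frag_extend (\<lambda>x. f (nat n) (src G l) (ba x l)) c
          = frag_extend (\<lambda>x. push (\<lambda>y. ba' y l) (f (nat n) (rng G l) x)) c"
        by (rule frag_extend_cong) (rule f_act[OF l])
      then show ?thesis using True by (simp add: aug_map_def aug_act_def zc frag_extend_frag_extend)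
    qed (simp add: aug_map_def aug_act_def zc)
  qed
  have eq: "aug_bd bo' n v (aug_map f n v x) = aug_map f (n - 1) v (aug_bd bo n v x)"
    if v: "v \<in> vertices G" and x: "x \<in> carrier (aug_grp B n v)" for n v x
  proof -
    obtain z c where zc: "x = (z, c)" by (cases x)
    consider "n < 0" | "n = 0" | "n \<ge> 1" by linarith
    then show ?thesis
    proof cases
      case 1
      then show ?thesis by (simp add: zc aug_map_def aug_bd_def)
    next
      case 2
      then have c: "supp c \<subseteq> B 0 v" using x by (simp add: zc aug_carrier)
      have "augmentation (frag_extend (f 0 v) c) = augmentation c * 1"
        by (rule augmentation_frag_extend) (use c f_aug[OF v] in blast)
      then show ?thesis using 2 by (simp add: zc aug_map_def aug_bd_def augmentation_def)
    next
      case 3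
      then obtain m where m: "nat n = Suc m" "nat (n - 1) = m" using nat_of_pos_int by blast
      have "supp c \<subseteq> B (Suc m) v" using x m 3 by (simp add: zc aug_carrier)
      then have "frag_extend (\<lambda>x. frag_extend (bo' (Suc m) v) (f (Suc m) v x)) c
          = frag_extend (\<lambda>x. frag_extend (f m v) (bo (Suc m) v x)) c"
        by (rule frag_extend_cong) (rule f_bo[OF v])
      then show ?thesis using 3 m
        by (simp add: zc aug_map_def aug_bd_def frag_extend_frag_extend)
    qed
  qed
  show ?thesis
    unfolding chain_map_def module_map_def
    using hom act eq by (simp add: aug_complex_def)
qed

section \<open>Segments of a morphism\<close>

lemma nat_fun_le_iff_add: "m \<le> n \<longleftrightarrow> (\<exists>d. n = m + d)" for m n :: "nat \<Rightarrow> nat"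
proof
  assume "m \<le> n"
  then have "n = m + (\<lambda>i. n i - m i)" by (auto simp: le_fun_def fun_eq_iff)
  then show "\<exists>d. n = m + d" by (rule exI[of _ "\<lambda>i. n i - m i"])
qed (auto simp: le_fun_def)

lemma Nvec_mono: "n \<in> Nvec k \<Longrightarrow> m \<le> n \<Longrightarrow> m \<in> Nvec k"
  unfolding Nvec_def le_fun_def by (auto, metis le_zero_eq, metis le_zero_eq)

context kgraph
begin

lemma rng_vertices: "x \<in> mor G \<Longrightarrow> rng G x \<in> vertices G"
  by (simp add: vertices_def rng_mor src_rng)

lemma factor_ex:
  assumes "x \<in> mor G" "m \<le> deg G x"
  obtains u w where "u \<in> mor G" "w \<in> mor G" "src G u = rng G w" "x = cmp G u w" "deg G u = m"
proof -
  obtain n where n: "deg G x = m + n" using assms nat_fun_le_iff_add by blast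
  have "m \<in> Nvec k" "n \<in> Nvec k" using deg_Nvec[OF assms(1)] n
    by (auto intro: Nvec_mono simp: le_fun_def)
  from factorization[OF assms(1) this n] show thesis using that by blast
qed

lemma factor_unique:
  assumes "u \<in> mor G" "w \<in> mor G" "src G u = rng G w"
    and "u' \<in> mor G" "w' \<in> mor G" "src G u' = rng G w'"
    and "cmp G u w = cmp G u' w'" "deg G u = deg G u'"
  shows "u = u'" "w = w'"
proof -
  let ?P = "\<lambda>p. case p of (\<mu>, \<nu>) \<Rightarrow> \<mu> \<in> mor G \<and> \<nu> \<in> mor G \<and> src G \<mu> = rng G \<nu>
              \<and> deg G \<mu> = deg G u \<and> deg G \<nu> = deg G w \<and> cmp G u w = cmp G \<mu> \<nu>"
  have ex: "\<exists>!p. ?P p"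
    using assms by (intro factorization cmp_mor deg_Nvec deg_cmp) auto
  have "deg G u + deg G w = deg G u' + deg G w'"
    using assms deg_cmp by metis
  then have "deg G w' = deg G w" using assms(8) by simp
  then have "?P (u, w)" "?P (u', w')" using assms by auto
  then have "(u, w) = (u', w')" using ex by blast
  then show "u = u'" "w = w'" by auto
qed

text \<open>By unique factorization, any factorization with the right degrees exhibits the segment.\<close>

lemma segment_eqI:
  assumes "l1 \<in> mor G" "x \<in> mor G" "l2 \<in> mor G" "src G l1 = rng G x" "src G x = rng G l2"
  shows "segment G (cmp G (cmp G l1 x) l2) (deg G l1) (deg G l1 + deg G x) = x"
  unfolding segment_def
proof (rule the_equality)
  fix y
  assume "y \<in> mor G \<and> deg G l1 + deg G y = deg G l1 + deg G x \<and>
     (\<exists>l1'\<in>mor G. \<exists>l2'\<in>mor G. src G l1' = rng G y \<and> src G y = rng G l2' \<and>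
        deg G l1' = deg G l1 \<and> cmp G (cmp G l1 x) l2 = cmp G (cmp G l1' y) l2')"
  then obtain l1' l2' where y: "y \<in> mor G" "deg G y = deg G x" "l1' \<in> mor G" "l2' \<in> mor G"
     "src G l1' = rng G y" "src G y = rng G l2'"
     "deg G l1' = deg G l1" "cmp G (cmp G l1 x) l2 = cmp G (cmp G l1' y) l2'"
    by auto
  have "cmp G l1 x = cmp G l1' y"
    by (rule factor_unique(1)[OF _ _ _ _ _ _ y(8)]) (use assms y in \<open>auto simp: cmp_mor src_cmp deg_cmp\<close>)
  then show "y = x" using factor_unique(2)[of l1 x l1' y] assms y by auto
qed (use assms in auto)

lemma segment_ex:
  assumes "l \<in> mor G" "m \<le> n" "n \<le> deg G l"
  obtains l1 x l2 where "l1 \<in> mor G" "x \<in> mor G" "l2 \<in> mor G" "src G l1 = rng G x" "src G x = rng G l2"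
    "deg G l1 = m" "m + deg G x = n" "l = cmp G (cmp G l1 x) l2" "segment G l m n = x"
proof -
  obtain u l2 where u: "u \<in> mor G" "l2 \<in> mor G" "src G u = rng G l2" "l = cmp G u l2" "deg G u = n"
    using factor_ex assms by blast
  obtain l1 x where x: "l1 \<in> mor G" "x \<in> mor G" "src G l1 = rng G x" "u = cmp G l1 x" "deg G l1 = m"
    using factor_ex[of u m] assms u by blast
  have sx: "src G x = rng G l2" using u x src_cmp by auto
  have d: "m + deg G x = n" using u x deg_cmp by auto
  then have "segment G l m n = x" using segment_eqI[OF x(1,2) u(2) x(3) sx] u x by auto
  then show thesis using that[OF x(1,2) u(2) x(3) sx x(5) d] u x by auto
qed

lemma segment_mor:
  assumes "l \<in> mor G" "m \<le> n" "n \<le> deg G l"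
  shows "segment G l m n \<in> mor G" and "m + deg G (segment G l m n) = n"
  using segment_ex[OF assms] by metis+

lemma segment_cmp_left:
  assumes "u \<in> mor G" "w \<in> mor G" "src G u = rng G w" "m \<le> n" "n \<le> deg G u"
  shows "segment G (cmp G u w) m n = segment G u m n"
proof -
  obtain l1 x l2 where x: "l1 \<in> mor G" "x \<in> mor G" "l2 \<in> mor G" "src G l1 = rng G x" "src G x = rng G l2"
    "deg G l1 = m" "m + deg G x = n" "u = cmp G (cmp G l1 x) l2" "segment G u m n = x"
    using segment_ex[OF assms(1,4,5)] by blast
  have s: "src G l2 = rng G w" using assms x by (simp add: src_cmp cmp_mor)
  have "cmp G u w = cmp G (cmp G l1 x) (cmp G l2 w)"
    unfolding x(8) by (rule cmp_assoc) (use x assms s in \<open>auto simp: cmp_mor src_cmp\<close>)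
  then show ?thesis using segment_eqI[of l1 x "cmp G l2 w"] x assms s
    by (auto simp: cmp_mor rng_cmp)
qed

lemma segment_cmp_right:
  assumes "u \<in> mor G" "w \<in> mor G" "src G u = rng G w" "m \<le> n" "n \<le> deg G w"
  shows "segment G (cmp G u w) (deg G u + m) (deg G u + n) = segment G w m n"
proof -
  obtain l1 x l2 where x: "l1 \<in> mor G" "x \<in> mor G" "l2 \<in> mor G" "src G l1 = rng G x" "src G x = rng G l2"
    "deg G l1 = m" "m + deg G x = n" "w = cmp G (cmp G l1 x) l2" "segment G w m n = x"
    using segment_ex[OF assms(2,4,5)] by blast
  have s: "src G u = rng G l1" using assms x by (simp add: rng_cmp cmp_mor src_cmp)
  have "cmp G u w = cmp G (cmp G u (cmp G l1 x)) l2"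
    unfolding x(8) using x assms s by (auto simp: cmp_mor src_cmp rng_cmp cmp_assoc)
  also have "cmp G u (cmp G l1 x) = cmp G (cmp G u l1) x"
    using x assms s by (auto simp: cmp_assoc)
  finally have "cmp G u w = cmp G (cmp G (cmp G u l1) x) l2" .
  then show ?thesis using segment_eqI[of "cmp G u l1" x l2] x assms s
    by (auto simp: cmp_mor src_cmp deg_cmp add.assoc)
qed

lemma segment_whole:
  assumes "l \<in> mor G" shows "segment G l 0 (deg G l) = l"
proof -
  have "rng G l \<in> mor G" "src G l \<in> mor G" "deg G (rng G l) = 0"
    using assms rng_mor src_mor deg_vertex rng_vertices by auto
  then show ?thesis using segment_eqI[of "rng G l" l "src G l"] assms
    by (simp add: src_rng rng_src cmp_rng cmp_src)
qed

lemma segment_prefix: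
  assumes "u \<in> mor G" "w \<in> mor G" "src G u = rng G w"
  shows "segment G (cmp G u w) 0 (deg G u) = u"
  using segment_cmp_left[OF assms, of 0 "deg G u"] segment_whole assms by (simp add: le_fun_def)

lemma segment_suffix:
  assumes "u \<in> mor G" "w \<in> mor G" "src G u = rng G w"
  shows "segment G (cmp G u w) (deg G u) (deg G u + deg G w) = w"
  using segment_cmp_right[OF assms, of 0 "deg G w"] segment_whole assms by (simp add: le_fun_def)

lemma segment_segment:
  assumes "l \<in> mor G" "p \<le> q" "q \<le> deg G l" "m \<le> n" "p + n \<le> q"
  shows "segment G (segment G l p q) m n = segment G l (p + m) (p + n)"
proof -
  obtain l1 x l2 where x: "l1 \<in> mor G" "x \<in> mor G" "l2 \<in> mor G" "src G l1 = rng G x" "src G x = rng G l2"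
    "deg G l1 = p" "p + deg G x = q" "l = cmp G (cmp G l1 x) l2" "segment G l p q = x"
    using segment_ex[OF assms(1-3)] by blast
  have n: "n \<le> deg G x" using assms(5) x(7) by (auto simp: le_fun_def)
  have "segment G l (p + m) (p + n) = segment G (cmp G l1 x) (p + m) (p + n)"
    unfolding x(8) using x assms n by (intro segment_cmp_left) (auto simp: cmp_mor src_cmp deg_cmp le_fun_def)
  also have "\<dots> = segment G x m n"
    using segment_cmp_right[OF x(1,2,4) assms(4) n] x by simp
  finally show ?thesis using x by simp
qed

lemma segment_join:
  assumes "l \<in> mor G" "m \<le> n" "n \<le> p" "p \<le> deg G l"
  shows "src G (segment G l m n) = rng G (segment G l n p)"
    and "cmp G (segment G l m n) (segment G l n p) = segment G l m p"
proof -
  let ?y = "segment G l m p"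
  have mp: "m \<le> p" using assms by order
  obtain d where d: "n = m + d" using assms nat_fun_le_iff_add by blast
  obtain e where e: "p = n + e" using assms nat_fun_le_iff_add by blast
  have y: "?y \<in> mor G" "m + deg G ?y = p" using segment_mor[OF assms(1) mp assms(4)] by auto
  then have dy: "deg G ?y = d + e" using d e by (simp add: add.assoc)
  then obtain u w where u: "u \<in> mor G" "w \<in> mor G" "src G u = rng G w" "?y = cmp G u w" "deg G u = d"
    using factor_ex[OF y(1), of d] by (auto simp: le_fun_def)
  have w: "deg G w = e" using dy u deg_cmp by auto
  have "segment G ?y 0 d = u" using segment_prefix u by metis
  moreover have "segment G ?y 0 d = segment G l (m + 0) (m + d)"
    by (rule segment_segment) (use assms mp d in \<open>auto simp: le_fun_def\<close>)
  ultimately have U: "segment G l m n = u" using d by simp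
  have "segment G ?y d (d + e) = w" using segment_suffix u w by metis
  moreover have "segment G ?y d (d + e) = segment G l (m + d) (m + (d + e))"
    by (rule segment_segment) (use assms mp d e in \<open>auto simp: le_fun_def\<close>)
  ultimately have W: "segment G l n p = w" using d e by (simp add: add.assoc)
  show "src G (segment G l m n) = rng G (segment G l n p)"
    "cmp G (segment G l m n) (segment G l n p) = segment G l m p"
    using u U W by auto
qed

lemma src_segment_end:
  assumes "l \<in> mor G" "m \<le> deg G l"
  shows "src G (segment G l m (deg G l)) = src G l"
proof -
  have "l = cmp G (segment G l 0 m) (segment G l m (deg G l))"
    using segment_join[of l 0 m "deg G l"] segment_whole assms by (simp add: le_fun_def)
  then show ?thesis
    using src_cmp[of "segment G l 0 m" "segment G l m (deg G l)"]
      segment_join(1)[of l 0 m "deg G l"] segment_mor(1)[of l] assms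
    by (simp add: le_fun_def)
qed

lemma segment_cmp_end:
  assumes "l \<in> mor G" "w \<in> mor G" "src G l = rng G w" "m \<le> deg G l"
  shows "segment G (cmp G l w) m (deg G (cmp G l w)) = cmp G (segment G l m (deg G l)) w"
proof -
  let ?D = "deg G (cmp G l w)"
  have lw: "cmp G l w \<in> mor G" "?D = deg G l + deg G w" using assms by (auto simp: cmp_mor deg_cmp)
  then have "cmp G (segment G (cmp G l w) m (deg G l)) (segment G (cmp G l w) (deg G l) ?D)
      = segment G (cmp G l w) m ?D"
    using assms by (intro segment_join) (auto simp: le_fun_def)
  moreover have "segment G (cmp G l w) m (deg G l) = segment G l m (deg G l)"
    using segment_cmp_left assms by auto
  moreover have "segment G (cmp G l w) (deg G l) ?D = w"
    using segment_suffix assms lw by auto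
  ultimately show ?thesis by simp
qed

end

section \<open>Paths from chains of lattice points\<close>

text \<open>The points cut \<open>l\<close> into pieces. The last piece extends to the end of \<open>l\<close>, and the part before the first
  point is dropped; so deleting the first point of a list corresponds to dropping the first entry of the
  tuple, for the same \<open>l\<close>.\<close>

fun realize_path :: "'a dgraph \<Rightarrow> 'a \<Rightarrow> (nat \<Rightarrow> nat) list \<Rightarrow> 'a list" where
  "realize_path G l [] = []"
| "realize_path G l [x] = [segment G l x (deg G l)]"
| "realize_path G l (x # y # xs) = segment G l x y # realize_path G l (y # xs)"

definition chain_in :: "(nat \<Rightarrow> nat) \<Rightarrow> (nat \<Rightarrow> nat) list \<Rightarrow> bool"
  where "chain_in D xs \<longleftrightarrow> xs \<noteq> [] \<and> sorted_wrt (\<le>) xs \<and> (\<forall>x\<in>set xs. x \<le> D)"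

lemma chain_in_drop:
  assumes "chain_in D xs" "i < length xs" "length xs \<noteq> 1"
  shows "chain_in D (take i xs @ drop (Suc i) xs)"
proof -
  obtain us x vs where xs: "xs = us @ x # vs" "length us = i"
    using assms(2) id_take_nth_drop[of i xs] by (metis length_take min.absorb4)
  then have "take i xs @ drop (Suc i) xs = us @ vs" by simp
  moreover have "us @ vs \<noteq> []" using assms(3) xs by auto
  ultimately show ?thesis using assms(1) by (auto simp: chain_in_def xs sorted_wrt_append)
qed

lemma length_realize_path [simp]: "length (realize_path G l xs) = length xs"
  by (induction G l xs rule: realize_path.induct) auto

lemma realize_path_Nil_iff [simp]: "realize_path G l xs = [] \<longleftrightarrow> xs = []"
  by (metis length_0_conv length_realize_path)

lemma composable_Cons:
  assumes "ls \<noteq> []"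
  shows "composable G (l # ls) \<longleftrightarrow> l \<in> mor G \<and> src G l = rng G (hd ls) \<and> composable G ls"
proof
  assume "composable G (l # ls)"
  then have s: "set (l # ls) \<subseteq> mor G" and c: "Suc i < length (l # ls) \<Longrightarrow> src G ((l # ls) ! i) = rng G ((l # ls) ! Suc i)" for i
    by (auto simp: composable_def)
  show "l \<in> mor G \<and> src G l = rng G (hd ls) \<and> composable G ls"
    using s c[of 0] c[of "Suc i" for i] assms by (auto simp: composable_def hd_conv_nth)
next
  assume "l \<in> mor G \<and> src G l = rng G (hd ls) \<and> composable G ls"
  then show "composable G (l # ls)"
    using assms by (auto simp: composable_def hd_conv_nth nth_Cons split: nat.splits)
qed

lemma composable_single [simp]: "composable G [l] \<longleftrightarrow> l \<in> mor G"
  by (auto simp: composable_def)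

lemma composite_single [simp]: "composite G [l] = l"
  by (simp add: composite_def)

lemma composite_Cons: "ls \<noteq> [] \<Longrightarrow> composite G (l # ls) = cmp G l (composite G ls)"
  by (simp add: composite_def)

context kgraph
begin

lemma composite_mor:
  assumes "composable G ls"
  shows "composite G ls \<in> mor G" "rng G (composite G ls) = rng G (hd ls)" "src G (composite G ls) = src G (last ls)"
proof -
  have "composite G ls \<in> mor G \<and> rng G (composite G ls) = rng G (hd ls) \<and> src G (composite G ls) = src G (last ls)"
    using assms
  proof (induction ls)
    case (Cons l ls)
    show ?case
    proof (cases "ls = []")
      case False
      then show ?thesis using Cons
        by (auto simp: composable_Cons composite_Cons cmp_mor rng_cmp src_cmp)
    qed (use Cons in auto)
  qed (auto simp: composable_def)
  then show "composite G ls \<in> mor G" "rng G (composite G ls) = rng G (hd ls)" "src G (composite G ls) = src G (last ls)"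
    by auto
qed

lemma realize_path_props:
  assumes "l \<in> mor G" "chain_in (deg G l) xs"
  shows "composable G (realize_path G l xs)"
    and "composite G (realize_path G l xs) = segment G l (hd xs) (deg G l)"
    and "src G (last (realize_path G l xs)) = src G l"
proof -
  have "composable G (realize_path G l xs) \<and> composite G (realize_path G l xs) = segment G l (hd xs) (deg G l)
    \<and> src G (last (realize_path G l xs)) = src G l \<and>
     (\<forall>w \<le> hd xs. src G (segment G l w (hd xs)) = rng G (hd (realize_path G l xs)))"
    using assms(2)
  proof (induction xs rule: induct_list012)
    case (2 x)
    then show ?case using assms(1)
      by (auto simp: chain_in_def segment_mor src_segment_end intro: segment_join)
  next
    case (3 x y xs)
    then have xy: "x \<le> y" "y \<le> deg G l" and c: "chain_in (deg G l) (y # xs)" by (auto simp: chain_in_def)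
    note IH = 3(2)[OF c]
    have "segment G l x y \<in> mor G" using segment_mor xy assms(1) by auto
    moreover have "\<forall>w\<le>x. src G (segment G l w x) = rng G (segment G l x y)"
      using segment_join(1) xy assms(1) by auto
    moreover have "cmp G (segment G l x y) (segment G l y (deg G l)) = segment G l x (deg G l)"
      using segment_join(2) xy assms(1) by auto
    ultimately show ?case using IH xy
      by (simp add: composable_Cons composite_Cons)
  qed (simp add: chain_in_def)
  then show "composable G (realize_path G l xs)"
    "composite G (realize_path G l xs) = segment G l (hd xs) (deg G l)"
    "src G (last (realize_path G l xs)) = src G l" by auto
qed

lemma realize_path_in_paths:
  "l \<in> mor G \<Longrightarrow> chain_in (deg G l) xs \<Longrightarrow> realize_path G l xs \<in> paths G (length xs) (src G l)"
  using realize_path_props by (simp add: paths_def)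

lemma realize_path_act:
  assumes "l \<in> mor G" "w \<in> mor G" "src G l = rng G w" "chain_in (deg G l) xs"
  shows "realize_path G (cmp G l w) xs
    = butlast (realize_path G l xs) @ [cmp G (last (realize_path G l xs)) w]"
  using assms(4)
proof (induction xs rule: induct_list012)
  case (2 x)
  then show ?case using assms by (simp add: chain_in_def segment_cmp_end)
next
  case (3 x y xs)
  then have "segment G (cmp G l w) x y = segment G l x y"
    using segment_cmp_left assms by (auto simp: chain_in_def)
  moreover have "chain_in (deg G l) (y # xs)" using 3 by (auto simp: chain_in_def)
  ultimately show ?case using 3 by simp
qed (simp add: chain_in_def)

primrec partial_degrees :: "(nat \<Rightarrow> nat) \<Rightarrow> 'a list \<Rightarrow> (nat \<Rightarrow> nat) list" where
  "partial_degrees x [] = []"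
| "partial_degrees x (l # ls) = x # partial_degrees (x + deg G l) ls"

lemma realize_partial_degrees:
  assumes "composable G ls" "l \<in> mor G" "x \<le> deg G l" "segment G l x (deg G l) = composite G ls"
  shows "realize_path G l (partial_degrees x ls) = ls \<and> chain_in (deg G l) (partial_degrees x ls)
    \<and> (\<forall>y\<in>set (partial_degrees x ls). x \<le> y)"
  using assms(1,3,4)
proof (induction ls arbitrary: x)
  case (Cons u ls)
  show ?case
  proof (cases "ls = []")
    case True
    then show ?thesis using Cons by (simp add: chain_in_def)
  next
    case False
    let ?w = "composite G ls"
    have u: "u \<in> mor G" "src G u = rng G (hd ls)" "composable G ls" using Cons.prems(1) False
      by (auto simp: composable_Cons)
    note w = composite_mor[OF u(3)]
    have seg: "segment G l x (deg G l) = cmp G u ?w" using Cons.prems False by (simp add: composite_Cons)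
    have d: "x + (deg G u + deg G ?w) = deg G l"
      using segment_mor(2)[OF assms(2) Cons.prems(2) order_refl] unfolding seg using u w deg_cmp by simp
    let ?y = "x + deg G u"
    have y: "x \<le> ?y" "?y \<le> deg G l" using d by (auto simp: le_fun_def fun_eq_iff) (metis add.assoc le_add1)
    have "segment G (cmp G u ?w) 0 (deg G u) = segment G l x ?y"
      unfolding seg[symmetric] using segment_segment[OF assms(2) Cons.prems(2) order_refl, of 0 "deg G u"] y
      by (simp add: le_fun_def)
    then have 1: "segment G l x ?y = u" using segment_prefix u w by auto
    have "segment G (cmp G u ?w) (deg G u) (deg G u + deg G ?w) = segment G l ?y (deg G l)"
      unfolding seg[symmetric] using segment_segment[OF assms(2) Cons.prems(2) order_refl, of "deg G u" "deg G u + deg G ?w"] d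
      by (simp add: le_fun_def)
    then have 2: "segment G l ?y (deg G l) = ?w" using segment_suffix u w by auto
    have IH: "realize_path G l (partial_degrees ?y ls) = ls \<and> chain_in (deg G l) (partial_degrees ?y ls)
      \<and> (\<forall>z\<in>set (partial_degrees ?y ls). ?y \<le> z)"
      by (rule Cons.IH[OF u(3) y(2) 2])
    obtain v vs where ls: "ls = v # vs" using False by (cases ls) auto
    show ?thesis using IH 1 y Cons.prems(2)
      by (auto simp: ls chain_in_def intro: order_trans simp del: plus_fun_apply)
  qed
qed (simp add: composable_def)

text \<open>The morphism is the composite of the tuple, the points are the degrees of its initial parts.\<close>

lemma path_is_realized:
  assumes "ls \<in> paths G n v"
  obtains l xs where "l \<in> mor G" "src G l = v" "chain_in (deg G l) xs" "length xs = n" "ls = realize_path G l xs"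
proof -
  have c: "composable G ls" "src G (last ls) = v" "length ls = n" using assms by (auto simp: paths_def)
  let ?l = "composite G ls"
  note l = composite_mor[OF c(1)]
  have "realize_path G ?l (partial_degrees 0 ls) = ls \<and> chain_in (deg G ?l) (partial_degrees 0 ls)"
    using realize_partial_degrees[OF c(1) l(1), of 0] segment_whole l by (simp add: le_fun_def)
  moreover then have "length (partial_degrees 0 ls) = n" using c length_realize_path by metis
  ultimately show thesis using that[of ?l "partial_degrees 0 ls"] l c by auto
qed

text \<open>Without the point \<open>xs ! i\<close>, the two pieces on either side of it become one, their composite.\<close>

lemma realize_path_drop:
  assumes "l \<in> mor G" "chain_in (deg G l) xs" "i < length xs" "i \<ge> 1"
  shows "realize_path G l (take i xs @ drop (Suc i) xs)
    = (let ls = realize_path G l xs in take (i - 1) ls @ [cmp G (ls ! (i - 1)) (ls ! i)] @ drop (i + 1) ls)"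
  using assms(2-)
proof (induction xs arbitrary: i rule: induct_list012)
  case (3 x y xs)
  have xy: "x \<le> y" "y \<le> deg G l" "x \<le> deg G l" using 3 by (auto simp: chain_in_def)
  show ?case
  proof (cases "i = 1")
    case True
    show ?thesis
    proof (cases xs)
      case Nil
      then show ?thesis using True xy segment_join(2)[OF assms(1), of x y "deg G l"]
        by (simp add: Let_def One_nat_def)
    next
      case (Cons z zs)
      then have "y \<le> z" "z \<le> deg G l" using 3 by (auto simp: chain_in_def)
      then show ?thesis using True Cons xy segment_join(2)[OF assms(1), of x y z]
        by (simp add: Let_def One_nat_def)
    qed
  next
    case False
    then obtain i' where i: "i = Suc i'" "i' \<ge> 1" "i' < length (y # xs)" using 3 by (cases i) auto
    have c: "chain_in (deg G l) (y # xs)" using 3 by (auto simp: chain_in_def)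
    note IH = 3(2)[OF c i(3,2)]
    obtain i'' where i'': "i' = Suc i''" using i(2) by (cases i') auto
    show ?thesis using IH by (simp add: i i'' Let_def)
  qed
qed (auto simp: chain_in_def)

lemma path_bd_realize:
  assumes "l \<in> mor G" "chain_in (deg G l) xs" "length xs = Suc n" "n \<ge> 1"
  shows "path_bd G n (realize_path G l xs) = frag_extend (\<lambda>ys. frag_of (realize_path G l ys)) (simplex_bd xs)"
proof -
  obtain x y ys where xs: "xs = x # y # ys" using assms by (cases xs; cases "tl xs") auto
  have "frag_extend (\<lambda>ys. frag_of (realize_path G l ys)) (simplex_bd xs)
    = (\<Sum>i<Suc n. frag_cmul ((-1) ^ i) (frag_of (realize_path G l (take i xs @ drop (Suc i) xs))))"
    unfolding simplex_bd_eq_sum assms(3) by (simp only: frag_extend_sum'[OF finite_lessThan] frag_extend_cmul frag_extend_of)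
  also have "{..<Suc n} = insert 0 {1..n}" by auto
  finally have "frag_extend (\<lambda>ys. frag_of (realize_path G l ys)) (simplex_bd xs)
    = frag_of (realize_path G l (tl xs))
     + (\<Sum>i=1..n. frag_cmul ((-1) ^ i) (frag_of (realize_path G l (take i xs @ drop (Suc i) xs))))"
    by (simp add: drop_Suc)
  also have "realize_path G l (tl xs) = tl (realize_path G l xs)" by (simp add: xs)
  finally show ?thesis unfolding path_bd_def
    using realize_path_drop[OF assms(1,2)] assms(3) by (simp add: Let_def)
qed

end

section \<open>Cubes of the slice from cubes in the lattice\<close>

abbreviation ones :: "nat set \<Rightarrow> nat \<Rightarrow> nat"
  where "ones K \<equiv> \<Sum>j\<in>K. evec j"

definition realize_cube :: "'a dgraph \<Rightarrow> 'a \<Rightarrow> (nat \<Rightarrow> nat) \<times> nat set \<Rightarrow> 'a \<times> 'a"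
  where "realize_cube G l = (\<lambda>(a, K).
     (segment G l a (a + ones K), segment G l (a + ones K) (deg G l)))"

definition box_in :: "(nat \<Rightarrow> nat) \<Rightarrow> (nat \<Rightarrow> nat) \<times> nat set \<Rightarrow> bool"
  where "box_in D = (\<lambda>(a, K). finite K \<and> a + ones K \<le> D)"

lemma ones_remove:
  assumes "finite K" "c \<in> K"
  shows "ones K = evec c + ones (K - {c})"
  using sum.remove[OF assms, of evec] .

lemma box_in_remove:
  assumes "box_in D (a, K)" "c \<in> K"
  shows "box_in D (a, K - {c})" "box_in D (a + evec c, K - {c})"
proof -
  have 1: "a + evec c + ones (K - {c}) \<le> D" and 2: "finite K"
    using assms ones_remove[of K c] by (auto simp: box_in_def add.assoc)
  have "a + ones (K - {c}) \<le> a + evec c + ones (K - {c})" by (simp add: le_fun_def)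
  from order_trans[OF this 1] 1 2
  show "box_in D (a, K - {c})" "box_in D (a + evec c, K - {c})" by (simp_all add: box_in_def)
qed

lemma keys_box_bd_face:
  assumes "y \<in> supp (box_bd (a, K))"
  shows "\<exists>j\<in>K. y = (a + evec j, K - {j}) \<or> y = (a, K - {j})"
proof -
  have "y \<in> (\<Union>j\<in>K. supp (frag_cmul (color_sign K j)
     (frag_of (a + evec j, K - {j}) - frag_of (a, K - {j}))))"
    using assms unfolding box_bd_def prod.case by (rule subsetD[OF keys_sum])
  then obtain j where j: "j \<in> K" "y \<in> supp (frag_of (a + evec j, K - {j}) - frag_of (a, K - {j}))"
    by auto
  from j(2) have "y \<in> supp (frag_of (a + evec j, K - {j})) \<union> supp (frag_of (a, K - {j}))"
    by (rule subsetD[OF keys_diff])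
  then show ?thesis using j(1) by auto
qed

lemma keys_box_bd:
  assumes "y \<in> supp (box_bd (a, K))" "box_in D (a, K)"
  shows "box_in D y" "Suc (card (snd y)) = card K"
proof -
  obtain j where j: "j \<in> K" "y = (a + evec j, K - {j}) \<or> y = (a, K - {j})"
    using keys_box_bd_face[OF assms(1)] by blast
  have "finite K" using assms(2) by (simp add: box_in_def)
  then show "Suc (card (snd y)) = card K" using j card_Suc_Diff1[of K j] by auto
  show "box_in D y" using j box_in_remove[OF assms(2)] by auto
qed

lemma chain_in_lattice_path:
  assumes "a + sum_list (map evec cs) \<le> D"
  shows "chain_in D (lattice_path a cs) \<and> (\<forall>x\<in>set (lattice_path a cs). a \<le> x)"
  using assms
proof (induction cs arbitrary: a)
  case (Cons c cs)
  have le: "a + evec c + sum_list (map evec cs) \<le> D" using Cons.prems by (simp only: list.map sum_list.Cons add.assoc)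
  have IH: "chain_in D (lattice_path (a + evec c) cs) \<and> (\<forall>x\<in>set (lattice_path (a + evec c) cs). a + evec c \<le> x)"
    by (rule Cons.IH[OF le])
  have "a \<le> a + evec c" by (simp add: le_fun_def)
  then have a: "\<forall>x\<in>set (lattice_path (a + evec c) cs). a \<le> x" using IH by (meson order_trans)
  have "a \<le> a + evec c + sum_list (map evec cs)" by (simp add: le_fun_def)
  then have "a \<le> D" using le by (rule order_trans)
  then show ?case using IH a by (auto simp: chain_in_def)
qed (simp add: chain_in_def)

lemma sum_list_evec: "distinct cs \<Longrightarrow> sum_list (map evec cs) = ones (set cs)"
  by (rule sum_list_distinct_conv_sum_set)

lemma keys_shuffle:
  assumes "xs \<in> supp (shuffle (a, K))" "box_in D (a, K)"
  shows "chain_in D xs" "length xs = Suc (card K)"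
proof -
  have "xs \<in> (\<Union>cs\<in>permutations_of_set K.
      supp (frag_cmul ((-1) ^ inversions cs) (frag_of (lattice_path a cs))))"
    using assms(1) unfolding shuffle_def prod.case by (rule subsetD[OF keys_sum])
  then obtain cs where cs: "distinct cs" "set cs = K" "xs = lattice_path a cs"
    by (auto simp: permutations_of_set_def)
  then show "length xs = Suc (card K)" using distinct_card by force
  show "chain_in D xs" using chain_in_lattice_path[of a cs D] cs assms(2)
    by (simp add: sum_list_evec box_in_def)
qed

lemma keys_simplex_bd_chain_in:
  assumes "ys \<in> supp (simplex_bd xs)" "chain_in D xs" "length xs \<noteq> 1"
  shows "chain_in D ys" "Suc (length ys) = length xs"
proof -
  obtain i where i: "i < length xs" "ys = take i xs @ drop (Suc i) xs"
    using keys_simplex_bd assms(1) by blast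
  then show "chain_in D ys" using chain_in_drop assms by blast
  show "Suc (length ys) = length xs" using i by auto
qed

lemma chain_in_nth_mono: "chain_in D xs \<Longrightarrow> i \<le> j \<Longrightarrow> j < length xs \<Longrightarrow> xs ! i \<le> xs ! j"
  unfolding chain_in_def using sorted_wrt_nth_less[of "(\<le>)" xs i j] by (cases "i = j") auto

lemma chain_in_Nvec: "chain_in D xs \<Longrightarrow> D \<in> Nvec k \<Longrightarrow> set xs \<subseteq> Nvec k"
  unfolding chain_in_def using Nvec_mono by blast

lemma below_Suc: "finite K \<Longrightarrow> below K (Suc j) = (if j \<in> K then Suc (below K j) else below K j)"
proof -
  assume fin: "finite K"
  have "{i \<in> K. i < Suc j} = (if j \<in> K then insert j {i \<in> K. i < j} else {i \<in> K. i < j})"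
    by (auto simp: less_Suc_eq)
  then show ?thesis using fin by (simp add: below_def)
qed

lemma aw_region_iff:
  assumes "finite K"
  shows "a \<in> aw_region xs K \<longleftrightarrow> (\<forall>j. (xs ! below K j) j \<le> a j \<and> a j + ones K j \<le> (xs ! below K (Suc j)) j)"
proof -
  have "a j \<in> aw_range xs K j \<longleftrightarrow>
      (xs ! below K j) j \<le> a j \<and> a j + ones K j \<le> (xs ! below K (Suc j)) j" for j
    unfolding sum_evec_apply[OF assms] below_Suc[OF assms] by (cases "j \<in> K") (auto simp: aw_range_def)
  then show ?thesis unfolding aw_region_def by simp
qed

lemma keys_aw_box_in:
  assumes "y \<in> supp (aw k xs)" "chain_in D xs" "D \<in> Nvec k"
  shows "box_in D y" "Suc (card (snd y)) = length xs"
proof -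
  have ne: "xs \<noteq> []" and sorted: "sorted_wrt (\<le>) xs" using assms by (simp_all add: chain_in_def)
  have "y \<in> (\<Union>K\<in>{K. K \<subseteq> {1..k} \<and> card K = length xs - 1}.
      supp (\<Sum>a\<in>aw_region xs K. frag_of (a, K)))"
    using assms(1) unfolding aw_closed[OF ne sorted chain_in_Nvec[OF assms(2,3)]]
    by (rule subsetD[OF keys_sum])
  then obtain K where K: "K \<subseteq> {1..k}" "card K = length xs - 1"
     "y \<in> supp (\<Sum>a\<in>aw_region xs K. frag_of (a, K))" by blast
  from K(3) have "y \<in> (\<Union>a\<in>aw_region xs K. supp (frag_of (a, K)))"
    by (rule subsetD[OF keys_sum])
  then obtain a where a: "a \<in> aw_region xs K" "y = (a, K)" by auto
  have fin: "finite K" using K finite_subset by blast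
  have "a j + ones K j \<le> D j" for j
  proof -
    have "below K (Suc j) < length xs" using below_le_card[OF fin, of "Suc j"] K(2) ne
        length_greater_0_conv[of xs] by linarith
    then have "xs ! below K (Suc j) \<le> D" using assms(2) by (simp add: chain_in_def)
    moreover have "a j + ones K j \<le> (xs ! below K (Suc j)) j"
      using a(1) unfolding aw_region_iff[OF fin] by blast
    ultimately show ?thesis by (auto simp: le_fun_def intro: order_trans)
  qed
  then show "box_in D y" using a fin by (simp add: box_in_def le_fun_def)
  show "Suc (card (snd y)) = length xs" using a K ne by simp
qed

lemma below_ith_smallest:
  assumes "finite K" "i \<in> {1..card K}"
  shows "below K (ith_smallest K i) = i - 1"
proof -
  let ?f = "ith_smallest K"
  note mono = ith_smallest_strict_mono[OF assms(1)]
  have "{j \<in> K. j < ?f i} = ?f ` {1..<i}"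
  proof
    show "{j \<in> K. j < ?f i} \<subseteq> ?f ` {1..<i}"
    proof
      fix j assume j: "j \<in> {j \<in> K. j < ?f i}"
      then obtain i' where i': "i' \<in> {1..card K}" "j = ?f i'" using ith_smallest_image[OF assms(1)] by blast
      then have "i' < i" using j mono assms(2) strict_mono_on_less by blast
      then show "j \<in> ?f ` {1..<i}" using i' by auto
    qed
    show "?f ` {1..<i} \<subseteq> {j \<in> K. j < ?f i}"
      using ith_smallest_image[OF assms(1)] assms(2) strict_mono_onD[OF mono] by auto
  qed
  moreover have "card (?f ` {1..<i}) = card {1..<i}"
    using strict_mono_on_imp_inj_on[OF mono] by (intro card_image) (rule inj_on_subset, use assms(2) in auto)
  ultimately show ?thesis by (simp add: below_def)
qed

lemma ith_smallest_less_iff: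
  assumes "finite K" "i \<in> {1..card K}"
  shows "ith_smallest K i < j \<longleftrightarrow> i \<le> below K j"
proof -
  have m: "ith_smallest K i \<in> K" using assms ith_smallest_image by blast
  have b: "below K (Suc (ith_smallest K i)) = i"
    using below_ith_smallest[OF assms] m assms by (simp add: below_Suc)
  have mono: "below K p \<le> below K q" if "p \<le> q" for p q
    unfolding below_def using assms(1) that by (intro card_mono) auto
  show ?thesis
  proof
    assume "ith_smallest K i < j"
    then show "i \<le> below K j" using mono[of "Suc (ith_smallest K i)" j] b by simp
  next
    assume i: "i \<le> below K j"
    show "ith_smallest K i < j"
    proof (rule ccontr)
      assume "\<not> ith_smallest K i < j"
      then have "below K j \<le> i - 1" using mono[of j "ith_smallest K i"] below_ith_smallest[OF assms] by simp
      moreover have "1 \<le> i" using assms(2) by simp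
      ultimately show False using i by linarith
    qed
  qed
qed

lemma nth_realize_path:
  "Suc i < length xs \<Longrightarrow> realize_path G l xs ! i = segment G l (xs ! i) (xs ! Suc i)"
proof (induction xs arbitrary: i rule: induct_list012)
  case (3 x y xs)
  show ?case
  proof (cases i)
    case (Suc i')
    then have "Suc i' < length (y # xs)" using 3(3) by simp
    then show ?thesis using 3(2)[of i'] Suc by simp
  qed simp
qed simp_all

lemma sum_ones:
  assumes "K \<subseteq> {1..k}" shows "(\<Sum>i=1..k. ones K i) = card K"
proof -
  have fin: "finite K" using assms finite_subset by blast
  have "(\<Sum>i=1..k. ones K i) = (\<Sum>i\<in>{1..k}. if i \<in> K then 1 else 0)"
    by (simp only: sum_evec_apply[OF fin])
  also have "\<dots> = (\<Sum>i\<in>{1..k} \<inter> K. 1)"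
    by (rule sum.inter_restrict[symmetric]) simp
  also have "{1..k} \<inter> K = K" using assms by auto
  finally show ?thesis by simp
qed

context kgraph
begin

text \<open>A factorization in the slice is one of the first component; the second components are determined by
  composability.\<close>

lemma slice_segment:
  assumes "\<eta> \<in> mor G" "\<mu> \<in> mor G" "src G \<eta> = rng G \<mu>" "src G \<mu> = v" "m \<le> n" "n \<le> deg G \<eta>"
  shows "segment (slice G v) (\<eta>, \<mu>) m n = (segment G \<eta> m n, cmp G (segment G \<eta> n (deg G \<eta>)) \<mu>)"
  unfolding segment_def[of "slice G v"]
proof (rule the_equality)
  let ?D = "deg G \<eta>"
  have mD: "m \<le> ?D" using assms by order
  have z: "0 \<le> m" by (simp add: le_fun_def)
  let ?e1 = "segment G \<eta> 0 m" and ?e2 = "segment G \<eta> m n" and ?e3 = "segment G \<eta> n ?D"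
    and ?m2 = "segment G \<eta> m ?D"
  have e: "?e1 \<in> mor G" "?e2 \<in> mor G" "?e3 \<in> mor G" "?m2 \<in> mor G" "deg G ?e1 = m" "m + deg G ?e2 = n"
    using segment_mor[OF assms(1) z mD] segment_mor[OF assms(1,5,6)]
      segment_mor[OF assms(1,6) order_refl] segment_mor[OF assms(1) mD order_refl] by simp_all
  have s: "src G ?e1 = rng G ?e2" "src G ?e2 = rng G ?e3" "src G ?e1 = rng G ?m2" "src G ?e3 = src G \<eta>"
    using segment_join(1)[OF assms(1) z assms(5,6)] segment_join(1)[OF assms(1,5,6) order_refl]
      segment_join(1)[OF assms(1) z mD order_refl] src_segment_end[OF assms(1,6)] by simp_all
  have s2: "src G ?m2 = src G \<eta>" using src_segment_end[OF assms(1) mD] .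
  have c: "cmp G ?e2 ?e3 = ?m2" "cmp G (cmp G ?e1 ?e2) ?e3 = \<eta>"
    using segment_join(2)[OF assms(1) z assms(5,6)] segment_join(2)[OF assms(1,5,6) order_refl]
      segment_join(2)[OF assms(1) order_trans[OF z assms(5)] assms(6) order_refl]
      segment_whole[OF assms(1)] by simp_all
  let ?x = "(?e2, cmp G ?e3 \<mu>)" and ?l1 = "(?e1, cmp G ?m2 \<mu>)" and ?l2 = "(?e3, \<mu>)"
  have "cmp G ?e2 (cmp G ?e3 \<mu>) = cmp G ?m2 \<mu>"
    using cmp_assoc[OF e(2,3) assms(2) s(2)] c(1) s(4) assms(3) by simp
  then show "?x \<in> mor (slice G v) \<and> m + deg (slice G v) ?x = n \<and>
    (\<exists>l1\<in>mor (slice G v). \<exists>l2\<in>mor (slice G v).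
        src (slice G v) l1 = rng (slice G v) ?x \<and> src (slice G v) ?x = rng (slice G v) l2 \<and>
        deg (slice G v) l1 = m \<and> (\<eta>, \<mu>) = cmp (slice G v) (cmp (slice G v) l1 ?x) l2)"
    using e s s2 c assms by (intro conjI bexI[of _ ?l1] bexI[of _ ?l2])
      (auto simp: slice_def cmp_mor src_cmp rng_cmp)
next
  fix x
  assume A: "x \<in> mor (slice G v) \<and> m + deg (slice G v) x = n \<and>
    (\<exists>l1\<in>mor (slice G v). \<exists>l2\<in>mor (slice G v).
        src (slice G v) l1 = rng (slice G v) x \<and> src (slice G v) x = rng (slice G v) l2 \<and>
        deg (slice G v) l1 = m \<and> (\<eta>, \<mu>) = cmp (slice G v) (cmp (slice G v) l1 x) l2)"
  obtain e2 m2 where x: "x = (e2, m2)" by (cases x)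
  from A obtain e1 m1 e3 m3 where
    l1: "(e1, m1) \<in> mor (slice G v)" and l3: "(e3, m3) \<in> mor (slice G v)"
    and r: "src (slice G v) (e1, m1) = rng (slice G v) x" "src (slice G v) x = rng (slice G v) (e3, m3)"
        "deg (slice G v) (e1, m1) = m" "(\<eta>, \<mu>) = cmp (slice G v) (cmp (slice G v) (e1, m1) x) (e3, m3)"
    by (metis surj_pair)
  have m: "e1 \<in> mor G" "e2 \<in> mor G" "e3 \<in> mor G" "src G e1 = rng G e2" "src G e2 = rng G e3"
    "deg G e1 = m" "m + deg G e2 = n" "m2 = cmp G e3 \<mu>" "\<eta> = cmp G (cmp G e1 e2) e3"
    using A l1 l3 r by (auto simp: slice_def x)
  have "e2 = segment G \<eta> m n" using segment_eqI[OF m(1-5)] m by simp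
  moreover have "e3 = segment G \<eta> n (deg G \<eta>)"
  proof -
    have "src G (cmp G e1 e2) = rng G e3" "deg G (cmp G e1 e2) = n" "cmp G e1 e2 \<in> mor G"
      using m by (auto simp: src_cmp deg_cmp cmp_mor)
    then show ?thesis using segment_suffix[of "cmp G e1 e2" e3] m deg_cmp by auto
  qed
  ultimately show "x = (segment G \<eta> m n, cmp G (segment G \<eta> n (deg G \<eta>)) \<mu>)"
    unfolding x m(8) by (simp only:)
qed

lemma slice_segment_pair:
  assumes "l \<in> mor G" "p \<le> q" "q \<le> deg G l" "m \<le> n" "p + n \<le> q"
  shows "segment (slice G (src G l)) (segment G l p q, segment G l q (deg G l)) m n
    = (segment G l (p + m) (p + n), segment G l (p + n) (deg G l))"
proof -
  let ?e = "segment G l p q" and ?u = "segment G l q (deg G l)"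
  have e: "?e \<in> mor G" "p + deg G ?e = q" "?u \<in> mor G" "src G ?e = rng G ?u" "src G ?u = src G l"
    using segment_mor[OF assms(1-3)] segment_mor[OF assms(1,3) order_refl]
      segment_join(1)[OF assms(1-3) order_refl] src_segment_end[OF assms(1,3)] by simp_all
  have n: "n \<le> deg G ?e"
  proof -
    have "p + n \<le> p + deg G ?e" using e(2) assms(5) by simp
    then show ?thesis by (simp add: le_fun_def)
  qed
  have "segment (slice G (src G l)) (?e, ?u) m n = (segment G ?e m n, cmp G (segment G ?e n (deg G ?e)) ?u)"
    using slice_segment e n assms by auto
  also have "segment G ?e m n = segment G l (p + m) (p + n)" using segment_segment assms by auto
  also have "segment G ?e n (deg G ?e) = segment G l (p + n) q"
    using segment_segment[of l p q n "deg G ?e"] e(2) n assms by simp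
  also have "cmp G (segment G l (p + n) q) ?u = segment G l (p + n) (deg G l)"
    using segment_join(2) assms by auto
  finally show ?thesis .
qed

lemma deg_segment_eqI:
  assumes "l \<in> mor G" "p + d \<le> deg G l"
  shows "deg G (segment G l p (p + d)) = d"
proof -
  have "p \<le> p + d" by (simp add: le_fun_def)
  then have "p + deg G (segment G l p (p + d)) = p + d" using segment_mor(2) assms by blast
  then show ?thesis by simp
qed

lemma realize_cube_props:
  assumes "l \<in> mor G" "box_in (deg G l) (a, K)"
  shows "realize_cube G l (a, K) \<in> mor (slice G (src G l))"
    and "deg (slice G (src G l)) (realize_cube G l (a, K)) = ones K"
    and "colors (slice G (src G l)) (realize_cube G l (a, K)) = K"
    and "K \<subseteq> {1..k}"
    and "realize_cube G l (a, K) \<in> cubes k (slice G (src G l)) (card K)"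
proof -
  let ?q = "a + ones K"
  have fin: "finite K" and q: "?q \<le> deg G l" "a \<le> ?q" using assms by (auto simp: box_in_def le_fun_def)
  show m: "realize_cube G l (a, K) \<in> mor (slice G (src G l))"
    using segment_mor(1)[OF assms(1) q(2,1)] segment_mor(1)[OF assms(1) q(1) order_refl]
      segment_join(1)[OF assms(1) q(2,1) order_refl] src_segment_end[OF assms(1) q(1)]
    by (simp add: realize_cube_def slice_def)
  show d: "deg (slice G (src G l)) (realize_cube G l (a, K)) = ones K"
    using deg_segment_eqI[OF assms(1) q(1)] by (simp add: realize_cube_def slice_def)
  show "colors (slice G (src G l)) (realize_cube G l (a, K)) = K"
    using fin by (auto simp: colors_def d sum_evec_apply)
  show K: "K \<subseteq> {1..k}"
  proof (rule subsetI, rule ccontr)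
    fix j assume j: "j \<in> K" "j \<notin> {1..k}"
    have "deg G l j = 0" using deg_Nvec[OF assms(1)] j(2) unfolding Nvec_def by simp
    moreover have "ones K j = 1" using sum_evec_apply[OF fin, of j] j(1) by (simp only: if_True)
    moreover have "a j + ones K j \<le> deg G l j" using le_funD[OF q(1), of j] by (simp only: plus_fun_apply)
    ultimately show False by linarith
  qed
  have o01: "ones K i \<in> {0, 1}" for i by (cases "i \<in> K") (simp_all only: sum_evec_apply[OF fin] if_True if_False insert_iff simp_thms)
  show "realize_cube G l (a, K) \<in> cubes k (slice G (src G l)) (card K)"
    unfolding cubes_def mem_Collect_eq d by (intro conjI ballI m sum_ones[OF K] o01)
qed

text \<open>The morphism is \<open>\<eta>\<mu>\<close> for a cube \<open>(\<eta>, \<mu>)\<close>, and the unit cube sits at the origin of its box.\<close>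

lemma cube_is_realized:
  assumes "x \<in> cubes k (slice G v) n"
  obtains l K where "l \<in> mor G" "src G l = v" "box_in (deg G l) (0, K)" "card K = n" "K \<subseteq> {1..k}"
    "x = realize_cube G l (0, K)"
proof -
  obtain \<eta> \<mu> where x: "x = (\<eta>, \<mu>)" by (cases x)
  have m: "\<eta> \<in> mor G" "\<mu> \<in> mor G" "src G \<eta> = rng G \<mu>" "src G \<mu> = v"
    and s: "(\<Sum>i=1..k. deg G \<eta> i) = n" "\<forall>i\<in>{1..k}. deg G \<eta> i \<in> {0, 1}"
    using assms by (auto simp: cubes_def slice_def x)
  define K where "K = {i. deg G \<eta> i > 0}"
  have K: "K \<subseteq> {1..k}"
  proof (rule subsetI, rule ccontr)
    fix i assume "i \<in> K" "i \<notin> {1..k}"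
    then show False using deg_Nvec[OF m(1)] unfolding K_def Nvec_def by simp
  qed
  then have fin: "finite K" using finite_subset by blast
  have ones: "ones K = deg G \<eta>"
  proof
    fix i show "ones K i = deg G \<eta> i"
    proof (cases "i \<in> K")
      case True
      then have "i \<in> {1..k}" by (rule subsetD[OF K])
      then have "deg G \<eta> i \<in> {0, 1}" by (rule bspec[OF s(2)])
      moreover have "deg G \<eta> i > 0" using True unfolding K_def by (rule CollectD)
      ultimately have "deg G \<eta> i = 1" by (elim insertE) simp_all
      then show ?thesis using sum_evec_apply[OF fin, of i] True by (simp only: if_True)
    next
      case False
      then show ?thesis using sum_evec_apply[OF fin, of i] by (simp add: K_def)
    qed
  qed
  have n: "card K = n" using s(1) sum_ones[OF K] unfolding ones by (rule trans[OF sym, rotated])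
  let ?l = "cmp G \<eta> \<mu>"
  have l: "?l \<in> mor G" "src G ?l = v" "deg G ?l = deg G \<eta> + deg G \<mu>"
    using cmp_mor[OF m(1-3)] src_cmp[OF m(1-3)] deg_cmp[OF m(1-3)] m(4) by simp_all
  have "deg G \<eta> \<le> deg G \<eta> + deg G \<mu>" by (simp add: le_fun_def)
  then have "box_in (deg G ?l) (0, K)" using fin unfolding box_in_def prod.case ones l(3) by simp
  moreover have "x = realize_cube G ?l (0, K)"
    using segment_prefix[OF m(1-3)] segment_suffix[OF m(1-3)]
    unfolding realize_cube_def prod.case ones l(3) x by simp
  ultimately show thesis using that[OF l(1,2) _ n K] by simp
qed

lemma realize_cube_act:
  assumes "l \<in> mor G" "w \<in> mor G" "src G l = rng G w" "box_in (deg G l) (a, K)"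
  shows "realize_cube G (cmp G l w) (a, K) = (case realize_cube G l (a, K) of (\<eta>, \<mu>) \<Rightarrow> (\<eta>, cmp G \<mu> w))"
proof -
  have "a \<le> a + ones K" "a + ones K \<le> deg G l" using assms by (auto simp: box_in_def le_fun_def)
  then have "segment G (cmp G l w) a (a + ones K) = segment G l a (a + ones K)"
     "segment G (cmp G l w) (a + ones K) (deg G (cmp G l w)) = cmp G (segment G l (a + ones K) (deg G l)) w"
    using segment_cmp_left[OF assms(1-3)] segment_cmp_end[OF assms(1-3)] by blast+
  then show ?thesis by (simp only: realize_cube_def prod.case)
qed

lemma face_realize:
  assumes "l \<in> mor G" "box_in (deg G l) (a, K)" "j \<in> {1..card K}"
  defines "c \<equiv> ith_smallest K j"
  shows "face (slice G (src G l)) 0 j (realize_cube G l (a, K)) = realize_cube G l (a, K - {c})"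
    and "face (slice G (src G l)) 1 j (realize_cube G l (a, K)) = realize_cube G l (a + evec c, K - {c})"
proof -
  note p = realize_cube_props[OF assms(1,2)]
  have fin: "finite K" using assms(2) by (simp add: box_in_def)
  have c: "c \<in> K" using ith_smallest_image[OF fin] assms(3) c_def by blast
  note o = ones_remove[OF fin c]
  have o': "ones K - evec c = ones (K - {c})" unfolding o by (simp add: fun_eq_iff)
  let ?q = "a + ones K"
  have q: "?q \<le> deg G l" "a \<le> ?q" using assms by (auto simp: box_in_def le_fun_def)
  have le: "0 \<le> ones (K - {c})" "evec c \<le> ones K" "a + ones (K - {c}) \<le> ?q"
    unfolding o by (simp_all add: le_fun_def)
  show "face (slice G (src G l)) 0 j (realize_cube G l (a, K)) = realize_cube G l (a, K - {c})"
    unfolding face_def Let_def p(2,3) c_def[symmetric] o'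
    using slice_segment_pair[OF assms(1) q(2,1) le(1,3)]
    by (simp only: realize_cube_def prod.case refl if_True add_0_right)
  have "a + evec c + ones (K - {c}) = ?q" by (simp only: o add.assoc)
  then show "face (slice G (src G l)) 1 j (realize_cube G l (a, K)) = realize_cube G l (a + evec c, K - {c})"
    unfolding face_def Let_def p(2,3) c_def[symmetric] o'
    using slice_segment_pair[OF assms(1) q(2,1) le(2) order_refl]
    by (simp only: realize_cube_def prod.case one_neq_zero if_False)
qed

lemma cube_bd_realize:
  assumes "l \<in> mor G" "box_in (deg G l) (a, K)"
  shows "cube_bd (slice G (src G l)) (card K) (realize_cube G l (a, K))
    = frag_extend (\<lambda>y. frag_of (realize_cube G l y)) (box_bd (a, K))"
proof -
  have fin: "finite K" using assms(2) by (simp add: box_in_def)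
  let ?c = "ith_smallest K" and ?r = "\<lambda>y. frag_of (realize_cube G l y)"
  have bij: "bij_betw ?c {1..card K} K"
    using ith_smallest_image[OF fin] strict_mono_on_imp_inj_on[OF ith_smallest_strict_mono[OF fin]]
    by (simp add: bij_betw_def)
  have "frag_extend ?r (box_bd (a, K)) = (\<Sum>c\<in>K. frag_cmul (color_sign K c)
      (?r (a + evec c, K - {c}) - ?r (a, K - {c})))"
    using fin by (simp add: box_bd_def frag_extend_sum' frag_extend_cmul frag_extend_diff)
  also have "\<dots> = (\<Sum>j=1..card K. frag_cmul (color_sign K (?c j))
      (?r (a + evec (?c j), K - {?c j}) - ?r (a, K - {?c j})))"
    by (rule sum.reindex_bij_betw[OF bij, symmetric])
  also have "\<dots> = cube_bd (slice G (src G l)) (card K) (realize_cube G l (a, K))"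
    unfolding cube_bd_def
  proof (intro sum.cong refl)
    fix j assume j: "j \<in> {1..card K}"
    obtain i where i: "j = Suc i" using j not0_implies_Suc[of j] by force
    have "color_sign K (?c j) = (-1) ^ (j - 1)"
      using below_ith_smallest[OF fin j] by (simp add: color_sign_def below_def)
    also have "\<dots> = (-1) ^ (j + 1)" unfolding i by (simp add: One_nat_def)
    finally have s: "color_sign K (?c j) = (-1) ^ (j + 1)" .
    have "{0..1::nat} = {0, 1}" by auto
    then have "(\<Sum>i=0..1. frag_cmul ((-1) ^ (j + i)) (frag_of (face (slice G (src G l)) i j (realize_cube G l (a, K)))))
      = frag_cmul ((-1) ^ (j + 0)) (?r (a, K - {?c j})) + frag_cmul ((-1) ^ (j + 1)) (?r (a + evec (?c j), K - {?c j}))"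
      unfolding face_realize[OF assms j, symmetric] by simp
    then show "frag_cmul (color_sign K (?c j)) (?r (a + evec (?c j), K - {?c j}) - ?r (a, K - {?c j}))
      = (\<Sum>i=0..1. frag_cmul ((-1) ^ (j + i)) (frag_of (face (slice G (src G l)) i j (realize_cube G l (a, K)))))"
      unfolding s by (simp add: frag_cmul_diff One_nat_def)
  qed
  finally show ?thesis by simp
qed

section \<open>From cubes to paths: the shuffle map\<close>

primrec step_factors :: "'a \<Rightarrow> (nat \<Rightarrow> nat) \<Rightarrow> nat list \<Rightarrow> 'a list" where
  "step_factors l a [] = []"
| "step_factors l a (c # cs) = segment G l a (a + evec c) # step_factors l (a + evec c) cs"

lemma realize_lattice_path:
  "realize_path G l (lattice_path a cs)
    = step_factors l a cs @ [segment G l (a + sum_list (map evec cs)) (deg G l)]"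
proof (induction cs arbitrary: a)
  case (Cons c cs)
  obtain y ys where y: "lattice_path (a + evec c) cs = y # ys" "y = a + evec c"
    by (cases cs) auto
  then show ?case using Cons[of "a + evec c"] by (simp add: add.assoc del: plus_fun_apply)
qed simp

lemma deg_0_src:
  assumes "x \<in> mor G" "deg G x = 0" shows "src G x = x"
proof -
  have "deg G (rng G x) = 0" using deg_vertex rng_vertices assms by auto
  then have "x = src G x"
    using factor_unique(2)[of "rng G x" x x "src G x"] assms
    by (simp add: rng_mor src_mor src_rng rng_src cmp_rng cmp_src)
  then show ?thesis by simp
qed

lemma step_factors_props:
  assumes "l \<in> mor G" "b = a + sum_list (map evec cs)" "b \<le> deg G l"
  shows "composable G (step_factors l a cs @ [src G (segment G l a b)])"
    and "composite G (step_factors l a cs @ [src G (segment G l a b)]) = segment G l a b"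
    and "map (deg G) (step_factors l a cs) = map evec cs"
proof -
  have "composable G (step_factors l a cs @ [src G (segment G l a b)])
    \<and> composite G (step_factors l a cs @ [src G (segment G l a b)]) = segment G l a b
    \<and> map (deg G) (step_factors l a cs) = map evec cs"
    using assms(2)
  proof (induction cs arbitrary: a)
    case Nil
    have "a \<le> deg G l" using assms(3) Nil by simp
    then have "segment G l a a \<in> mor G" "deg G (segment G l a a) = 0"
      using segment_mor[OF assms(1) order_refl, of a] by simp_all
    then show ?case using deg_0_src Nil by auto
  next
    case (Cons c cs)
    let ?a = "a + evec c"
    have b: "b = ?a + sum_list (map evec cs)" using Cons.prems by (simp only: list.map sum_list.Cons add.assoc)
    then have le: "a \<le> ?a" "?a \<le> b" by (simp_all add: le_fun_def)
    have le': "?a \<le> deg G l" "a \<le> b" using le assms(3) by order+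
    have m: "segment G l a ?a \<in> mor G" "segment G l ?a b \<in> mor G" "deg G (segment G l a ?a) = evec c"
      using segment_mor(1)[OF assms(1) le(1) le'(1)] segment_mor(1)[OF assms(1) le(2) assms(3)]
        deg_segment_eqI[OF assms(1) le'(1)] by simp_all
    have j: "src G (segment G l a ?a) = rng G (segment G l ?a b)"
        "cmp G (segment G l a ?a) (segment G l ?a b) = segment G l a b"
      using segment_join assms(1,3) le by blast+
    then have s: "src G (segment G l a b) = src G (segment G l ?a b)"
      using src_cmp m by metis
    have "composable G (step_factors l ?a cs @ [src G (segment G l ?a b)])
       \<and> composite G (step_factors l ?a cs @ [src G (segment G l ?a b)]) = segment G l ?a b
       \<and> map (deg G) (step_factors l ?a cs) = map evec cs"
      by (rule Cons.IH[OF b])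
    then have IH: "composable G (step_factors l ?a cs @ [src G (segment G l ?a b)])"
       "composite G (step_factors l ?a cs @ [src G (segment G l ?a b)]) = segment G l ?a b"
       "map (deg G) (step_factors l ?a cs) = map evec cs"
      by blast+
    show ?case
      using IH m j composite_mor(2)[OF IH(1)]
      by (simp add: composable_Cons composite_Cons s del: plus_fun_apply)
  qed
  then show "composable G (step_factors l a cs @ [src G (segment G l a b)])"
    "composite G (step_factors l a cs @ [src G (segment G l a b)]) = segment G l a b"
    "map (deg G) (step_factors l a cs) = map evec cs" by auto
qed

lemma factors_unique:
  assumes "map (deg G) ls = map (deg G) ls'" "composable G (ls @ [v])" "composable G (ls' @ [v])"
    "composite G (ls @ [v]) = composite G (ls' @ [v])"
  shows "ls = ls'"
  using assms
proof (induction ls arbitrary: ls')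
  case (Cons l ls)
  then obtain m ms where ls': "ls' = m # ms" by (cases ls') auto
  have 1: "l \<in> mor G" "composable G (ls @ [v])" "src G l = rng G (composite G (ls @ [v]))"
    "m \<in> mor G" "composable G (ms @ [v])" "src G m = rng G (composite G (ms @ [v]))"
    using Cons.prems by (auto simp: ls' composable_Cons composite_mor)
  have eq: "cmp G l (composite G (ls @ [v])) = cmp G m (composite G (ms @ [v]))"
    using Cons.prems(4) by (simp add: ls' composite_Cons)
  have "deg G l = deg G m" using Cons.prems by (simp add: ls')
  then have "l = m" "composite G (ls @ [v]) = composite G (ms @ [v])"
    using factor_unique[OF 1(1) composite_mor(1)[OF 1(2)] 1(3) 1(4) composite_mor(1)[OF 1(5)] 1(6) eq] by auto
  then show ?case using Cons 1 by (simp add: ls')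
qed auto

text \<open>The points of an edge path cut a morphism into edges of the prescribed colours, and there is only one
  such factorization.\<close>

lemma factors_segment:
  assumes "l \<in> mor G" "b = a + sum_list (map evec cs)" "b \<le> deg G l"
  shows "factors G (segment G l a b) (map evec cs) = step_factors l a cs"
  unfolding factors_def
  by (rule the_equality) (use step_factors_props[OF assms] factors_unique in \<open>auto\<close>)

lemma nabla_basis_realize:
  assumes "l \<in> mor G" "box_in (deg G l) (a, K)"
  shows "nabla_basis G (card K) (realize_cube G l (a, K))
    = frag_extend (\<lambda>ys. frag_of (realize_path G l ys)) (shuffle (a, K))"
proof -
  have fin: "finite K" and le: "a + ones K \<le> deg G l" using assms(2) by (auto simp: box_in_def)
  let ?s = "segment G l a (a + ones K)" and ?t = "segment G l (a + ones K) (deg G l)"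
  have col: "colors G ?s = K"
    using realize_cube_props(3)[OF assms] by (simp add: realize_cube_def colors_def slice_def)
  let ?g = "\<lambda>cs. frag_of (factors G ?s (map evec cs) @ [?t])"
  have "nabla_basis G (card K) (realize_cube G l (a, K))
     = (\<Sum>\<sigma> | \<sigma> permutes {1..card K}. frag_cmul (sign \<sigma>) (?g (map (\<lambda>i. ith_smallest K (\<sigma> i)) [1..<card K + 1])))"
    by (simp add: nabla_basis_def realize_cube_def col o_def del: upt_Suc)
  also have "\<dots> = (\<Sum>cs\<in>permutations_of_set K. frag_cmul ((-1) ^ inversions cs) (?g cs))"
    by (rule sum_permutes_eq_sum_orderings[OF fin])
  also have "\<dots> = (\<Sum>cs\<in>permutations_of_set K. frag_cmul ((-1) ^ inversions cs)
      (frag_of (realize_path G l (lattice_path a cs))))"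
  proof (intro sum.cong refl)
    fix cs assume "cs \<in> permutations_of_set K"
    then have "distinct cs" "set cs = K" by (auto simp: permutations_of_set_def)
    then have "sum_list (map evec cs) = ones K" by (simp add: sum_list_evec)
    then show "frag_cmul ((-1) ^ inversions cs) (?g cs)
       = frag_cmul ((-1) ^ inversions cs) (frag_of (realize_path G l (lattice_path a cs)))"
      using factors_segment[OF assms(1), of "a + ones K" a cs] le
      by (simp add: realize_lattice_path del: plus_fun_apply)
  qed
  finally show ?thesis
    by (simp add: shuffle_def frag_extend_sum' frag_extend_cmul)
qed

end

section \<open>From paths to cubes: the Alexander-Whitney map\<close>

lemma sum_fun_apply: "(\<Sum>i\<in>I. f i) x = (\<Sum>i\<in>I. f i x)"
  for f :: "'i \<Rightarrow> 'j \<Rightarrow> nat"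
  by (induction I rule: infinite_finite_induct) simp_all

lemma sum_evec_scaled_range:
  "(\<Sum>j=p..k. evec_scaled (d j) j) i = (if p \<le> i \<and> i \<le> k then d i else 0)"
proof -
  have "(\<Sum>j=p..k. evec_scaled (d j) j) i = (\<Sum>j=p..k. if j = i then d i else 0)"
    unfolding sum_fun_apply by (intro sum.cong) (auto simp: evec_scaled_def)
  also have "\<dots> = (if p \<le> i \<and> i \<le> k then d i else 0)"
    by (subst sum.delta) simp_all
  finally show ?thesis .
qed

text \<open>In the vectors \<open>b\<close> and \<open>c\<close> that define \<open>\<square>\<close>, the \<open>i\<close>-th degree contributes to colour \<open>j\<close> if \<open>i\<close> is at most
  the number \<open>r\<close> of directions below \<open>j\<close> (or up to \<open>j\<close>). Thus each coordinate is a partial sum of degrees.\<close>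

lemma threshold_sum:
  fixes d :: "nat \<Rightarrow> nat \<Rightarrow> nat" and p :: "nat \<Rightarrow> nat" and n r j k :: nat
  assumes "\<And>i. i \<in> {1..n} \<Longrightarrow> p i \<le> j \<longleftrightarrow> i \<le> r" "r \<le> n"
    and "\<And>i. i \<in> {1..n} \<Longrightarrow> \<not> j \<le> k \<Longrightarrow> d i j = 0"
  shows "(\<Sum>i=1..n. \<Sum>j'=p i..k. evec_scaled (d i j') j') j = (\<Sum>i=1..r. d i j)"
proof -
  have "(\<Sum>i=1..n. \<Sum>j'=p i..k. evec_scaled (d i j') j') j
     = (\<Sum>i\<in>{1..n}. if i \<le> r then d i j else 0)"
    unfolding sum_fun_apply[of _ "{1..n}"] sum_evec_scaled_range
    by (intro sum.cong) (use assms(1,3) in auto)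
  also have "\<dots> = (\<Sum>i\<in>{i \<in> {1..n}. i \<le> r}. d i j)"
    by (rule sum.inter_filter[symmetric]) simp
  also have "{i \<in> {1..n}. i \<le> r} = {1..r}" using assms(2) by auto
  finally show ?thesis .
qed

context kgraph
begin

lemma telescope_degrees:
  assumes "l \<in> mor G" "chain_in (deg G l) xs" "r < length xs"
  shows "(xs ! 0) j + (\<Sum>i=1..r. deg G (realize_path G l xs ! (i - 1)) j) = (xs ! r) j"
  using assms(3)
proof (induction r)
  case 0
  then show ?case by simp
next
  case (Suc r)
  have r: "r < length xs" using Suc.prems by simp
  have "xs ! r \<le> xs ! Suc r" "xs ! Suc r \<le> deg G l"
    using chain_in_nth_mono[OF assms(2), of r "Suc r"] Suc.prems assms(2) by (auto simp: chain_in_def)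
  then have "xs ! r + deg G (segment G l (xs ! r) (xs ! Suc r)) = xs ! Suc r"
    by (rule segment_mor(2)[OF assms(1)])
  then have "(xs ! r) j + deg G (realize_path G l xs ! r) j = (xs ! Suc r) j"
    unfolding nth_realize_path[OF Suc.prems] by (metis plus_fun_apply)
  moreover have "(\<Sum>i=1..Suc r. deg G (realize_path G l xs ! (i - 1)) j)
    = (\<Sum>i=1..r. deg G (realize_path G l xs ! (i - 1)) j) + deg G (realize_path G l xs ! r) j"
    by simp
  ultimately show ?case using Suc.IH[OF r] by linarith
qed

text \<open>The partial sums of degrees telescope to coordinates of the points of \<open>xs\<close>: after a shift by the first
  point, \<open>b\<close> and \<open>c\<close> are the lower and upper bounds of \<open>aw_region\<close>.\<close>

lemma square_hat_realize:
  assumes l: "l \<in> mor G" and xs: "chain_in (deg G l) xs" "length xs = Suc n"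
    and K: "K \<subseteq> {1..k}" "card K = n"
  defines "p \<equiv> \<lambda>j. (xs ! below K j) j" and "q \<equiv> \<lambda>j. (xs ! below K (Suc j)) j"
  shows "square_hat k G n (realize_path G l xs) K = (segment G l p q, segment G l q (deg G l))"
    and "p \<le> q" and "q \<le> deg G l"
proof -
  have fin: "finite K" using K(1) finite_subset by blast
  have bn: "below K j \<le> n" for j using below_le_card[OF fin] K(2) by simp
  have mono: "below K j \<le> below K (Suc j)" for j by (simp add: below_Suc[OF fin])
  let ?ls = "realize_path G l xs"
  let ?d = "\<lambda>i. deg G (?ls ! (i - 1))"
  have nz: "?d i j = 0" if "i \<in> {1..n}" "\<not> j \<le> k" for i j
  proof -
    have "i - 1 < length ?ls" using that xs(2) by auto
    then have "?ls ! (i - 1) \<in> mor G"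
      using realize_path_props(1)[OF l xs(1)] nth_mem unfolding composable_def by blast
    then have "?d i \<in> Nvec k" by (rule deg_Nvec)
    then show ?thesis using that(2) unfolding Nvec_def by simp
  qed
  let ?b = "\<Sum>i=1..n. \<Sum>j=ith_smallest K i + 1..k. evec_scaled (?d i j) j"
  let ?c = "\<Sum>i=1..n. \<Sum>j=ith_smallest K i..k. evec_scaled (?d i j) j"
  have b: "?b j = (\<Sum>i=1..below K j. ?d i j)" for j
  proof (rule threshold_sum)
    fix i assume "i \<in> {1..n}"
    then show "ith_smallest K i + 1 \<le> j \<longleftrightarrow> i \<le> below K j"
      using ith_smallest_less_iff[OF fin, of i j] K(2) by (simp add: One_nat_def Suc_le_eq)
  qed (use bn nz in auto)
  have c: "?c j = (\<Sum>i=1..below K (Suc j). ?d i j)" for j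
  proof (rule threshold_sum)
    fix i assume "i \<in> {1..n}"
    then show "ith_smallest K i \<le> j \<longleftrightarrow> i \<le> below K (Suc j)"
      using ith_smallest_less_iff[OF fin, of i "Suc j"] K(2) by (simp add: less_Suc_eq_le)
  qed (use bn nz in auto)
  let ?x = "xs ! 0"
  have xb: "?x + ?b = p"
    by (rule ext, unfold plus_fun_apply b p_def, rule telescope_degrees[OF l xs(1)])
       (use bn xs(2) in \<open>simp add: le_imp_less_Suc\<close>)
  have xc: "?x + ?c = q"
    by (rule ext, unfold plus_fun_apply c q_def, rule telescope_degrees[OF l xs(1)])
       (use bn xs(2) in \<open>simp add: le_imp_less_Suc\<close>)
  show pq: "p \<le> q"
  proof (rule le_funI)
    fix j
    have "xs ! below K j \<le> xs ! below K (Suc j)"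
      by (rule chain_in_nth_mono[OF xs(1) mono]) (use bn xs(2) in \<open>simp add: le_imp_less_Suc\<close>)
    then show "p j \<le> q j" unfolding p_def q_def by (rule le_funD)
  qed
  show qD: "q \<le> deg G l"
  proof (rule le_funI)
    fix j
    have "xs ! below K (Suc j) \<in> set xs" using bn[of "Suc j"] xs(2) by (simp add: le_imp_less_Suc)
    then have "xs ! below K (Suc j) \<le> deg G l" using xs(1) unfolding chain_in_def by blast
    then show "q j \<le> deg G l j" unfolding q_def by (rule le_funD)
  qed
  have x: "?x \<le> deg G l" using xs by (simp add: chain_in_def)
  have hd: "hd xs = ?x" using xs by (intro hd_conv_nth) auto
  have l': "composite G ?ls = segment G l ?x (deg G l)"
    using realize_path_props(2)[OF l xs(1)] unfolding hd .
  let ?l = "segment G l ?x (deg G l)"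
  have dl: "?x + deg G ?l = deg G l" by (rule segment_mor(2)[OF l x order_refl])
  have "?x + ?b \<le> ?x + ?c" unfolding xb xc by (rule pq)
  then have bc: "?b \<le> ?c" by (simp only: add_le_cancel_left)
  have "?x + ?c \<le> ?x + deg G ?l" unfolding xc dl by (rule qD)
  then have cD: "?c \<le> deg G ?l" by (simp only: add_le_cancel_left)
  have "segment G ?l ?b ?c = segment G l (?x + ?b) (?x + ?c)"
    by (rule segment_segment[OF l x order_refl bc]) (unfold xc, rule qD)
  then have 1: "segment G ?l ?b ?c = segment G l p q" unfolding xb xc .
  have "segment G ?l ?c (deg G ?l) = segment G l (?x + ?c) (?x + deg G ?l)"
    by (rule segment_segment[OF l x order_refl cD]) (unfold dl, rule order_refl)
  then have 2: "segment G ?l ?c (deg G ?l) = segment G l q (deg G l)" unfolding xc dl .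
  show "square_hat k G n ?ls K = (segment G l p q, segment G l q (deg G l))"
    unfolding square_hat_def Let_def l' 1 2 ..
qed

lemma bracket_realize:
  assumes l: "l \<in> mor G" and xs: "chain_in (deg G l) xs" "length xs = Suc n"
    and K: "K \<subseteq> {1..k}" "card K = n"
  shows "bracket k (slice G (src G l)) K (square_hat k G n (realize_path G l xs) K)
    = (\<Sum>a\<in>aw_region xs K. frag_of (realize_cube G l (a, K)))"
proof -
  have fin: "finite K" using K(1) finite_subset by blast
  define p where "p = (\<lambda>j. (xs ! below K j) j)"
  define q where "q = (\<lambda>j. (xs ! below K (Suc j)) j)"
  note hat = square_hat_realize[OF l xs K, folded p_def q_def]
  let ?h = "(segment G l p q, segment G l q (deg G l))" and ?S = "slice G (src G l)"
  have dh: "deg ?S ?h = deg G (segment G l p q)" by (simp add: slice_def)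
  have pd: "p + deg G (segment G l p q) = q" by (rule segment_mor(2)[OF l hat(2,3)])
  have region: "a \<in> aw_region xs K \<longleftrightarrow> p \<le> a \<and> a + ones K \<le> q" for a
    unfolding aw_region_iff[OF fin] le_fun_def p_def q_def plus_fun_apply by blast
  have iff: "m + ones K \<le> deg ?S ?h \<longleftrightarrow> p + m + ones K \<le> q" for m
  proof -
    have "m + ones K \<le> deg G (segment G l p q) \<longleftrightarrow> p + (m + ones K) \<le> p + deg G (segment G l p q)"
      by (rule add_le_cancel_left[symmetric])
    then show ?thesis unfolding dh pd add.assoc .
  qed
  have seg: "segment ?S ?h m (m + ones K) = realize_cube G l (p + m, K)" if "m + ones K \<le> deg ?S ?h" for m
  proof -
    have "m \<le> m + ones K" by (simp add: le_fun_def)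
    moreover have "p + (m + ones K) \<le> q" using that unfolding iff by (simp only: add.assoc)
    ultimately show ?thesis
      using slice_segment_pair[OF l hat(2,3)] unfolding realize_cube_def prod.case by (simp only: add.assoc)
  qed
  have pN: "q \<in> Nvec k" using hat(3) deg_Nvec[OF l] Nvec_mono by blast
  have "bracket k ?S K ?h = (\<Sum>m | m \<in> Nvec k \<and> m + ones K \<le> deg ?S ?h. frag_of (realize_cube G l (p + m, K)))"
    unfolding bracket_def by (intro sum.cong refl) (use seg in simp)
  also have "\<dots> = (\<Sum>a\<in>aw_region xs K. frag_of (realize_cube G l (a, K)))"
  proof (rule sum.reindex_bij_witness[where i = "\<lambda>a j. a j - p j" and j = "\<lambda>m. p + m"])
    fix m assume m: "m \<in> {m. m \<in> Nvec k \<and> m + ones K \<le> deg ?S ?h}"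
    show "(\<lambda>j. (p + m) j - p j) = m" by (simp add: fun_eq_iff)
    show "p + m \<in> aw_region xs K"
      unfolding region using m iff by (simp add: le_fun_def)
    show "frag_of (realize_cube G l (p + m, K)) = frag_of (realize_cube G l (p + m, K))" ..
  next
    fix a assume "a \<in> aw_region xs K"
    then have a: "p \<le> a" "a + ones K \<le> q" unfolding region by auto
    show pa: "p + (\<lambda>j. a j - p j) = a"
    proof
      fix j show "(p + (\<lambda>j. a j - p j)) j = a j" using le_funD[OF a(1), of j] by simp
    qed
    have "(\<lambda>j. a j - p j) \<le> q"
    proof (rule le_funI)
      fix j have "a j + ones K j \<le> q j" using le_funD[OF a(2), of j] by (simp only: plus_fun_apply)
      then show "a j - p j \<le> q j" by linarith
    qed
    then have "(\<lambda>j. a j - p j) \<in> Nvec k" by (rule Nvec_mono[OF pN])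
    then show "(\<lambda>j. a j - p j) \<in> {m. m \<in> Nvec k \<and> m + ones K \<le> deg ?S ?h}"
      using a(2) unfolding mem_Collect_eq iff pa by blast
  qed
  finally show ?thesis unfolding hat(1) .
qed

lemma square_basis_realize:
  assumes l: "l \<in> mor G" and xs: "chain_in (deg G l) xs" "length xs = Suc n"
  shows "square_basis k G n (src G l) (realize_path G l xs)
    = frag_extend (\<lambda>y. frag_of (realize_cube G l y)) (aw k xs)"
proof -
  have ne: "xs \<noteq> []" and sorted: "sorted_wrt (\<le>) xs" using xs(1) by (simp_all add: chain_in_def)
  let ?X = "{K. K \<subseteq> {1..k} \<and> card K = n}"
  have finX: "finite ?X" by (rule finite_subset[of _ "Pow {1..k}"]) auto
  have fin: "finite (aw_region xs K)" if "K \<in> ?X" for K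
    using that finite_subset[of K "{1..k}"] by (intro finite_aw_region) simp
  have "frag_extend (\<lambda>y. frag_of (realize_cube G l y)) (aw k xs)
     = (\<Sum>K\<in>?X. \<Sum>a\<in>aw_region xs K. frag_of (realize_cube G l (a, K)))"
  proof -
    have n: "length xs - 1 = n" using xs(2) by simp
    have "aw k xs = (\<Sum>K\<in>?X. \<Sum>a\<in>aw_region xs K. frag_of (a, K))"
      using aw_closed[OF ne sorted chain_in_Nvec[OF xs(1) deg_Nvec[OF l]]] unfolding n .
    then show ?thesis using finX fin by (simp add: frag_extend_sum' del: mem_Collect_eq)
  qed
  also have "\<dots> = square_basis k G n (src G l) (realize_path G l xs)"
    unfolding square_basis_def
    by (intro sum.cong refl) (use bracket_realize[OF l xs] in simp)
  finally show ?thesis by simp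
qed

end

section \<open>Transport from the lattice to the complexes\<close>

definition boxes_in :: "(nat \<Rightarrow> nat) \<Rightarrow> nat \<Rightarrow> ((nat \<Rightarrow> nat) \<times> nat set) set"
  where "boxes_in D n = {y. box_in D y \<and> card (snd y) = n}"

definition chains_in :: "(nat \<Rightarrow> nat) \<Rightarrow> nat \<Rightarrow> (nat \<Rightarrow> nat) list set"
  where "chains_in D n = {xs. chain_in D xs \<and> length xs = n}"

lemma keys_box_bd_boxes_in: "y \<in> boxes_in D (Suc n) \<Longrightarrow> supp (box_bd y) \<subseteq> boxes_in D n"
  using keys_box_bd[of _ "fst y" "snd y" D] by (auto simp: boxes_in_def)

lemma keys_simplex_bd_chains_in:
  assumes "xs \<in> chains_in D (Suc (Suc n))"
  shows "supp (simplex_bd xs) \<subseteq> chains_in D (Suc n)"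
proof
  fix ys assume ys: "ys \<in> supp (simplex_bd xs)"
  have "chain_in D xs" "length xs = Suc (Suc n)" using assms by (auto simp: chains_in_def)
  moreover from this(2) have "length xs \<noteq> 1" by (simp add: One_nat_def)
  ultimately show "ys \<in> chains_in D (Suc n)"
    using keys_simplex_bd_chain_in[OF ys] by (simp add: chains_in_def)
qed

lemma keys_shuffle_chains_in: "y \<in> boxes_in D n \<Longrightarrow> supp (shuffle y) \<subseteq> chains_in D (Suc n)"
  using keys_shuffle[of _ "fst y" "snd y" D] by (auto simp: boxes_in_def chains_in_def)

lemma keys_aw_boxes_in:
  "xs \<in> chains_in D (Suc n) \<Longrightarrow> D \<in> Nvec k \<Longrightarrow> supp (aw k xs) \<subseteq> boxes_in D n"
  using keys_aw_box_in[of _ k xs D] by (auto simp: boxes_in_def chains_in_def)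

lemma shuffle_bd:
  assumes "y \<in> boxes_in D (Suc n)"
  shows "frag_extend simplex_bd (shuffle y) = frag_extend shuffle (box_bd y)"
proof -
  have "finite (snd y)" "card (snd y) = Suc n" using assms by (auto simp: boxes_in_def box_in_def)
  then have "snd y \<noteq> {}" by auto
  then show ?thesis using shuffle_chain_map[of "snd y" "fst y"] \<open>finite (snd y)\<close> by simp
qed

text \<open>The shuffle map is an injective chain map, as the Alexander-Whitney map is a left inverse of it; so
  the identity is inherited from the simplicial boundary.\<close>

lemma box_bd_bd:
  assumes "y \<in> boxes_in D (Suc (Suc n))" "snd y \<subseteq> {1..k}"
  shows "frag_extend box_bd (box_bd y) = 0"
proof -
  let ?c = "frag_extend box_bd (box_bd y)"
  have "frag_extend shuffle ?c = frag_extend (\<lambda>z. frag_extend shuffle (box_bd z)) (box_bd y)"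
    by (simp only: frag_extend_frag_extend)
  also have "\<dots> = frag_extend (\<lambda>z. frag_extend simplex_bd (shuffle z)) (box_bd y)"
    by (rule frag_extend_cong[OF keys_box_bd_boxes_in[OF assms(1)]]) (rule shuffle_bd[symmetric])
  also have "\<dots> = frag_extend simplex_bd (frag_extend shuffle (box_bd y))"
    by (simp only: frag_extend_frag_extend)
  also have "\<dots> = frag_extend simplex_bd (frag_extend simplex_bd (shuffle y))"
    by (simp only: shuffle_bd[OF assms(1)])
  also have "\<dots> = 0"
    unfolding frag_extend_frag_extend by (rule frag_extend_eq_0) (rule simplex_bd_bd)
  finally have z: "frag_extend shuffle ?c = 0" .
  have sub: "snd x \<subseteq> snd z" if "x \<in> supp (box_bd z)" for x z
    using keys_box_bd_face[of x "fst z" "snd z"] that by auto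
  have "frag_extend (aw k) (frag_extend shuffle ?c) = frag_extend frag_of ?c"
    unfolding frag_extend_frag_extend[of "aw k"]
  proof (rule frag_extend_eq)
    fix x assume "x \<in> supp ?c"
    then have "x \<in> (\<Union>z\<in>supp (box_bd y). supp (box_bd z))"
      by (rule subsetD[OF keys_frag_extend])
    then have "snd x \<subseteq> {1..k}" using sub assms(2) by blast
    then show "frag_extend (aw k) (shuffle x) = frag_of x"
      using aw_shuffle[of "snd x" k "fst x"] by simp
  qed
  then show ?thesis unfolding z by simp
qed

text \<open>A family of free groups with basis \<open>B n v\<close> is realized by a lattice model \<open>M\<close> if every basis
  element comes from a model element in the box \<open>[0, d(l)]\<close> of a morphism \<open>l\<close>, and the right action
  only enlarges \<open>l\<close>, leaving the model element unchanged. A map that is given on each box by one and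
  the same formula on model elements then commutes with the action.\<close>

locale realization = kgraph k G for k :: nat and G :: "'a dgraph" +
  fixes M :: "(nat \<Rightarrow> nat) \<Rightarrow> nat \<Rightarrow> 'm set" and r :: "'a \<Rightarrow> 'm \<Rightarrow> 'b"
    and B :: "nat \<Rightarrow> 'a \<Rightarrow> 'b set" and ba :: "'b \<Rightarrow> 'a \<Rightarrow> 'b"
  assumes M_mono: "D \<le> D' \<Longrightarrow> M D n \<subseteq> M D' n"
    and r_mem: "l \<in> mor G \<Longrightarrow> y \<in> M (deg G l) n \<Longrightarrow> r l y \<in> B n (src G l)"
    and r_ex: "x \<in> B n v \<Longrightarrow> \<exists>l y. l \<in> mor G \<and> v = src G l \<and> y \<in> M (deg G l) n \<and> x = r l y"
    and r_act: "l \<in> mor G \<Longrightarrow> w \<in> mor G \<Longrightarrow> src G l = rng G w \<Longrightarrow> y \<in> M (deg G l) n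
      \<Longrightarrow> r (cmp G l w) y = ba (r l y) w"
begin

lemma r_cases:
  assumes "x \<in> B n v"
  obtains l y where "l \<in> mor G" "v = src G l" "y \<in> M (deg G l) n" "x = r l y"
  using r_ex[OF assms] by blast

lemma M_cmp:
  assumes "l \<in> mor G" "w \<in> mor G" "src G l = rng G w"
  shows "M (deg G l) n \<subseteq> M (deg G (cmp G l w)) n"
  by (rule M_mono) (simp add: deg_cmp[OF assms] le_fun_def)

lemma act_closed:
  assumes w: "w \<in> mor G" and x: "x \<in> B n (rng G w)"
  shows "ba x w \<in> B n (src G w)"
proof -
  obtain l y where l: "l \<in> mor G" "rng G w = src G l" "y \<in> M (deg G l) n" "x = r l y"
    using x by (rule r_cases)
  have "r (cmp G l w) y \<in> B n (src G (cmp G l w))"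
    by (rule r_mem) (use M_cmp[OF l(1) w] l w in \<open>auto simp: cmp_mor\<close>)
  then show ?thesis using r_act[OF l(1) w _ l(3)] l w by (simp add: src_cmp)
qed

end

context kgraph
begin

text \<open>The map \<open>\<phi>\<close> between realized bases is given on every box by the formula \<open>g\<close>, which does not leave the
  box.\<close>

definition modelled ::
    "((nat \<Rightarrow> nat) \<Rightarrow> 'm set) \<Rightarrow> ('a \<Rightarrow> 'm \<Rightarrow> 'b) \<Rightarrow> ((nat \<Rightarrow> nat) \<Rightarrow> 'n set) \<Rightarrow> ('a \<Rightarrow> 'n \<Rightarrow> 'c)
      \<Rightarrow> ('a \<Rightarrow> 'b \<Rightarrow> ('c \<Rightarrow>\<^sub>0 int)) \<Rightarrow> ('m \<Rightarrow> ('n \<Rightarrow>\<^sub>0 int)) \<Rightarrow> bool"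
  where "modelled M r M' r' \<phi> g \<longleftrightarrow> (\<forall>l\<in>mor G. \<forall>y\<in>M (deg G l).
     \<phi> (src G l) (r l y) = push (r' l) (g y) \<and> supp (g y) \<subseteq> M' (deg G l))"

lemma modelledD:
  assumes "modelled M r M' r' \<phi> g" "l \<in> mor G" "y \<in> M (deg G l)"
  shows "\<phi> (src G l) (r l y) = push (r' l) (g y)" "supp (g y) \<subseteq> M' (deg G l)"
  using assms by (auto simp: modelled_def)

lemma modelled_comp_eq:
  assumes "modelled M r M' r' \<phi> g" "modelled M' r' M'' r'' \<psi> h" "l \<in> mor G" "y \<in> M (deg G l)"
  shows "frag_extend (\<psi> (src G l)) (\<phi> (src G l) (r l y)) = push (r'' l) (frag_extend h (g y))"
  unfolding modelledD(1)[OF assms(1,3,4)] frag_extend_frag_extend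
  by (rule frag_extend_cong[OF modelledD(2)[OF assms(1,3,4)]])
    (simp add: modelledD(1)[OF assms(2,3)])

lemma modelled_comp:
  assumes "modelled M r M' r' \<phi> g" "modelled M' r' M'' r'' \<psi> h"
  shows "modelled M r M'' r'' (\<lambda>v x. frag_extend (\<psi> v) (\<phi> v x)) (\<lambda>y. frag_extend h (g y))"
  unfolding modelled_def
proof (intro ballI conjI)
  fix l y assume l: "l \<in> mor G" "y \<in> M (deg G l)"
  show "frag_extend (\<psi> (src G l)) (\<phi> (src G l) (r l y)) = push (r'' l) (frag_extend h (g y))"
    by (rule modelled_comp_eq[OF assms l])
  show "supp (frag_extend h (g y)) \<subseteq> M'' (deg G l)"
    by (rule keys_frag_extend_subset[OF modelledD(2)[OF assms(1) l] modelledD(2)[OF assms(2) l(1)]])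
qed

lemma modelled_keys:
  assumes "realization k G M r B ba" "realization k G M' r' B' ba'"
    and "modelled (\<lambda>D. M D n) r (\<lambda>D. M' D m) r' \<phi> g" "x \<in> B n v"
  shows "supp (\<phi> v x) \<subseteq> B' m v"
proof -
  obtain l y where l: "l \<in> mor G" "v = src G l" "y \<in> M (deg G l) n" "x = r l y"
    using assms(4) by (rule realization.r_cases[OF assms(1)])
  show ?thesis
    unfolding l(2,4) modelledD(1)[OF assms(3) l(1,3)]
    by (rule keys_frag_extend_subset[OF modelledD(2)[OF assms(3) l(1,3)]])
      (simp add: realization.r_mem[OF assms(2) l(1)])
qed

lemma modelled_act:
  assumes M: "realization k G M r B ba" and M': "realization k G M' r' B' ba'"
    and mo: "modelled (\<lambda>D. M D n) r (\<lambda>D. M' D m) r' \<phi> g" and w: "w \<in> mor G" and x: "x \<in> B n (rng G w)"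
  shows "\<phi> (src G w) (ba x w) = push (\<lambda>z. ba' z w) (\<phi> (rng G w) x)"
proof -
  obtain l y where l: "l \<in> mor G" "rng G w = src G l" "y \<in> M (deg G l) n" "x = r l y"
    using x by (rule realization.r_cases[OF M])
  note lw = l(1) w l(2)[symmetric]
  have y: "y \<in> M (deg G (cmp G l w)) n" using realization.M_cmp[OF M lw] l(3) by blast
  have "\<phi> (src G w) (ba x w) = \<phi> (src G (cmp G l w)) (r (cmp G l w) y)"
    using realization.r_act[OF M lw l(3)] src_cmp[OF lw] l(4) by simp
  also have "\<dots> = push (r' (cmp G l w)) (g y)"
    by (rule modelledD(1)[OF mo cmp_mor[OF lw] y])
  also have "\<dots> = frag_extend (\<lambda>z. push (\<lambda>z. ba' z w) (frag_of (r' l z))) (g y)"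
    by (rule frag_extend_cong[OF modelledD(2)[OF mo l(1,3)]])
      (simp add: realization.r_act[OF M' lw])
  also have "\<dots> = push (\<lambda>z. ba' z w) (push (r' l) (g y))"
    by (simp only: frag_extend_frag_extend)
  also have "push (r' l) (g y) = \<phi> (rng G w) x"
    unfolding l(2,4) by (rule modelledD(1)[OF mo l(1,3), symmetric])
  finally show ?thesis .
qed

text \<open>Identities between composites of modelled maps need only be checked in the model.\<close>

lemma modelled_eq:
  assumes M: "realization k G M r B ba"
    and "modelled (\<lambda>D. M D n) r M' r' \<phi> g" "modelled M' r' M'' r'' \<psi> h"
    and "modelled (\<lambda>D. M D n) r N' s' \<phi>' g'" "modelled N' s' M'' r'' \<psi>' h'"
    and eq: "\<And>l y. l \<in> mor G \<Longrightarrow> y \<in> M (deg G l) n \<Longrightarrow> frag_extend h (g y) = frag_extend h' (g' y)"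
    and x: "x \<in> B n v"
  shows "frag_extend (\<psi> v) (\<phi> v x) = frag_extend (\<psi>' v) (\<phi>' v x)"
proof -
  obtain l y where l: "l \<in> mor G" "v = src G l" "y \<in> M (deg G l) n" "x = r l y"
    using x by (rule realization.r_cases[OF M])
  show ?thesis
    unfolding l(2,4) modelled_comp_eq[OF assms(2,3) l(1,3)] modelled_comp_eq[OF assms(4,5) l(1,3)]
      eq[OF l(1,3)] ..
qed

lemma augmentation_push: "augmentation (push g c) = augmentation c"
  using augmentation_frag_extend[of c "\<lambda>x. frag_of (g x)" 1] by simp

lemma basis_complexI:
  assumes M: "realization k G M r B ba" and "basis_action G B ba"
    and mo: "\<And>n. modelled (\<lambda>D. M D (Suc n)) r (\<lambda>D. M D n) r (\<lambda>v. bo (Suc n) v) g"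
    and gg: "\<And>l n y. l \<in> mor G \<Longrightarrow> y \<in> M (deg G l) (Suc (Suc n)) \<Longrightarrow> frag_extend g (g y) = 0"
    and aug: "\<And>l y. l \<in> mor G \<Longrightarrow> y \<in> M (deg G l) (Suc 0) \<Longrightarrow> augmentation (g y) = 0"
  shows "basis_complex G B ba bo"
proof (intro basis_complex.intro basis_complex_axioms.intro assms(2))
  fix v x n assume "x \<in> B (Suc n) v"
  then show "supp (bo (Suc n) v x) \<subseteq> B n v" by (rule modelled_keys[OF M M mo])
next
  fix w x n assume "w \<in> mor G" "x \<in> B (Suc n) (rng G w)"
  then show "bo (Suc n) (src G w) (ba x w) = push (\<lambda>y. ba y w) (bo (Suc n) (rng G w) x)"
    by (rule modelled_act[OF M M mo])
next
  fix v x n assume "x \<in> B (Suc (Suc n)) v"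
  then obtain l y where l: "l \<in> mor G" "v = src G l" "y \<in> M (deg G l) (Suc (Suc n))" "x = r l y"
    by (rule realization.r_cases[OF M])
  show "frag_extend (bo (Suc n) v) (bo (Suc (Suc n)) v x) = 0"
    unfolding l(2,4) modelled_comp_eq[OF mo mo l(1,3)] gg[OF l(1,3)] by simp
next
  fix v x assume "x \<in> B (Suc 0) v"
  then obtain l y where l: "l \<in> mor G" "v = src G l" "y \<in> M (deg G l) (Suc 0)" "x = r l y"
    by (rule realization.r_cases[OF M])
  show "augmentation (bo (Suc 0) v x) = 0"
    unfolding l(2,4) modelledD(1)[OF mo l(1,3)] augmentation_push by (rule aug[OF l(1,3)])
qed

lemma chain_map_modelled:
  assumes M: "realization k G M r B ba" and M': "realization k G M' r' B' ba'"
    and C: "basis_complex G B ba bo" "basis_complex G B' ba' bo'"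
    and bo: "\<And>n. modelled (\<lambda>D. M D (Suc n)) r (\<lambda>D. M D n) r (\<lambda>v. bo (Suc n) v) g"
    and bo': "\<And>n. modelled (\<lambda>D. M' D (Suc n)) r' (\<lambda>D. M' D n) r' (\<lambda>v. bo' (Suc n) v) g'"
    and f: "\<And>n. modelled (\<lambda>D. M D n) r (\<lambda>D. M' D n) r' (\<lambda>v. f n v) F"
    and eq: "\<And>l y n. l \<in> mor G \<Longrightarrow> y \<in> M (deg G l) (Suc n) \<Longrightarrow> frag_extend g' (F y) = frag_extend F (g y)"
    and aug: "\<And>l y. l \<in> mor G \<Longrightarrow> y \<in> M (deg G l) 0 \<Longrightarrow> augmentation (F y) = 1"
  shows "chain_map G (aug_complex B ba bo) (aug_complex B' ba' bo') (aug_map f)"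
proof (rule chain_map_aug[OF C])
  fix n v x assume "x \<in> B n v"
  then show "supp (f n v x) \<subseteq> B' n v" by (rule modelled_keys[OF M M' f])
next
  fix n w x assume "w \<in> mor G" "x \<in> B n (rng G w)"
  then show "f n (src G w) (ba x w) = push (\<lambda>y. ba' y w) (f n (rng G w) x)"
    by (rule modelled_act[OF M M' f])
next
  fix n v x assume x: "x \<in> B (Suc n) v"
  show "frag_extend (bo' (Suc n) v) (f (Suc n) v x) = frag_extend (f n v) (bo (Suc n) v x)"
    by (rule modelled_eq[OF M f[of "Suc n"] bo'[of n] bo[of n] f[of n] _ x]) (rule eq)
next
  fix v x assume "x \<in> B 0 v"
  then obtain l y where l: "l \<in> mor G" "v = src G l" "y \<in> M (deg G l) 0" "x = r l y"
    by (rule realization.r_cases[OF M])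
  show "augmentation (f 0 v x) = 1"
    unfolding l(2,4) modelledD(1)[OF f l(1,3)] augmentation_push by (rule aug[OF l(1,3)])
qed

section \<open>The two complexes and the comparison maps in the model\<close>

abbreviation cube_act :: "'a \<times> 'a \<Rightarrow> 'a \<Rightarrow> 'a \<times> 'a"
  where "cube_act \<equiv> \<lambda>(\<eta>, \<mu>) l. (\<eta>, cmp G \<mu> l)"

abbreviation path_act :: "'a list \<Rightarrow> 'a \<Rightarrow> 'a list"
  where "path_act \<equiv> \<lambda>ls l. butlast ls @ [cmp G (last ls) l]"

lemma boxes_in_colors: "l \<in> mor G \<Longrightarrow> y \<in> boxes_in (deg G l) n \<Longrightarrow> snd y \<subseteq> {1..k}"
  using realize_cube_props(4)[of l "fst y" "snd y"] unfolding boxes_in_def by simp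

lemma realization_cubes:
  "realization k G boxes_in (realize_cube G) (\<lambda>n v. cubes k (slice G v) n) cube_act"
proof unfold_locales
  fix D D' :: "nat \<Rightarrow> nat" and n assume "D \<le> D'"
  then show "boxes_in D n \<subseteq> boxes_in D' n"
    by (auto simp: boxes_in_def box_in_def intro: order_trans)
next
  fix l y n assume "l \<in> mor G" "y \<in> boxes_in (deg G l) n"
  then show "realize_cube G l y \<in> cubes k (slice G (src G l)) n"
    using realize_cube_props(5)[of l "fst y" "snd y"] by (simp add: boxes_in_def)
next
  fix x n v assume x: "x \<in> cubes k (slice G v) n"
  obtain l K where l: "l \<in> mor G" "src G l = v" "box_in (deg G l) (0, K)" "card K = n"
    "x = realize_cube G l (0, K)"
    by (rule cube_is_realized[OF x])
  show "\<exists>l y. l \<in> mor G \<and> v = src G l \<and> y \<in> boxes_in (deg G l) n \<and> x = realize_cube G l y"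
    by (intro exI[of _ l] exI[of _ "(0, K)"]) (use l in \<open>simp add: boxes_in_def\<close>)
next
  fix l w y n assume "l \<in> mor G" "w \<in> mor G" "src G l = rng G w" "y \<in> boxes_in (deg G l) n"
  then show "realize_cube G (cmp G l w) y = cube_act (realize_cube G l y) w"
    using realize_cube_act[of l w "fst y" "snd y"] by (simp add: boxes_in_def case_prod_unfold)
qed

lemma realization_paths:
  "realization k G (\<lambda>D n. chains_in D (Suc n)) (realize_path G) (\<lambda>n v. paths G (Suc n) v) path_act"
proof unfold_locales
  fix D D' :: "nat \<Rightarrow> nat" and n assume "D \<le> D'"
  then show "chains_in D (Suc n) \<subseteq> chains_in D' (Suc n)"
    by (auto simp: chains_in_def chain_in_def intro: order_trans)
next
  fix l y n assume "l \<in> mor G" "y \<in> chains_in (deg G l) (Suc n)"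
  then show "realize_path G l y \<in> paths G (Suc n) (src G l)"
    using realize_path_in_paths[of l y] by (simp add: chains_in_def)
next
  fix x n v assume x: "x \<in> paths G (Suc n) v"
  obtain l xs where l: "l \<in> mor G" "src G l = v" "chain_in (deg G l) xs" "length xs = Suc n" "x = realize_path G l xs"
    by (rule path_is_realized[OF x])
  show "\<exists>l y. l \<in> mor G \<and> v = src G l \<and> y \<in> chains_in (deg G l) (Suc n) \<and> x = realize_path G l y"
    by (intro exI[of _ l] exI[of _ xs]) (use l in \<open>simp add: chains_in_def\<close>)
next
  fix l w y n assume "l \<in> mor G" "w \<in> mor G" "src G l = rng G w" "y \<in> chains_in (deg G l) (Suc n)"
  then show "realize_path G (cmp G l w) y = path_act (realize_path G l y) w"
    using realize_path_act[of l w y] by (simp add: chains_in_def)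
qed

lemma modelled_cube_bd:
  "modelled (\<lambda>D. boxes_in D (Suc n)) (realize_cube G) (\<lambda>D. boxes_in D n) (realize_cube G)
     (\<lambda>v. cube_bd (slice G v) (Suc n)) box_bd"
  unfolding modelled_def
proof (intro ballI conjI)
  fix l y assume l: "l \<in> mor G" "y \<in> boxes_in (deg G l) (Suc n)"
  then show "cube_bd (slice G (src G l)) (Suc n) (realize_cube G l y) = push (realize_cube G l) (box_bd y)"
    using cube_bd_realize[of l "fst y" "snd y"] by (simp add: boxes_in_def)
  show "supp (box_bd y) \<subseteq> boxes_in (deg G l) n" by (rule keys_box_bd_boxes_in[OF l(2)])
qed

lemma modelled_path_bd:
  "modelled (\<lambda>D. chains_in D (Suc (Suc n))) (realize_path G) (\<lambda>D. chains_in D (Suc n)) (realize_path G)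
     (\<lambda>v. path_bd G (Suc n)) simplex_bd"
  unfolding modelled_def
proof (intro ballI conjI)
  fix l y assume l: "l \<in> mor G" "y \<in> chains_in (deg G l) (Suc (Suc n))"
  then show "path_bd G (Suc n) (realize_path G l y) = push (realize_path G l) (simplex_bd y)"
    using path_bd_realize[of l y "Suc n"] by (simp add: chains_in_def One_nat_def)
  show "supp (simplex_bd y) \<subseteq> chains_in (deg G l) (Suc n)"
    by (rule keys_simplex_bd_chains_in[OF l(2)])
qed

lemma modelled_nabla:
  "modelled (\<lambda>D. boxes_in D n) (realize_cube G) (\<lambda>D. chains_in D (Suc n)) (realize_path G)
     (\<lambda>v. nabla_basis G n) shuffle"
  unfolding modelled_def
proof (intro ballI conjI)
  fix l y assume l: "l \<in> mor G" "y \<in> boxes_in (deg G l) n"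
  then show "nabla_basis G n (realize_cube G l y) = push (realize_path G l) (shuffle y)"
    using nabla_basis_realize[of l "fst y" "snd y"] by (simp add: boxes_in_def)
  show "supp (shuffle y) \<subseteq> chains_in (deg G l) (Suc n)"
    by (rule keys_shuffle_chains_in[OF l(2)])
qed

lemma modelled_square:
  "modelled (\<lambda>D. chains_in D (Suc n)) (realize_path G) (\<lambda>D. boxes_in D n) (realize_cube G)
     (\<lambda>v. square_basis k G n v) (aw k)"
  unfolding modelled_def
proof (intro ballI conjI)
  fix l y assume l: "l \<in> mor G" "y \<in> chains_in (deg G l) (Suc n)"
  then show "square_basis k G n (src G l) (realize_path G l y) = push (realize_cube G l) (aw k y)"
    using square_basis_realize[of l y n] by (simp add: chains_in_def)
  show "supp (aw k y) \<subseteq> boxes_in (deg G l) n"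
    by (rule keys_aw_boxes_in[OF l(2) deg_Nvec[OF l(1)]])
qed

lemma aw_bd:
  "l \<in> mor G \<Longrightarrow> y \<in> chains_in (deg G l) n \<Longrightarrow> frag_extend box_bd (aw k y) = frag_extend (aw k) (simplex_bd y)"
  using chain_in_Nvec[OF _ deg_Nvec, of l y] by (intro aw_chain_map) (auto simp: chains_in_def chain_in_def)

lemma shuffle_point:
  assumes "y \<in> boxes_in D 0" shows "shuffle y = frag_of [fst y]"
proof -
  have "snd y = {}" using assms by (auto simp: boxes_in_def box_in_def)
  then show ?thesis using shuffle_empty[of "fst y"] by (metis prod.collapse)
qed

lemma chains_in_1_cases:
  assumes "y \<in> chains_in D (Suc 0)" obtains p where "y = [p]"
  using assms by (cases y) (auto simp: chains_in_def)

lemma basis_action_cubes: "basis_action G (\<lambda>n v. cubes k (slice G v) n) cube_act"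
proof unfold_locales
  fix l x n assume "l \<in> mor G" "x \<in> cubes k (slice G (rng G l)) n"
  then show "cube_act x l \<in> cubes k (slice G (src G l)) n"
    by (rule realization.act_closed[OF realization_cubes])
next
  fix v x n assume "v \<in> vertices G" "x \<in> cubes k (slice G v) n"
  then show "cube_act x v = x"
    using cmp_src[of "snd x"] by (auto simp: cubes_def slice_def)
next
  fix l l' x n assume "l \<in> mor G" "l' \<in> mor G" "src G l = rng G l'" "x \<in> cubes k (slice G (rng G l)) n"
  then show "cube_act x (cmp G l l') = cube_act (cube_act x l) l'"
    using cmp_assoc[of "snd x" l l'] by (auto simp: cubes_def slice_def)
qed

lemma last_path:
  assumes "ls \<in> paths G (Suc n) v"
  shows "last ls \<in> mor G" "src G (last ls) = v" "ls \<noteq> []"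
  using assms last_in_set[of ls] by (auto simp: paths_def composable_def)

lemma basis_action_paths: "basis_action G (\<lambda>n v. paths G (Suc n) v) path_act"
proof unfold_locales
  fix l x n assume "l \<in> mor G" "x \<in> paths G (Suc n) (rng G l)"
  then show "path_act x l \<in> paths G (Suc n) (src G l)"
    by (rule realization.act_closed[OF realization_paths])
next
  fix v x n assume "v \<in> vertices G" "x \<in> paths G (Suc n) v"
  then show "path_act x v = x" using last_path[of x n v] cmp_src[of "last x"] by simp
next
  fix l l' x n assume "l \<in> mor G" "l' \<in> mor G" "src G l = rng G l'" "x \<in> paths G (Suc n) (rng G l)"
  then show "path_act x (cmp G l l') = path_act (path_act x l) l'"
    using last_path[of x n "rng G l"] cmp_assoc[of "last x" l l'] by simp
qed

lemma basis_complex_cubes: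
  "basis_complex G (\<lambda>n v. cubes k (slice G v) n) cube_act (\<lambda>n v. cube_bd (slice G v) n)"
proof (rule basis_complexI[OF realization_cubes basis_action_cubes modelled_cube_bd])
  fix l n y assume "l \<in> mor G" "y \<in> boxes_in (deg G l) (Suc (Suc n))"
  then show "frag_extend box_bd (box_bd y) = 0" using box_bd_bd boxes_in_colors by blast
qed (simp add: box_bd_def augmentation_sum augmentation_cmul augmentation_diff case_prod_unfold)

lemma basis_complex_paths:
  "basis_complex G (\<lambda>n v. paths G (Suc n) v) path_act (\<lambda>n v. path_bd G n)"
proof (rule basis_complexI[OF realization_paths basis_action_paths modelled_path_bd simplex_bd_bd])
  fix l y assume "y \<in> chains_in (deg G l) (Suc (Suc 0))"
  then have "length y = Suc (Suc 0)" by (simp add: chains_in_def)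
  then obtain p q where "y = [p, q]" by (cases y; cases "tl y") auto
  then show "augmentation (simplex_bd y) = 0" by (simp add: augmentation_diff)
qed

lemma simplicial_complex_eq:
  "simplicial_complex G = aug_complex (\<lambda>n v. paths G (Suc n) v) path_act (\<lambda>n v. path_bd G n)"
  by (simp add: simplicial_complex_def Suc_eq_plus1)

lemma chain_map_nabla: "chain_map G (cubical_complex k G) (simplicial_complex G) (nabla G)"
  unfolding cubical_complex_def simplicial_complex_eq nabla_def
  by (rule chain_map_modelled[OF realization_cubes realization_paths basis_complex_cubes basis_complex_paths
        modelled_cube_bd modelled_path_bd modelled_nabla])
    (simp_all add: shuffle_bd shuffle_point)

lemma chain_map_square: "chain_map G (simplicial_complex G) (cubical_complex k G) (square k G)"
  unfolding cubical_complex_def simplicial_complex_eq square_def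
  by (rule chain_map_modelled[OF realization_paths realization_cubes basis_complex_paths basis_complex_cubes
        modelled_path_bd modelled_cube_bd modelled_square])
    (auto simp: aw_bd elim: chains_in_1_cases)

section \<open>The homotopies\<close>

text \<open>The composite of the two maps on cubes is the identity on the nose, so the zero homotopy serves.\<close>

lemma square_nabla:
  assumes "x \<in> cubes k (slice G v) n"
  shows "frag_extend (square_basis k G n v) (nabla_basis G n x) = frag_of x"
proof -
  obtain l y where l: "l \<in> mor G" "v = src G l" "y \<in> boxes_in (deg G l) n" "x = realize_cube G l y"
    using assms by (rule realization.r_cases[OF realization_cubes])
  have "frag_extend (aw k) (shuffle y) = frag_of y"
    using aw_shuffle[OF boxes_in_colors[OF l(1,3)], of "fst y"] by simp
  then show ?thesis
    using modelled_comp_eq[OF modelled_nabla modelled_square l(1,3)] unfolding l(2,4) by simp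
qed

lemma composable_snoc:
  "composable G (us @ [x]) \<longleftrightarrow> x \<in> mor G \<and> (us = [] \<or> composable G us \<and> src G (last us) = rng G x)"
proof (induction us)
  case (Cons u us)
  show ?case
  proof (cases "us = []")
    case True
    then show ?thesis by (auto simp: composable_Cons)
  next
    case False
    then have "hd (us @ [x]) = hd us" by simp
    then show ?thesis using Cons False by (auto simp: composable_Cons)
  qed
qed simp

lemma path_snoc:
  assumes "ys \<in> paths G (Suc n) (rng G x)" "x \<in> mor G"
  shows "ys @ [x] \<in> paths G (Suc (Suc n)) (src G x)"
  using assms by (auto simp: paths_def composable_snoc)

lemma path_trivial_end:
  assumes "ls \<in> paths G (Suc n) v"
  defines "w \<equiv> rng G (last ls)" and "ls' \<equiv> butlast ls @ [rng G (last ls)]"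
  shows "w \<in> vertices G" "ls' \<in> paths G (Suc n) w" "path_act ls' (last ls) = ls"
proof -
  note l = last_path[OF assms(1)]
  show "w \<in> vertices G" unfolding w_def by (rule rng_vertices[OF l(1)])
  have "composable G (butlast ls @ [last ls])" using assms(1) l(3) by (simp add: paths_def)
  then have "composable G ls'" unfolding ls'_def composable_snoc using rng_mor[OF l(1)] rng_rng[OF l(1)] by simp
  then show "ls' \<in> paths G (Suc n) w"
    using assms(1) l src_rng[OF l(1)] by (simp add: paths_def ls'_def w_def)
  show "path_act ls' (last ls) = ls" using l cmp_rng[OF l(1)] by (simp add: ls'_def)
qed

text \<open>The last summand of the boundary lets the new entry act on the tuple; all others leave it at its place.\<close>

lemma path_bd_snoc:
  assumes "length ys = Suc m"
  shows "path_bd G (Suc m) (ys @ [x]) = push (\<lambda>zs. zs @ [x]) (path_bd G m ys)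
    + frag_cmul ((-1) ^ Suc m) (frag_of (path_act ys x))"
proof -
  let ?t = "\<lambda>ls i. take (i - 1) ls @ [cmp G (ls ! (i - 1)) (ls ! i)] @ drop (i + 1) ls"
  have ne: "ys \<noteq> []" using assms by auto
  have 1: "?t (ys @ [x]) i = ?t ys i @ [x]" if "i \<in> {1..m}" for i
  proof -
    have "i < length ys" "i - 1 < length ys" "i + 1 \<le> length ys" using that assms by auto
    then show ?thesis by (simp add: nth_append)
  qed
  have 2: "?t (ys @ [x]) (Suc m) = path_act ys x"
  proof -
    have "take m ys = butlast ys" "ys ! m = last ys"
      using assms ne by (simp_all add: butlast_conv_take last_conv_nth)
    then show ?thesis using assms by (simp add: nth_append)
  qed
  have r: "{1..Suc m} = insert (Suc m) {1..m}" by auto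
  have "path_bd G (Suc m) (ys @ [x]) = frag_of (tl ys @ [x])
     + (frag_cmul ((-1) ^ Suc m) (frag_of (path_act ys x))
        + (\<Sum>i=1..m. frag_cmul ((-1) ^ i) (frag_of (?t ys i @ [x]))))"
  proof -
    have "(\<Sum>i=1..m. frag_cmul ((-1) ^ i) (frag_of (?t (ys @ [x]) i)))
       = (\<Sum>i=1..m. frag_cmul ((-1) ^ i) (frag_of (?t ys i @ [x])))"
      by (intro sum.cong refl) (simp only: 1)
    then show ?thesis unfolding path_bd_def r using ne
      by (simp only: sum.insert[of "{1..m}" "Suc m"] finite_atLeastAtMost atLeastAtMost_iff 2 tl_append2
          not_less_eq_eq[symmetric] simp_thms le_refl)
  qed
  also have "\<dots> = push (\<lambda>zs. zs @ [x]) (path_bd G m ys)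
    + frag_cmul ((-1) ^ Suc m) (frag_of (path_act ys x))"
    unfolding path_bd_def frag_extend_add frag_extend_sum'[OF finite_atLeastAtMost] frag_extend_cmul frag_extend_of
    by (simp only: add_ac)
  finally show ?thesis .
qed

text \<open>Let \<open>ls'\<close> be \<open>ls\<close> with its last entry replaced by the identity at its range, a generator of the free
  module of tuples. The chain \<open>f ls' - ls' - H(\<partial>ls')\<close> is a cycle, and up to sign it is the boundary of
  what results from appending the end vertex. Letting the last entry of \<open>ls\<close> act turns the appended
  vertex into this entry. In degree \<open>0\<close> the homotopy is zero, for maps \<open>f\<close> that are the identity there.\<close>

primrec recursive_homotopy ::
    "(nat \<Rightarrow> 'a \<Rightarrow> 'a list \<Rightarrow> ('a list \<Rightarrow>\<^sub>0 int)) \<Rightarrow> nat \<Rightarrow> 'a list \<Rightarrow> ('a list \<Rightarrow>\<^sub>0 int)" where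
  "recursive_homotopy f 0 ls = 0"
| "recursive_homotopy f (Suc n) ls = frag_cmul ((-1) ^ n) (push (\<lambda>ys. ys @ [last ls])
     (f (Suc n) (rng G (last ls)) (butlast ls @ [rng G (last ls)]) - frag_of (butlast ls @ [rng G (last ls)])
       - frag_extend (recursive_homotopy f n) (path_bd G (Suc n) (butlast ls @ [rng G (last ls)]))))"

text \<open>The homotopy depends on the last entry only through its range, except for appending it.\<close>

lemma recursive_homotopy_act:
  assumes "w \<in> mor G" "ls \<in> paths G (Suc n) (rng G w)"
  shows "recursive_homotopy f n (path_act ls w) = push (\<lambda>ys. path_act ys w) (recursive_homotopy f n ls)"
proof (cases n)
  case (Suc m)
  note l = last_path[OF assms(2)]
  have "rng G (cmp G (last ls) w) = rng G (last ls)" by (rule rng_cmp[OF l(1) assms(1) l(2)])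
  then show ?thesis unfolding Suc by (simp add: frag_extend_cmul frag_extend_frag_extend)
qed simp

context
  fixes f :: "nat \<Rightarrow> 'a \<Rightarrow> 'a list \<Rightarrow> ('a list \<Rightarrow>\<^sub>0 int)"
  assumes f_keys: "\<And>n v x. v \<in> vertices G \<Longrightarrow> x \<in> paths G (Suc n) v \<Longrightarrow> supp (f n v x) \<subseteq> paths G (Suc n) v"
    and f_act: "\<And>n w x. w \<in> mor G \<Longrightarrow> x \<in> paths G (Suc n) (rng G w) \<Longrightarrow>
      f n (src G w) (path_act x w) = push (\<lambda>y. path_act y w) (f n (rng G w) x)"
    and f_bd: "\<And>n v x. v \<in> vertices G \<Longrightarrow> x \<in> paths G (Suc (Suc n)) v \<Longrightarrow>
      frag_extend (path_bd G (Suc n)) (f (Suc n) v x) = frag_extend (f n v) (path_bd G (Suc n) x)"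
    and f_0: "\<And>v x. v \<in> vertices G \<Longrightarrow> x \<in> paths G (Suc 0) v \<Longrightarrow> f 0 v x = frag_of x"
begin

lemma recursive_homotopy_props:
  assumes "v \<in> vertices G" "ls \<in> paths G (Suc n) v"
  shows "supp (recursive_homotopy f n ls) \<subseteq> paths G (Suc (Suc n)) v \<and>
    frag_extend (path_bd G (Suc n)) (recursive_homotopy f n ls)
      + (if n = 0 then 0 else frag_extend (recursive_homotopy f (n - 1)) (path_bd G n ls))
      = f n v ls - frag_of ls"
  using assms
proof (induction n arbitrary: v ls)
  case 0
  then show ?case by (simp add: f_0)
next
  case (Suc n)
  let ?H = "recursive_homotopy f"
  let ?x = "last ls"
  define w where "w = rng G ?x"
  define ls' where "ls' = butlast ls @ [rng G ?x]"
  note l = last_path[OF Suc.prems(2)]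
  note t = path_trivial_end[OF Suc.prems(2), folded w_def ls'_def]
  define Z where "Z = f (Suc n) w ls' - frag_of ls' - frag_extend (?H n) (path_bd G (Suc n) ls')"
  have bk: "supp (path_bd G (Suc n) ls') \<subseteq> paths G (Suc n) w"
    by (rule basis_complex.bo_keys[OF basis_complex_paths t(1,2)])
  have Hk: "supp (frag_extend (?H n) (path_bd G (Suc n) ls')) \<subseteq> paths G (Suc (Suc n)) w"
    by (rule keys_frag_extend_subset[OF bk]) (use Suc.IH[OF t(1)] in blast)
  have Zk: "supp Z \<subseteq> paths G (Suc (Suc n)) w"
  proof -
    have "supp (f (Suc n) w ls' - frag_of ls') \<subseteq> paths G (Suc (Suc n)) w"
      by (rule subset_trans[OF keys_diff]) (use f_keys[OF t(1,2)] t(2) in auto)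
    then show ?thesis unfolding Z_def by (intro subset_trans[OF keys_diff]) (use Hk in auto)
  qed
  \<comment> \<open>The boundary of \<open>H(\<partial>ls')\<close> is known by induction, and \<open>\<partial>\<partial> = 0\<close>.\<close>
  have Zbd: "frag_extend (path_bd G (Suc n)) Z = 0"
  proof -
    let ?c = "path_bd G (Suc n) ls'"
    have "frag_extend (\<lambda>y. frag_extend (path_bd G (Suc n)) (?H n y)
        + (if n = 0 then 0 else frag_extend (?H (n - 1)) (path_bd G n y))) ?c
      = frag_extend (\<lambda>y. f n w y - frag_of y) ?c"
      by (rule frag_extend_cong[OF bk]) (use Suc.IH[OF t(1)] in blast)
    moreover have "frag_extend (\<lambda>y. if n = 0 then 0 else frag_extend (?H (n - 1)) (path_bd G n y)) ?c = 0"
    proof (cases n)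
      case 0
      then show ?thesis by (simp add: frag_extend_eq_0)
    next
      case (Suc m)
      have "frag_extend (path_bd G n) ?c = 0"
        unfolding Suc by (rule basis_complex.bo_bo[OF basis_complex_paths t(1)]) (use t(2) Suc in simp)
      then have "frag_extend (?H (n - 1)) (frag_extend (path_bd G n) ?c) = 0" by simp
      then show ?thesis using Suc by (simp add: frag_extend_frag_extend)
    qed
    ultimately have "frag_extend (path_bd G (Suc n)) (frag_extend (?H n) ?c) = frag_extend (f n w) ?c - ?c"
      unfolding frag_extend_plus_fun frag_extend_diff_fun by (simp add: frag_extend_frag_extend)
    then show ?thesis
      unfolding Z_def frag_extend_diff by (simp add: f_bd[OF t(1,2)])
  qed
  have H: "?H (Suc n) ls = frag_cmul ((-1) ^ n) (push (\<lambda>ys. ys @ [?x]) Z)"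
    by (simp add: Z_def w_def ls'_def)
  have keys: "supp (?H (Suc n) ls) \<subseteq> paths G (Suc (Suc (Suc n))) v"
  proof -
    have "supp (push (\<lambda>ys. ys @ [?x]) Z) \<subseteq> paths G (Suc (Suc (Suc n))) v"
    proof (rule keys_frag_extend_subset[OF Zk])
      fix ys assume "ys \<in> paths G (Suc (Suc n)) w"
      then show "supp (frag_of (ys @ [?x])) \<subseteq> paths G (Suc (Suc (Suc n))) v"
        using path_snoc[of ys "Suc n" ?x] l w_def by simp
    qed
    then show ?thesis unfolding H by (rule subset_trans[OF keys_cmul])
  qed
  have "frag_extend (path_bd G (Suc (Suc n))) (push (\<lambda>ys. ys @ [?x]) Z)
     = frag_extend (\<lambda>ys. push (\<lambda>zs. zs @ [?x]) (path_bd G (Suc n) ys)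
        + frag_cmul ((-1) ^ Suc (Suc n)) (frag_of (path_act ys ?x))) Z"
    unfolding frag_extend_frag_extend[of "path_bd G (Suc (Suc n))"]
  proof (rule frag_extend_cong[OF Zk])
    fix ys assume "ys \<in> paths G (Suc (Suc n)) w"
    then have "length ys = Suc (Suc n)" by (simp add: paths_def)
    then show "frag_extend (path_bd G (Suc (Suc n))) (frag_of (ys @ [?x]))
      = push (\<lambda>zs. zs @ [?x]) (path_bd G (Suc n) ys) + frag_cmul ((-1) ^ Suc (Suc n)) (frag_of (path_act ys ?x))"
      using path_bd_snoc[of ys "Suc n" ?x] by simp
  qed
  also have "\<dots> = push (\<lambda>zs. zs @ [?x]) (frag_extend (path_bd G (Suc n)) Z)
      + frag_cmul ((-1) ^ n) (push (\<lambda>ys. path_act ys ?x) Z)"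
    by (simp add: frag_extend_plus_fun frag_extend_frag_extend frag_extend_cmul_fun)
  finally have "frag_extend (path_bd G (Suc (Suc n))) (?H (Suc n) ls) = push (\<lambda>ys. path_act ys ?x) Z"
    unfolding H frag_extend_cmul Zbd by (simp flip: power_mult_distrib)
  also have "\<dots> = f (Suc n) v ls - frag_of ls - frag_extend (?H n) (path_bd G (Suc n) ls)"
  proof -
    have 1: "push (\<lambda>ys. path_act ys ?x) (f (Suc n) w ls') = f (Suc n) v ls"
      using f_act[OF l(1), of ls' "Suc n"] t(2,3) l(2) unfolding w_def by simp
    have "push (\<lambda>ys. path_act ys ?x) (frag_extend (?H n) (path_bd G (Suc n) ls'))
      = frag_extend (\<lambda>y. ?H n (path_act y ?x)) (path_bd G (Suc n) ls')"
      unfolding frag_extend_frag_extend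
    proof (rule frag_extend_cong[OF bk])
      fix y assume "y \<in> paths G (Suc n) w"
      then show "push (\<lambda>ys. path_act ys ?x) (?H n y) = ?H n (path_act y ?x)"
        using recursive_homotopy_act[OF l(1), of y n f] unfolding w_def by simp
    qed
    also have "\<dots> = frag_extend (?H n) (push (\<lambda>ys. path_act ys ?x) (path_bd G (Suc n) ls'))"
      by (simp only: frag_extend_frag_extend frag_extend_of)
    also have "push (\<lambda>ys. path_act ys ?x) (path_bd G (Suc n) ls') = path_bd G (Suc n) ls"
    proof -
      have "path_bd G (Suc n) (path_act ls' ?x) = push (\<lambda>ys. path_act ys ?x) (path_bd G (Suc n) ls')"
        by (rule basis_complex.bo_act[OF basis_complex_paths l(1)]) (use t(2) in \<open>simp only: w_def\<close>)
      then show ?thesis unfolding t(3) by simp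
    qed
    finally show ?thesis unfolding Z_def frag_extend_diff 1 using t(3) by simp
  qed
  finally show ?case using keys by simp
qed

lemma self_map_homotopic_id:
  assumes F: "\<And>n v z c. v \<in> vertices G \<Longrightarrow> (z, c) \<in> carrier (aug_grp (\<lambda>n v. paths G (Suc n) v) n v) \<Longrightarrow>
      F n v (z, c) = (z, frag_extend (f (nat n) v) c)"
  shows "chain_homotopic G (aug_complex (\<lambda>n v. paths G (Suc n) v) path_act (\<lambda>n v. path_bd G n))
     (aug_complex (\<lambda>n v. paths G (Suc n) v) path_act (\<lambda>n v. path_bd G n)) F (\<lambda>n v. id)"
proof (rule basis_complex.chain_homotopic_id_aug[OF basis_complex_paths,
    where F = F and f = f and h = "\<lambda>n v. recursive_homotopy f n"])
  fix n v x assume "v \<in> vertices G" "x \<in> paths G (Suc (Suc n)) v"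
  then show "frag_extend (path_bd G (Suc (Suc n))) (recursive_homotopy f (Suc n) x)
     + frag_extend (recursive_homotopy f n) (path_bd G (Suc n) x) = f (Suc n) v x - frag_of x"
    using recursive_homotopy_props[of v x "Suc n"] by simp
next
  fix v x assume "v \<in> vertices G" "x \<in> paths G (Suc 0) v"
  then show "frag_extend (path_bd G (Suc 0)) (recursive_homotopy f 0 x) = f 0 v x - frag_of x"
    by (simp add: f_0)
next
  fix n v z c assume "v \<in> vertices G" "(z, c) \<in> carrier (aug_grp (\<lambda>n v. paths G (Suc n) v) n v)"
  then show "F n v (z, c) = (z, frag_extend (f (nat n) v) c)" by (rule F)
next
  fix n v x assume "v \<in> vertices G" "x \<in> paths G (Suc n) v"
  then show "supp (recursive_homotopy f n x) \<subseteq> paths G (Suc (Suc n)) v"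
    using recursive_homotopy_props by blast
qed (rule recursive_homotopy_act)

end

lemma square_nabla_homotopic_id:
  "chain_homotopic G (cubical_complex k G) (cubical_complex k G) (\<lambda>n v. square k G n v \<circ> nabla G n v) (\<lambda>n v. id)"
  unfolding cubical_complex_def
proof (rule basis_complex.chain_homotopic_id_aug[OF basis_complex_cubes,
    where f = "\<lambda>n v x. frag_extend (square_basis k G n v) (nabla_basis G n x)" and h = "\<lambda>n v x. 0"])
  fix n v z c assume "(z, c) \<in> carrier (aug_grp (\<lambda>n v. cubes k (slice G v) n) n v)"
  then show "(square k G n v \<circ> nabla G n v) (z, c)
     = (z, frag_extend (\<lambda>x. frag_extend (square_basis k G (nat n) v) (nabla_basis G (nat n) x)) c)"
    by (simp add: aug_carrier square_def nabla_def aug_map_def frag_extend_frag_extend split: if_splits)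
qed (simp_all add: square_nabla frag_extend_eq_0)

lemma nabla_square_homotopic_id:
  "chain_homotopic G (simplicial_complex G) (simplicial_complex G) (\<lambda>n v. nabla G n v \<circ> square k G n v) (\<lambda>n v. id)"
proof -
  let ?f = "\<lambda>n v x. frag_extend (nabla_basis G n) (square_basis k G n v x)"
  let ?F = "\<lambda>y. frag_extend shuffle (aw k y)"
  note f = modelled_comp[OF modelled_square modelled_nabla]
  show ?thesis
    unfolding simplicial_complex_eq
  proof (rule self_map_homotopic_id[where f = ?f])
    fix n v x assume "x \<in> paths G (Suc n) v"
    then show "supp (?f n v x) \<subseteq> paths G (Suc n) v"
      by (rule modelled_keys[OF realization_paths realization_paths f])
  next
    fix n w x assume "w \<in> mor G" "x \<in> paths G (Suc n) (rng G w)"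
    then show "?f n (src G w) (path_act x w) = push (\<lambda>y. path_act y w) (?f n (rng G w) x)"
      by (rule modelled_act[OF realization_paths realization_paths f])
  next
    fix n v x assume x: "x \<in> paths G (Suc (Suc n)) v"
    show "frag_extend (path_bd G (Suc n)) (?f (Suc n) v x) = frag_extend (?f n v) (path_bd G (Suc n) x)"
    proof (rule modelled_eq[OF realization_paths f modelled_path_bd modelled_path_bd f _ x])
      fix l y assume l: "l \<in> mor G" "y \<in> chains_in (deg G l) (Suc (Suc n))"
      have "frag_extend simplex_bd (?F y) = frag_extend (\<lambda>z. frag_extend shuffle (box_bd z)) (aw k y)"
        unfolding frag_extend_frag_extend
        by (rule frag_extend_cong[OF keys_aw_boxes_in[OF l(2) deg_Nvec[OF l(1)]]]) (rule shuffle_bd)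
      also have "\<dots> = frag_extend shuffle (frag_extend box_bd (aw k y))"
        by (simp only: frag_extend_frag_extend)
      also have "\<dots> = frag_extend ?F (simplex_bd y)"
        unfolding aw_bd[OF l] by (simp only: frag_extend_frag_extend)
      finally show "frag_extend simplex_bd (?F y) = frag_extend ?F (simplex_bd y)" .
    qed
  next
    fix v x assume "x \<in> paths G (Suc 0) v"
    then obtain l y where l: "l \<in> mor G" "v = src G l" "y \<in> chains_in (deg G l) (Suc 0)" "x = realize_path G l y"
      by (rule realization.r_cases[OF realization_paths])
    obtain p where "y = [p]" using l(3) by (rule chains_in_1_cases)
    then show "?f 0 v x = frag_of x"
      using modelledD(1)[OF f l(1,3)] unfolding l(2,4) by (simp add: shuffle_empty)
  next
    fix n v z c assume "(z, c) \<in> carrier (aug_grp (\<lambda>n v. paths G (Suc n) v) n v)"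
    then show "(nabla G n v \<circ> square k G n v) (z, c) = (z, frag_extend (?f (nat n) v) c)"
      by (simp add: aug_carrier square_def nabla_def aug_map_def frag_extend_frag_extend split: if_splits)
  qed
qed

end

theorem proposition7p18:
  fixes k :: nat and \<Lambda> :: "'a dgraph"
  assumes "kgraph k \<Lambda>"
  shows "chain_complex \<Lambda> (cubical_complex k \<Lambda>)
    \<and> chain_complex \<Lambda> (simplicial_complex \<Lambda>)
    \<and> homotopy_equivalence_by \<Lambda> (cubical_complex k \<Lambda>) (simplicial_complex \<Lambda>)
        (nabla \<Lambda>) (square k \<Lambda>)"
proof -
  interpret kgraph k \<Lambda> by fact
  have "chain_complex \<Lambda> (cubical_complex k \<Lambda>)"
    unfolding cubical_complex_def by (rule basis_complex.chain_complex_aug[OF basis_complex_cubes])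
  moreover have "chain_complex \<Lambda> (simplicial_complex \<Lambda>)"
    unfolding simplicial_complex_eq by (rule basis_complex.chain_complex_aug[OF basis_complex_paths])
  ultimately show ?thesis
    unfolding homotopy_equivalence_by_def
    using chain_map_nabla chain_map_square square_nabla_homotopic_id nabla_square_homotopic_id
    unfolding simplicial_complex_eq by blast
qed

end
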